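(* Let $\lambda,\mu$ be strict partitions. (1) For every admissible input $(S,(i,j),d,k)$ of the bump of type B or type D, the indices $i'$, $j'$ and $k'$ in the bump are well defined, and $S'$ is a well-defined shifted bicolored tableau (of the same type). (2) The insertion processes of type B and type D always terminate and are weight-preserving bijections $$\psi^B_\mu \colon \mathcal B^B(\mu) \times \{x_1,x_2,x_3,\ldots \} \longrightarrow \bigcup_{\nu} \mathcal B^B(\nu),\qquad \psi^D_\mu \colon \mathcal B^D(\mu) \times \{x_1,x_2,x_3,\ldots \} \longrightarrow \bigcup_{\nu} \mathcal B^D(\nu),$$ where the unions are over all strict partitions $\nu$ which cover $\mu$ (and the variable $x_k$ is identified with its index $k$). (3) The repeated insertion processes of type B and type D always terminate and are weight-preserving bijections $$\Psi^B_{\mu,\lambda} \colon \mathcal B^B(\mu,\lambda) \times \mathcal W^B(\mu,\lambda) \longrightarrow \bigcup_{\nu} \mathcal B^B(\nu,\lambda),\qquad \Psi^D_{\mu,\lambda} \colon \mathcal B^D(\mu,\lambda) \times \mathcal W^D(\mu,\lambda) \longrightarrow \bigcup_{\nu} \mathcal B^D(\nu,\lambda),$$ where the unions are over all strict partitions $\nu$ which cover $\mu$ and are contained in $\lambda$. Here weight-preserving means that the image of $(S,k)$ has weight $w(S)\cdot x_k$, where $w=w^B$ in type B and $w=w^D$ in type D.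
   Context: **Partitions.** A strict partition is a strictly decreasing finite (possibly empty) sequence $\lambda=(\lambda_1,\ldots,\lambda_\ell)$ of positive integers; $\ell(\lambda)=\ell$, $|\lambda|=\sum\lambda_i$, $\lambda_i=0$ for $i>\ell(\lambda)$. Shifted diagrams: $[\lambda]^B=\{(i,j): 1\le i\le \ell(\lambda),\ i\le j\le \lambda_i+i-1\}$ and $[\lambda]^D=\{(i,j): 1\le i\le \ell(\lambda),\ i< j\le \lambda_i+i\}$ ($i$ = row, $j$ = column). The diagonal cells are $(i,i)$ in type B and $(i,i+1)$ in type D. $\mu\subseteq\lambda$ means $[\mu]^B\subseteq[\lambda]^B$; $\nu$ covers $\mu$ if $\mu\subseteq\nu$ and $|\nu|-|\mu|=1$. In both types $\lambda'_i$ ($i\ge 1$) is the number of cells in column $i$ of $[\lambda]^B$. **Sets $\mathcal W$.** $\mathcal W^B(\mu,\lambda)$ is the set of positive integers $k$ such that either $k\le\ell(\lambda)$ and $\lambda_k\ne\mu_i$ for all $i$, or $k\ge\ell(\lambda)+1$ and $\lambda'_k-k\neq\mu'_i-i$ for all $i\ge1$. $\mathcal W^D(\mu,\lambda)$ consists of: all $k\le\ell(\lambda)$ with $\lambda_k\ne\mu_i$ for all $i$; $\ell(\lambda)+1$ if $\ell(\lambda)-\ell(\mu)$ is odd; and all $k\ge\ell(\lambda)+2$ with $\lambda'_{k-1}-(k-1)\neq\mu'_i-i$ for all $i\ge1$. **Bicolored tableaux.** A shifted bicolored tableau of type B (resp. D) and shape $\mu$ is a filling $T$ of $[\mu]^B$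 (resp. $[\mu]^D$) by non-negative integers $T_{ij}$, each colored black or red, weakly increasing along rows and down columns (colors are ignored for monotonicity), such that in type B the diagonal entries are black, and in type D the diagonal entries are even (of either color). $\mathcal B^B(\mu)$, $\mathcal B^D(\mu)$ are the sets of all of them. $\mathcal B^B(\mu,\lambda)\subseteq\mathcal B^B(\mu)$ consists of those $T$ with $j\le\lambda_{i+T_{ij}}+i-1$ for all cells $(i,j)$ of $[\mu]^B$; $\mathcal B^D(\mu,\lambda)\subseteq\mathcal B^D(\mu)$ of those with $j\le\lambda_{i+T_{ij}}+i$ for all cells of $[\mu]^D$. The variable index represented by a black entry $T_{ij}$ is $i+T_{ij}$, by a red entry $j+T_{ij}$. The weight $w^B(T)$ (resp. $w^D(T)$) is the product over all cells of $x_k$, where $k$ is the variable index represented by the entry in the cell. **Bump, general.** Input: a bicolored tableau $S$ of shape $\mu$, a cell $(i,j)\in[\mu]\cup\{(0,0)\}$, a direction $d\in\{\downarrow,\rightarrow\}$, and a variable index $k\ge1$. Output: $S'$, a cell $(i',j')$, a direction $d'\in\{\downarrow,\rightarrow,\circ\}$, and an index $k'$. The input is admissible if either $(i,j)=(0,0)$ and $d=\downarrow$ ($k\geq 1$ arbitrary), or $(i,j)\in[\mu]$ and $k$ can be in position $(i,j)$, as a black $k-i$ if $d=\rightarrow$, or as a red $k-j$ if $d=\downarrow$ (in type D: if $d=\downarrow$ then $(i,j)$ is not on the diagonal, and if $d=\rightarrow$ and $(i,j)$ is on the diagonal then $k$ may also be there as a red $k-j$). Here "can be in position $(i,j)$"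 means that the new value is at least the current entry $S_{ij}$ and that replacing the entry of $S$ in $(i,j)$ by that colored value yields a bicolored tableau of the same type. Conventions: $S_{0,c}=0$ for all $c$; $S_{r,c}=\infty$ for positions $(r,c)$, $r\ge1$, on or to the right of the diagonal which are not in $[\mu]$; the position directly below a diagonal position counts as $\infty$; the position directly to the left of a diagonal position counts as $0$. **Bump of type B.** If $d=\rightarrow$: set $j'=j+1$ and let $i'$, $1\le i'\le j'$, be the largest index with $S_{i'-1,j'}\le k-i'\le S_{i'+1,j'}$; $S'$ is $S$ with a black $k-i'$ written in position $(i',j')$ (replacing the old entry, if any). If $d=\downarrow$: set $i'=i+1$ and let $j'\ge i'$ be the largest index with $S_{i',j'-1}\le k-j'\le S_{i',j'+1}$; $S'$ is $S$ with a red $k-j'$ written in $(i',j')$, except that it is black if $i'=j'$. In both cases: if $(i',j')\notin[\mu]^B$, then $d'=\circ$ and $k'=\infty$ (stop). If $(i',j')\in[\mu]^B$ and the old entry $S_{i'j'}$ is black, then $d'=\rightarrow$, $k'=S_{i'j'}+i'$; if it is red, then $d'=\downarrow$, $k'=S_{i'j'}+j'$. **Bump of type D.** In a diagonal position $(r,r+1)$, $x_k$ is always written as the even one of: a black $k-r$, a red $k-r-1$. If $d=\rightarrow$: set $j'=j+1$ and let $i'$, $1\le i'\le j'-1$, be the largest index such that $S_{i'-1,j'}\le v\le S_{i'+1,j'}$, where $v=k-i'$ (black) if $i'<j'-1$, and $v\ge 0$ is the value of the even entry representing $x_k$ if $i'=j'-1$; write this colored entry in $(i',j')$. If $d=\downarrow$: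 set $i'=i+1$ and let $j'\ge i'+1$ be the largest index such that $S_{i',j'-1}\le v\le S_{i',j'+1}$, where $v=k-j'$ (red) if $j'>i'+1$, and $v\ge0$ is the value of the even entry representing $x_k$ if $j'=i'+1$; write this colored entry in $(i',j')$. If $(i',j')\notin[\mu]^D$: $d'=\circ$, $k'=\infty$. Otherwise $k'$ is the variable index represented by the old entry in $(i',j')$, and $d'=\rightarrow$ if the old entry is black or $(i',j')$ is on the diagonal, $d'=\downarrow$ if the old entry is red and $(i',j')$ is not on the diagonal. **Insertion process.** Given $S$ of shape $\mu$ and an index $k$: perform the bump on $S$, $(0,0)$, $\downarrow$, $k$; then repeatedly perform the bump on the output $S',(i',j'),d',k'$ of the previous bump, until the direction is $\circ$; output the last tableau. **Repeated insertion process.** Given $S$ in $\mathcal B(\mu,\lambda)$ and $k\in\mathcal W(\mu,\lambda)$ (both of the same type): perform the insertion process with $S$ and $k$, obtaining $S'$ of some shape $\nu$ covering $\mu$. If $\nu\subseteq\lambda$ and $S'\in\mathcal B(\nu,\lambda)$, output $S'$. Otherwise let $k'$ be the variable index represented by the entry of $S'$ in the unique cell of $[\nu]\setminus[\mu]$, remove that cell from $S'$, and perform the insertion process with the resulting tableau of shape $\mu$ and $k'$; continue in the same manner until the result is in some $\mathcal B(\nu,\lambda)$ with $\nu\subseteq\lambda$ covering $\mu$. *)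

theory Defs
  imports Main "HOL-Library.Extended_Nat" "HOL-Library.Poly_Mapping"
begin

definition strict_partition :: "nat list \<Rightarrow> bool" where
  "strict_partition l \<longleftrightarrow> sorted_wrt (>) l \<and> 0 \<notin> set l"

(* Parts are indexed from 1; there are infinitely many trailing zero parts. *)
definition part :: "nat list \<Rightarrow> nat \<Rightarrow> nat" where
  "part l i = (if 1 \<le> i \<and> i \<le> length l then l ! (i - 1) else 0)"

datatype ttype = TypeB | TypeD

type_synonym cell = "nat \<times> nat"  (* (row, column) *)

fun diagram :: "ttype \<Rightarrow> nat list \<Rightarrow> cell set" where
  "diagram TypeB l = {(i, j). 1 \<le> i \<and> i \<le> length l \<and> i \<le> j \<and> j \<le> part l i + i - 1}"
| "diagram TypeD l = {(i, j). 1 \<le> i \<and> i \<le> length l \<and> i < j \<and> j \<le> part l i + i}"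

fun diagonal :: "ttype \<Rightarrow> cell \<Rightarrow> bool" where
  "diagonal TypeB (i, j) \<longleftrightarrow> j = i"
| "diagonal TypeD (i, j) \<longleftrightarrow> j = i + 1"

fun right_of_or_on_diagonal :: "ttype \<Rightarrow> cell \<Rightarrow> bool" where
  "right_of_or_on_diagonal TypeB (i, j) \<longleftrightarrow> i \<le> j"
| "right_of_or_on_diagonal TypeD (i, j) \<longleftrightarrow> i + 1 \<le> j"

definition contained :: "nat list \<Rightarrow> nat list \<Rightarrow> bool" where
  "contained m l \<longleftrightarrow> diagram TypeB m \<subseteq> diagram TypeB l"

definition covers :: "nat list \<Rightarrow> nat list \<Rightarrow> bool" where
  "covers n m \<longleftrightarrow> contained m n \<and> sum_list n = sum_list m + 1"

(* The type B diagram is used in both types. *)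
definition col_length :: "nat list \<Rightarrow> nat \<Rightarrow> nat" where
  "col_length l i = card {r. (r, i) \<in> diagram TypeB l}"

fun index_set :: "ttype \<Rightarrow> nat list \<Rightarrow> nat list \<Rightarrow> nat set" where
  "index_set TypeB m l =
     {k. 1 \<le> k \<and> k \<le> length l \<and> (\<forall>i\<ge>1. part l k \<noteq> part m i)} \<union>
     {k. length l + 1 \<le> k \<and>
         (\<forall>i\<ge>1. int (col_length l k) - int k \<noteq> int (col_length m i) - int i)}"
| "index_set TypeD m l =
     {k. 1 \<le> k \<and> k \<le> length l \<and> (\<forall>i\<ge>1. part l k \<noteq> part m i)} \<union>
     {k. k = length l + 1 \<and> odd (int (length l) - int (length m))} \<union>
     {k. length l + 2 \<le> k \<and>
         (\<forall>i\<ge>1. int (col_length l (k - 1)) - (int k - 1) \<noteq> int (col_length m i) - int i)}"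

datatype color = Black | Red

type_synonym entry = "nat \<times> color"

(* A filling is a partial map whose domain is the diagram of its shape. *)
type_synonym tableau = "cell \<rightharpoonup> entry"

fun diagonal_entry :: "ttype \<Rightarrow> entry \<Rightarrow> bool" where
  "diagonal_entry TypeB (v, c) \<longleftrightarrow> c = Black"
| "diagonal_entry TypeD (v, c) \<longleftrightarrow> even v"

definition tableaux :: "ttype \<Rightarrow> nat list \<Rightarrow> tableau set" where
  "tableaux t m = {T. dom T = diagram t m \<and>
     (\<forall>i j j' e e'. T (i, j) = Some e \<and> T (i, j') = Some e' \<and> j \<le> j' \<longrightarrow> fst e \<le> fst e') \<and>
     (\<forall>i i' j e e'. T (i, j) = Some e \<and> T (i', j) = Some e' \<and> i \<le> i' \<longrightarrow> fst e \<le> fst e') \<and>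
     (\<forall>p e. T p = Some e \<and> diagonal t p \<longrightarrow> diagonal_entry t e)}"

fun bounded_tableaux :: "ttype \<Rightarrow> nat list \<Rightarrow> nat list \<Rightarrow> tableau set" where
  "bounded_tableaux TypeB m l = {T \<in> tableaux TypeB m.
     \<forall>i j v c. T (i, j) = Some (v, c) \<longrightarrow> j \<le> part l (i + v) + i - 1}"
| "bounded_tableaux TypeD m l = {T \<in> tableaux TypeD m.
     \<forall>i j v c. T (i, j) = Some (v, c) \<longrightarrow> j \<le> part l (i + v) + i}"

fun var_index :: "cell \<Rightarrow> entry \<Rightarrow> nat" where
  "var_index (i, j) (v, Black) = i + v"
| "var_index (i, j) (v, Red) = j + v"

(* Polynomials in the variables x_1, x_2, ... over the integers: finitely supported
   coefficient functions on exponent vectors. *)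
type_synonym mpoly = "(nat \<Rightarrow>\<^sub>0 nat) \<Rightarrow>\<^sub>0 int"

definition X :: "nat \<Rightarrow> mpoly" where
  "X k = Poly_Mapping.single (Poly_Mapping.single k 1) 1"

definition weight :: "tableau \<Rightarrow> mpoly" where
  "weight T = (\<Prod>p\<in>dom T. X (var_index p (the (T p))))"

datatype direction = Downward | Rightward | Stop

(* Tableau, cell, direction, variable index: both the input and the output of a bump. *)
type_synonym state = "tableau \<times> cell \<times> direction \<times> enat"

definition admissible :: "ttype \<Rightarrow> nat list \<Rightarrow> tableau \<Rightarrow> cell \<Rightarrow> direction \<Rightarrow> nat \<Rightarrow> bool" where
  "admissible t m S p d k \<longleftrightarrow> S \<in> tableaux t m \<and> 1 \<le> k \<and>
     (p = (0, 0) \<and> d = Downward \<or>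
      p \<in> diagram t m \<and>
      (\<exists>v c. var_index p (v, c) = k \<and> fst (the (S p)) \<le> v \<and> S(p \<mapsto> (v, c)) \<in> tableaux t m \<and>
             (d = Rightward \<and> (c = Black \<or> t = TypeD \<and> diagonal TypeD p) \<or>
              d = Downward \<and> c = Red \<and> \<not> (t = TypeD \<and> diagonal TypeD p))))"

(* Positions in row 0 count as 0. Positions outside the diagram count as infinity; among these
   are the positions directly below the diagonal. *)
fun value_at :: "tableau \<Rightarrow> cell \<Rightarrow> enat" where
  "value_at S (i, j) =
     (if i = 0 then 0 else case S (i, j) of None \<Rightarrow> \<infinity> | Some e \<Rightarrow> enat (fst e))"

(* In type D the position (i, i) is both directly to the left of the diagonal position (i, i + 1)
   and directly below (i - 1, i), so the left neighbour of a diagonal position, which counts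
   as 0, is treated separately. *)
fun value_left :: "ttype \<Rightarrow> tableau \<Rightarrow> cell \<Rightarrow> enat" where
  "value_left t S (i, j) = (if diagonal t (i, j) then 0 else value_at S (i, j - 1))"

(* e is the entry by which x_k is written in position p when bumping in direction d. On the
   diagonal, diagonal_entry determines the color: black in type B, and in type D the color
   that makes the value even. As the value is a natural number, e need not exist. *)
definition written :: "ttype \<Rightarrow> direction \<Rightarrow> nat \<Rightarrow> cell \<Rightarrow> entry \<Rightarrow> bool" where
  "written t d k p e \<longleftrightarrow> var_index p e = k \<and>
     (if diagonal t p then diagonal_entry t e
      else snd e = (if d = Rightward then Black else Red))"

definition fits_right :: "ttype \<Rightarrow> tableau \<Rightarrow> nat \<Rightarrow> nat \<Rightarrow> nat \<Rightarrow> entry \<Rightarrow> bool" where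
  "fits_right t S k i' j' e \<longleftrightarrow>
     1 \<le> i' \<and> right_of_or_on_diagonal t (i', j') \<and> written t Rightward k (i', j') e \<and>
     value_at S (i' - 1, j') \<le> enat (fst e) \<and> enat (fst e) \<le> value_at S (i' + 1, j')"

definition fits_down :: "ttype \<Rightarrow> tableau \<Rightarrow> nat \<Rightarrow> nat \<Rightarrow> nat \<Rightarrow> entry \<Rightarrow> bool" where
  "fits_down t S k i' j' e \<longleftrightarrow>
     right_of_or_on_diagonal t (i', j') \<and> written t Downward k (i', j') e \<and>
     value_left t S (i', j') \<le> enat (fst e) \<and> enat (fst e) \<le> value_at S (i', j' + 1)"

definition is_largest :: "(nat \<Rightarrow> bool) \<Rightarrow> nat \<Rightarrow> bool" where
  "is_largest P n \<longleftrightarrow> P n \<and> (\<forall>m. P m \<longrightarrow> m \<le> n)"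

definition outcome :: "ttype \<Rightarrow> tableau \<Rightarrow> cell \<Rightarrow> entry \<Rightarrow> state" where
  "outcome t S p e = (S(p \<mapsto> e), p,
     (case S p of
        None \<Rightarrow> (Stop, \<infinity>)
      | Some old \<Rightarrow>
          (if snd old = Black \<or> t = TypeD \<and> diagonal TypeD p then Rightward else Downward,
           enat (var_index p old))))"

(* A relation rather than a function, so that an input is related to nothing when the largest
   index does not exist. *)
inductive bump :: "ttype \<Rightarrow> state \<Rightarrow> state \<Rightarrow> bool" for t where
  bump_rightward:
    "is_largest (\<lambda>r. \<exists>a. fits_right t S k r (j + 1) a) i' \<Longrightarrow> fits_right t S k i' (j + 1) e \<Longrightarrow>
     bump t (S, (i, j), Rightward, enat k) (outcome t S (i', j + 1) e)"
| bump_downward: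
    "is_largest (\<lambda>c. \<exists>a. fits_down t S k (i + 1) c a) j' \<Longrightarrow> fits_down t S k (i + 1) j' e \<Longrightarrow>
     bump t (S, (i, j), Downward, enat k) (outcome t S (i + 1, j') e)"

definition terminates :: "('a \<Rightarrow> 'a \<Rightarrow> bool) \<Rightarrow> 'a \<Rightarrow> bool" where
  "terminates R x \<longleftrightarrow> \<not> (\<exists>f :: nat \<Rightarrow> 'a. f 0 = x \<and> (\<forall>n. R (f n) (f (Suc n))))"

definition start :: "tableau \<Rightarrow> nat \<Rightarrow> state" where
  "start S k = (S, (0, 0), Downward, enat k)"

definition insertion :: "ttype \<Rightarrow> tableau \<Rightarrow> nat \<Rightarrow> tableau \<Rightarrow> bool" where
  "insertion t S k S' \<longleftrightarrow> (\<exists>p. (bump t)\<^sup>+\<^sup>+ (start S k) (S', p, Stop, \<infinity>))"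

definition psi :: "ttype \<Rightarrow> tableau \<times> nat \<Rightarrow> tableau" where
  "psi t = (\<lambda>(S, k). THE S'. insertion t S k S')"

(* One round whose result S' is rejected; (S1, k1) is the input of the next round. *)
definition rejected_round ::
  "ttype \<Rightarrow> nat list \<Rightarrow> nat list \<Rightarrow> tableau \<times> nat \<Rightarrow> tableau \<times> nat \<Rightarrow> bool" where
  "rejected_round t m l = (\<lambda>(S, k) (S1, k1). \<exists>S' n p.
     insertion t S k S' \<and> strict_partition n \<and> covers n m \<and> S' \<in> tableaux t n \<and>
     \<not> (contained n l \<and> S' \<in> bounded_tableaux t n l) \<and>
     diagram t n - diagram t m = {p} \<and> k1 = var_index p (the (S' p)) \<and> S1 = S'(p := None))"

definition accepted_round ::
  "ttype \<Rightarrow> nat list \<Rightarrow> nat list \<Rightarrow> tableau \<times> nat \<Rightarrow> tableau \<Rightarrow> bool" where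
  "accepted_round t m l = (\<lambda>(S, k) S'. \<exists>n.
     insertion t S k S' \<and> strict_partition n \<and> covers n m \<and>
     contained n l \<and> S' \<in> bounded_tableaux t n l)"

definition repeated_insertion ::
  "ttype \<Rightarrow> nat list \<Rightarrow> nat list \<Rightarrow> tableau \<Rightarrow> nat \<Rightarrow> tableau \<Rightarrow> bool" where
  "repeated_insertion t m l S k S' \<longleftrightarrow>
     (\<exists>y. (rejected_round t m l)\<^sup>*\<^sup>* (S, k) y \<and> accepted_round t m l y S')"

definition Psi :: "ttype \<Rightarrow> nat list \<Rightarrow> nat list \<Rightarrow> tableau \<times> nat \<Rightarrow> tableau" where
  "Psi t m l = (\<lambda>(S, k). THE S'. repeated_insertion t m l S k S')"

end

theory Submission
  imports Defs
begin

text \<open>A bump places \<open>x\<^sub>k\<close> at the first place of a column or row whose variable index is at least \<open>k\<close>.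
  Hence, for a fixed tableau and a fixed \<open>k\<close>, the places from which \<open>x\<^sub>k\<close> can come correspond one-to-one
  to the places in which it can land, and a bump is a bijection from its admissible inputs to its
  possible outputs. It preserves the finite set of variable indices that occur, so its orbits are
  finite and iterating it is a bijection from the initial to the final states.

  If the tableau is bounded by \<open>l\<close> at the start, the bound can only fail in the new cell. It does so
  iff \<open>k\<close> is outside the index set and the new cell is the corner determined by \<open>k\<close>; every such pair of
  a bounded tableau and a \<open>k\<close> outside the index set occurs exactly once. Thus a round of the repeated
  process is again a bijection with finite orbits, and the same iteration argument applies.\<close>

section \<open>Diagrams of strict partitions\<close>

text \<open>Boundedness is tracked for the tableau together with the entry in transit, placed in the
  cell that expelled it. A bump writes an entry that is at most the old one, and the old one becomes
  the next in transit, so nothing changes before the last bump. There the entry may fit where it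
  came from but not in the new cell. In a rightward step all rows between the two cells end in the
  same column, in a downward step all columns between them end in the same row. Hence the bound
  given by \<open>l\<close> changes from true to false exactly where a row (column) of
  \<open>m\<close> matches the one of \<open>l\<close> numbered \<open>k\<close>, and such a match
  is what the index set excludes. The obstacle is the diagonal in type D. There parity, not the
  direction of travel, determines the color, so an entry that leaves the diagonal to the right may
  be red with value \<open>k - i - 1\<close> and may move on to the next diagonal cell. Many case
  distinctions come from this, and it is where the parity condition on the index
  \<open>length l + 1\<close> is used.\<close>

lemma strict_partition_nth_less:
  assumes "strict_partition m" "i < j" "j < length m"
  shows "m ! j < m ! i"
  using assms by (auto simp: strict_partition_def sorted_wrt_iff_nth_less)

lemma part_pos_iff: "strict_partition m \<Longrightarrow> 0 < part m i \<longleftrightarrow> 1 \<le> i \<and> i \<le> length m"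
  unfolding strict_partition_def part_def
  by (auto simp: in_set_conv_nth)

lemma part_strict: "strict_partition m \<Longrightarrow> 1 \<le> i \<Longrightarrow> i < j \<Longrightarrow> 0 < part m i \<Longrightarrow> part m j < part m i"
  by (auto simp: part_def intro!: strict_partition_nth_less split: if_splits)

lemma part_antimono: "strict_partition m \<Longrightarrow> 1 \<le> i \<Longrightarrow> i \<le> j \<Longrightarrow> part m j \<le> part m i"
proof (cases "i = j \<or> part m j = 0")
  case False
  moreover assume "strict_partition m" "1 \<le> i" "i \<le> j"
  ultimately show ?thesis using part_strict[of m i j] part_pos_iff[of m i] part_pos_iff[of m j] by auto
qed auto

text \<open>Each nonzero part drops by at least one, which pays for the indentation of its row: the
  right ends of the nonempty rows of a shifted diagram move weakly to the left.\<close>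

lemma part_add_diff_le:
  assumes "strict_partition m" "1 \<le> a" "a \<le> i" "0 < part m i"
  shows "part m i + i \<le> part m a + a"
  using assms(3,2,4)
proof (induction i rule: dec_induct)
  case (step i)
  have "part m (Suc i) < part m i"
    using step assms(1) by (intro part_strict) (auto simp: part_pos_iff)
  moreover have "0 < part m i" using calculation by simp
  ultimately show ?case using step by simp
qed simp

text \<open>The type D diagram is the type B diagram moved one column to the right. With this shift
  as a parameter, most arguments treat both types at once.\<close>

definition off :: "ttype \<Rightarrow> nat" where
  "off t = (case t of TypeB \<Rightarrow> 0 | TypeD \<Rightarrow> 1)"

lemma off_simps [simp]: "off TypeB = 0" "off TypeD = 1"
  by (simp_all add: off_def)

lemma in_diagram_iff:
  "(i, j) \<in> diagram t m \<longleftrightarrow> 1 \<le> i \<and> i + off t \<le> j \<and> j < part m i + i + off t"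
  by (cases t) (auto simp: part_def split: if_splits)

declare diagram.simps [simp del]

lemma diagonal_iff: "diagonal t (i, j) \<longleftrightarrow> j = i + off t"
  by (cases t) auto

lemma right_of_or_on_diagonal_iff: "right_of_or_on_diagonal t (i, j) \<longleftrightarrow> i + off t \<le> j"
  by (cases t) auto

lemma diagram_down:
  assumes "strict_partition m" "(i, j) \<in> diagram t m" "1 \<le> a" "a \<le> i" "a + off t \<le> b" "b \<le> j"
  shows "(a, b) \<in> diagram t m"
  using assms part_add_diff_le[of m a i] by (auto simp: in_diagram_iff)

lemma down_closed_eq_card:
  assumes "finite A" "0 \<notin> A" "\<And>x y. x \<in> A \<Longrightarrow> 1 \<le> y \<Longrightarrow> y \<le> x \<Longrightarrow> y \<in> A"
  shows "A = {1..card A}"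
proof (cases "A = {}")
  case False
  have "A \<subseteq> {1..Max A}"
    using assms(1,2) by (auto simp: Suc_le_eq intro: gr0I)
  moreover have "{1..Max A} \<subseteq> A"
    using assms(3)[OF Max_in[OF assms(1) False]] by auto
  ultimately have "A = {1..Max A}" by blast
  then show ?thesis by (metis card_atLeastAtMost diff_Suc_1)
qed simp

text \<open>A column is an initial segment of rows, hence determined by its size. Column
  \<open>j\<close> in type D is column \<open>j - 1\<close> in type B, and \<open>col_length\<close>
  always refers to type B.\<close>

lemma diagram_iff_col_length:
  assumes "strict_partition m"
  shows "(i, j) \<in> diagram t m \<longleftrightarrow> 1 \<le> i \<and> i + off t \<le> j \<and> i \<le> col_length m (j - off t)"
proof -
  let ?c = "j - off t"
  let ?A = "{r. (r, ?c) \<in> diagram TypeB m}"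
  have "?A = {1..card ?A}"
  proof (rule down_closed_eq_card)
    show "finite ?A" by (rule finite_subset[of _ "{..?c}"]) (auto simp: in_diagram_iff)
    show "0 \<notin> ?A" by (auto simp: in_diagram_iff)
    show "y \<in> ?A" if "x \<in> ?A" "1 \<le> y" "y \<le> x" for x y
      using diagram_down[OF assms, of x ?c TypeB y ?c] that by (auto simp: in_diagram_iff)
  qed
  then have "(i, ?c) \<in> diagram TypeB m \<longleftrightarrow> 1 \<le> i \<and> i \<le> col_length m ?c"
    unfolding col_length_def by (metis (no_types, lifting) atLeastAtMost_iff mem_Collect_eq)
  moreover have "(i, j) \<in> diagram t m \<longleftrightarrow> i + off t \<le> j \<and> (i, ?c) \<in> diagram TypeB m"
    by (auto simp: in_diagram_iff)
  ultimately show ?thesis by auto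
qed

lemma finite_diagram: "finite (diagram t m)"
proof (rule finite_subset)
  show "diagram t m \<subseteq> (SIGMA i:{..length m}. {..< part m i + i + off t})"
    by (cases t) (auto simp: part_def diagram.simps)
qed auto

lemma card_diagram: "card (diagram t m) = sum_list m"
proof -
  have "diagram t m = (SIGMA i:{1..length m}. {i + off t ..< part m i + i + off t})"
    by (cases t) (auto simp: part_def diagram.simps split: if_splits)
  then have "card (diagram t m) = (\<Sum>i = 1..length m. part m i)"
    by simp
  also have "\<dots> = (\<Sum>i<length m. m ! i)"
    by (rule sum.reindex_bij_witness[of _ Suc "\<lambda>i. i - 1"]) (auto simp: part_def)
  also have "\<dots> = sum_list m" by (simp add: sum_list_sum_nth atLeast0LessThan)
  finally show ?thesis .
qed

lemma contained_iff: "contained m l \<longleftrightarrow> diagram t m \<subseteq> diagram t l"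
proof -
  have "diagram TypeB m \<subseteq> diagram TypeB l \<longleftrightarrow> (\<forall>i j. (i, j + off t) \<in> diagram t m \<longrightarrow> (i, j + off t) \<in> diagram t l)"
    by (simp add: subset_iff in_diagram_iff)
  also have "\<dots> \<longleftrightarrow> diagram t m \<subseteq> diagram t l"
  proof -
    have "\<exists>j'. j = j' + off t" if "(i, j) \<in> diagram t m" for i j
      using that by (intro exI[of _ "j - off t"]) (auto simp: in_diagram_iff)
    then show ?thesis by fast
  qed
  finally show ?thesis by (simp add: contained_def)
qed

fun corner :: "ttype \<Rightarrow> nat list \<Rightarrow> cell \<Rightarrow> bool" where
  "corner t m (i, j) \<longleftrightarrow> (i, j) \<notin> diagram t m \<and> 1 \<le> i \<and> i + off t \<le> j \<and>
     (1 < i \<longrightarrow> (i - 1, j) \<in> diagram t m) \<and> (i + off t < j \<longrightarrow> (i, j - 1) \<in> diagram t m)"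

text \<open>A corner either prolongs row \<open>i\<close> by one cell or opens row
  \<open>length m + 1\<close>. The cell above it makes part \<open>i - 1\<close> exceed the new part
  \<open>i\<close>, which is what strictness requires.\<close>

lemma add_corner:
  assumes m: "strict_partition m" and c: "corner t m p"
  shows "\<exists>n. strict_partition n \<and> covers n m \<and> diagram t n = insert p (diagram t m)"
proof -
  obtain i j where p: "p = (i, j)" by force
  have i: "1 \<le> i" "i + off t \<le> j" using c p by auto
  have j: "j = part m i + i + off t"
    using c p by (cases "j = i + off t") (auto simp: in_diagram_iff)
  have up: "part m i + 1 < part m (i - 1)" if "1 < i"
    using c p that by (auto simp: in_diagram_iff j)
  define n where "n = (if i \<le> length m then m[i - 1 := part m i + 1] else m @ [1])"
  have le: "i \<le> length m + 1"
  proof (rule ccontr)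
    assume "\<not> ?thesis"
    then have "part m (i - 1) = 0" "1 < i" by (auto simp: part_def)
    then show False using up by simp
  qed
  have part_n: "part n r = (if r = i then part m i + 1 else part m r)" for r
  proof (cases "i \<le> length m")
    case True
    then show ?thesis using i by (auto simp: n_def part_def nth_list_update)
  next
    case False
    then have "i = length m + 1" using le by simp
    then show ?thesis by (auto simp: n_def part_def nth_append)
  qed
  have dg: "diagram t n = insert p (diagram t m)"
    using i by (auto simp: in_diagram_iff part_n p j split: if_splits)
  have "strict_partition n"
  proof -
    have "n ! b < n ! a" if "a < b" "b < length n" for a b
    proof -
      have "part m (Suc b) < part m (Suc a)" if "b < length m"
        using \<open>a < b\<close> that by (intro part_strict[OF m]) (auto simp: part_pos_iff[OF m])
      moreover have "part m (i - 1) \<le> part m (Suc a)" if "Suc a < i"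
        using that by (intro part_antimono[OF m]) auto
      moreover have "b < length m \<or> Suc b = i"
        using that(2) le by (auto simp: n_def split: if_splits)
      ultimately have "part n (Suc b) < part n (Suc a)"
        using \<open>a < b\<close> up by (auto simp: part_n)
      then show ?thesis using that by (simp add: part_def)
    qed
    moreover have "0 \<notin> set n"
      using m by (auto simp: n_def strict_partition_def dest: set_update_subset_insert[THEN subsetD])
    ultimately show ?thesis by (simp add: strict_partition_def sorted_wrt_iff_nth_less)
  qed
  moreover have "covers n m"
  proof -
    have "card (diagram t n) = card (diagram t m) + 1"
      using c p by (simp add: dg finite_diagram)
    then show ?thesis unfolding covers_def card_diagram
      using contained_iff[of m n t] dg by auto
  qed
  ultimately show ?thesis using dg by blast
qed

lemma covers_corner:
  assumes "strict_partition m" "strict_partition n" "covers n m"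
  shows "\<exists>p. corner t m p \<and> diagram t n = insert p (diagram t m)"
proof -
  have sub: "diagram t m \<subseteq> diagram t n" and card: "card (diagram t n) = card (diagram t m) + 1"
    using assms(3) contained_iff[of m n t] by (auto simp: covers_def card_diagram)
  have "card (diagram t n - diagram t m) = 1"
    using card card_Diff_subset[OF finite_diagram sub] by simp
  then obtain p where "diagram t n - diagram t m = {p}" by (auto simp: card_1_singleton_iff)
  then have p: "diagram t n = insert p (diagram t m)" "p \<notin> diagram t m" using sub by auto
  obtain i j where ij: "p = (i, j)" by force
  have mem: "1 \<le> i" "i + off t \<le> j" "(i, j) \<in> diagram t n"
    using p ij by (auto simp: in_diagram_iff[of i j t n, symmetric]) (auto simp: in_diagram_iff set_eq_iff)
  have "(i - 1, j) \<in> diagram t n" if "1 < i"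
    using that mem by (intro diagram_down[OF assms(2) mem(3)]) auto
  moreover have "(i, j - 1) \<in> diagram t n" if "i + off t < j"
    using that mem by (intro diagram_down[OF assms(2) mem(3)]) auto
  ultimately have "corner t m p" using p ij mem by auto
  then show ?thesis using p by blast
qed

section \<open>Tableaux\<close>

text \<open>Unspecified outside the domain, so statements about it carry a membership
  condition.\<close>

definition val :: "tableau \<Rightarrow> cell \<Rightarrow> nat" where
  "val S p = fst (the (S p))"

lemma val_upd [simp]: "val (S(p \<mapsto> e)) p = fst e" "p \<noteq> q \<Longrightarrow> val (S(q \<mapsto> e)) p = val S p"
  "val (S(p := Some e)) p = fst e"
  by (simp_all add: val_def)

text \<open>Monotonicity in rows and columns gives monotonicity in the product order by way of the
  cell \<open>(a, j)\<close>, which lies in the diagram. The other intermediate cell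
  \<open>(i, b)\<close> may lie below the diagonal.\<close>

lemma tableaux_iff:
  assumes "strict_partition m"
  shows "S \<in> tableaux t m \<longleftrightarrow> dom S = diagram t m \<and>
     (\<forall>a b i j. (a, b) \<in> dom S \<longrightarrow> (i, j) \<in> dom S \<longrightarrow> a \<le> i \<longrightarrow> b \<le> j \<longrightarrow> val S (a, b) \<le> val S (i, j)) \<and>
     (\<forall>p\<in>dom S. diagonal t p \<longrightarrow> diagonal_entry t (the (S p)))" (is "?L \<longleftrightarrow> ?R")
proof
  assume L: ?L
  then have dom: "dom S = diagram t m" by (simp add: tableaux_def)
  have "val S (a, b) \<le> val S (i, j)" if "(a, b) \<in> dom S" "(i, j) \<in> dom S" "a \<le> i" "b \<le> j" for a b i j
  proof -
    have "(a, j) \<in> dom S"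
      using that unfolding dom by (intro diagram_down[OF assms that(2)[unfolded dom]]) (auto simp: in_diagram_iff)
    moreover have "(a, b) \<in> dom S" "(i, j) \<in> dom S" using that by auto
    ultimately obtain x y z where xyz: "S (a, b) = Some x" "S (a, j) = Some y" "S (i, j) = Some z"
      unfolding dom_def by blast
    have "fst x \<le> fst y" "fst y \<le> fst z"
    proof -
      have "\<forall>i j j' e e'. S (i, j) = Some e \<and> S (i, j') = Some e' \<and> j \<le> j' \<longrightarrow> fst e \<le> fst e'"
        using L unfolding tableaux_def mem_Collect_eq by (elim conjE)
      moreover have "\<forall>i i' j e e'. S (i, j) = Some e \<and> S (i', j) = Some e' \<and> i \<le> i' \<longrightarrow> fst e \<le> fst e'"
        using L unfolding tableaux_def mem_Collect_eq by (elim conjE)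
      ultimately show "fst x \<le> fst y" "fst y \<le> fst z" using xyz \<open>a \<le> i\<close> \<open>b \<le> j\<close> by blast+
    qed
    then show ?thesis using xyz by (simp add: val_def)
  qed
  moreover have "diagonal_entry t (the (S p))" if "p \<in> dom S" "diagonal t p" for p
  proof -
    from that(1) obtain e where "S p = Some e" by blast
    moreover have "\<forall>p e. S p = Some e \<and> diagonal t p \<longrightarrow> diagonal_entry t e"
      using L unfolding tableaux_def mem_Collect_eq by (elim conjE)
    ultimately show ?thesis using that by (metis option.sel)
  qed
  ultimately show ?R using dom by simp
next
  assume R: ?R
  have *: "fst e \<le> fst e'"
    if "S (a, b) = Some e" "S (i, j) = Some e'" "a \<le> i" "b \<le> j" for a b i j e e'
  proof -
    have "val S (a, b) \<le> val S (i, j)" using R that by blast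
    then show ?thesis using that by (simp add: val_def)
  qed
  have "diagonal_entry t e" if "S p = Some e" "diagonal t p" for p e
    using R that by (metis domI option.sel)
  moreover have "dom S = diagram t m" using R by blast
  moreover have "\<forall>i j j' e e'. S (i, j) = Some e \<and> S (i, j') = Some e' \<and> j \<le> j' \<longrightarrow> fst e \<le> fst e'"
    using *[OF _ _ order_refl] by blast
  moreover have "\<forall>i i' j e e'. S (i, j) = Some e \<and> S (i', j) = Some e' \<and> i \<le> i' \<longrightarrow> fst e \<le> fst e'"
    using *[OF _ _ _ order_refl] by blast
  ultimately show ?L unfolding tableaux_def mem_Collect_eq by (intro conjI) blast+
qed

lemma tableaux_dom: "S \<in> tableaux t m \<Longrightarrow> dom S = diagram t m"
  by (simp add: tableaux_def)

lemma tableaux_mono: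
  assumes "strict_partition m" "S \<in> tableaux t m" "(i, j) \<in> diagram t m"
    "1 \<le> a" "a \<le> i" "a + off t \<le> b" "b \<le> j"
  shows "val S (a, b) \<le> val S (i, j)"
  using assms(2-7) diagram_down[OF assms(1,3-7)] tableaux_iff[OF assms(1), of S t] by simp

lemma tableaux_diag:
  assumes "S \<in> tableaux t m" "p \<in> diagram t m" "diagonal t p"
  shows "diagonal_entry t (the (S p))"
proof -
  obtain e where "S p = Some e" using assms(2) tableaux_dom[OF assms(1)] by blast
  moreover have "\<forall>p e. S p = Some e \<and> diagonal t p \<longrightarrow> diagonal_entry t e"
    using assms(1) unfolding tableaux_def mem_Collect_eq by (elim conjE)
  ultimately show ?thesis using assms by (metis option.sel)
qed

lemma tableauxI:
  assumes "strict_partition m" "dom S = diagram t m"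
    "\<And>a b i j. (a, b) \<in> diagram t m \<Longrightarrow> (i, j) \<in> diagram t m \<Longrightarrow> a \<le> i \<Longrightarrow> b \<le> j \<Longrightarrow> val S (a, b) \<le> val S (i, j)"
    "\<And>p. p \<in> diagram t m \<Longrightarrow> diagonal t p \<Longrightarrow> diagonal_entry t (the (S p))"
  shows "S \<in> tableaux t m"
  using assms by (simp add: tableaux_iff)

text \<open>The neighbours are also required to exist, so for a cell outside the diagram this says
  as well that the cell is a corner.\<close>

fun left_up_le :: "ttype \<Rightarrow> nat list \<Rightarrow> tableau \<Rightarrow> cell \<Rightarrow> nat \<Rightarrow> bool" where
  "left_up_le t m S (i, j) v \<longleftrightarrow>
     (1 < i \<longrightarrow> (i - 1, j) \<in> diagram t m \<and> val S (i - 1, j) \<le> v) \<and>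
     (i + off t < j \<longrightarrow> (i, j - 1) \<in> diagram t m \<and> val S (i, j - 1) \<le> v)"

lemma left_up_le_all:
  assumes m: "strict_partition m" and S: "S \<in> tableaux t m" and le: "left_up_le t m S (i, j) v"
    and ab: "1 \<le> a" "a \<le> i" "a + off t \<le> b" "b \<le> j" "(a, b) \<noteq> (i, j)" and ij: "i + off t \<le> j"
  shows "val S (a, b) \<le> v"
proof (cases "a = i")
  case True
  then have "val S (a, b) \<le> val S (i, j - 1)"
    using ab le by (intro tableaux_mono[OF m S]) auto
  then show ?thesis using True ab le by auto
next
  case False
  then have "val S (a, b) \<le> val S (i - 1, j)"
    using ab le by (intro tableaux_mono[OF m S]) auto
  then show ?thesis using False ab le by auto
qed

text \<open>Serves both outcomes of a bump: \<open>n = m\<close> if an old entry is replaced, and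
  \<open>n\<close> with one more cell if a corner is filled.\<close>

lemma tableaux_lower:
  assumes m: "strict_partition m" and n: "strict_partition n" and S: "S \<in> tableaux t m"
    and dn: "diagram t n = insert p (diagram t m)"
    and le: "left_up_le t m S p (fst e)" and old: "p \<in> diagram t m \<Longrightarrow> fst e \<le> val S p"
    and diag: "diagonal t p \<Longrightarrow> diagonal_entry t e"
  shows "S(p \<mapsto> e) \<in> tableaux t n"
proof -
  obtain i j where p: "p = (i, j)" by force
  have ij: "1 \<le> i" "i + off t \<le> j"
    using dn p by (auto simp: in_diagram_iff[of i j t n, symmetric]) (auto simp: in_diagram_iff set_eq_iff)
  have "val (S(p \<mapsto> e)) (a, b) \<le> val (S(p \<mapsto> e)) (c, d)"
    if ab: "(a, b) \<in> insert p (diagram t m)" and cd: "(c, d) \<in> insert p (diagram t m)" "a \<le> c" "b \<le> d" for a b c d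
  proof -
    have ab': "1 \<le> a" "a + off t \<le> b" using ab p ij by (auto simp: in_diagram_iff)
    consider "(a, b) = (c, d)" | "(a, b) \<noteq> (c, d)" "(c, d) = p" | "(a, b) \<noteq> (c, d)" "(a, b) = p"
      | "(c, d) \<noteq> p" "(a, b) \<noteq> p" by blast
    then show ?thesis
    proof cases
      case 2
      then show ?thesis
        using left_up_le_all[OF m S le[unfolded p], of a b] ab' cd ij p by auto
    next
      case 3
      then have c: "(c, d) \<in> diagram t m" using cd by auto
      have "p \<in> diagram t m"
        using diagram_down[OF m c, of a b] ab' cd 3 by auto
      moreover have "val S (a, b) \<le> val S (c, d)"
        using ab' cd by (intro tableaux_mono[OF m S c]) auto
      ultimately show ?thesis using 3 old by auto
    next
      case 4
      then show ?thesis using ab' ab cd by (auto intro!: tableaux_mono[OF m S])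
    qed simp
  qed
  moreover have "diagonal_entry t (the ((S(p \<mapsto> e)) q))" if "q \<in> insert p (diagram t m)" "diagonal t q" for q
    using that diag tableaux_diag[OF S] by (cases "q = p") auto
  ultimately show ?thesis
    unfolding dn[symmetric] using tableaux_dom[OF S] dn by (intro tableauxI[OF n]) auto
qed

lemma tableaux_raise:
  assumes m: "strict_partition m" and S: "S \<in> tableaux t m"
    and p: "(i, j) \<in> diagram t m" and old: "val S (i, j) \<le> fst e"
    and down: "(i + 1, j) \<in> diagram t m \<Longrightarrow> fst e \<le> val S (i + 1, j)"
    and right: "(i, j + 1) \<in> diagram t m \<Longrightarrow> fst e \<le> val S (i, j + 1)"
    and diag: "diagonal t (i, j) \<Longrightarrow> diagonal_entry t e"
  shows "S((i, j) \<mapsto> e) \<in> tableaux t m"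
proof -
  let ?S = "S((i, j) \<mapsto> e)"
  have ij: "1 \<le> i" "i + off t \<le> j" using p by (auto simp: in_diagram_iff)
  have "val ?S (a, b) \<le> val ?S (c, d)"
    if ab: "(a, b) \<in> diagram t m" and cd: "(c, d) \<in> diagram t m" "a \<le> c" "b \<le> d" for a b c d
  proof -
    have ab': "1 \<le> a" "a + off t \<le> b" using ab p ij by (auto simp: in_diagram_iff)
    have mono: "val S (a, b) \<le> val S (c, d)" using ab' cd by (intro tableaux_mono[OF m S]) auto
    consider "(a, b) = (c, d)" | "(a, b) \<noteq> (c, d)" "(c, d) = (i, j)" | "(a, b) \<noteq> (c, d)" "(a, b) = (i, j)" "a < c"
      | "(a, b) \<noteq> (c, d)" "(a, b) = (i, j)" "b < d" "a = c"
      | "(c, d) \<noteq> (i, j)" "(a, b) \<noteq> (i, j)" using cd by fastforce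
    then show ?thesis
    proof cases
      case 2
      then show ?thesis using mono old by auto
    next
      case 3
      have "c + off t \<le> d" using cd by (auto simp: in_diagram_iff)
      show ?thesis
      \<comment> \<open>For a diagonal cell the position below is missing, so the comparison has to
        pass through the right neighbour.\<close>
      proof (cases "i + 1 + off t \<le> j")
        case True
        then have "(i + 1, j) \<in> diagram t m" using 3 cd by (intro diagram_down[OF m cd(1)]) auto
        moreover have "val S (i + 1, j) \<le> val S (c, d)"
          using 3 cd True by (intro tableaux_mono[OF m S cd(1)]) auto
        ultimately show ?thesis using 3 down by auto
      next
        case False
        then have "i + off t \<le> j + 1" "j + 1 \<le> d" using ij 3 \<open>c + off t \<le> d\<close> by auto
        have "(i, j + 1) \<in> diagram t m"
          by (rule diagram_down[OF m cd(1)]) (use ij 3 \<open>j + 1 \<le> d\<close> \<open>i + off t \<le> j + 1\<close> in auto)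
        moreover have "val S (i, j + 1) \<le> val S (c, d)"
          by (rule tableaux_mono[OF m S cd(1)]) (use ij 3 \<open>j + 1 \<le> d\<close> \<open>i + off t \<le> j + 1\<close> in auto)
        ultimately show ?thesis using 3 right by auto
      qed
    next
      case 4
      have "(i, j + 1) \<in> diagram t m"
        by (rule diagram_down[OF m cd(1)]) (use ij 4 in auto)
      moreover have "val S (i, j + 1) \<le> val S (c, d)"
        by (rule tableaux_mono[OF m S cd(1)]) (use ij 4 in auto)
      ultimately show ?thesis using 4 right by auto
    next
      case 5
      then show ?thesis using mono by auto
    qed simp
  qed
  moreover have "diagonal_entry t (the (?S q))" if "q \<in> diagram t m" "diagonal t q" for q
    using that diag tableaux_diag[OF S] by (cases "q = (i, j)") auto
  ultimately show ?thesis
    using tableaux_dom[OF S] p by (intro tableauxI[OF m]) auto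
qed

text \<open>The only candidate for the written entry. Since subtraction truncates, it represents
  \<open>x_k\<close> only under the bounds in \<open>written_iff\<close>. On the type D diagonal an
  odd \<open>k - i\<close> forces the red value \<open>k - (i + 1)\<close>.\<close>

fun entry_of :: "ttype \<Rightarrow> direction \<Rightarrow> nat \<Rightarrow> cell \<Rightarrow> entry" where
  "entry_of t d k (i, j) =
     (if diagonal t (i, j)
      then if t = TypeD \<and> odd (k - i) then (k - i - 1, Red) else (k - i, Black)
      else if d = Rightward then (k - i, Black) else (k - j, Red))"

lemma written_imp_entry_of:
  assumes "written t d k p e" shows "e = entry_of t d k p"
proof -
  obtain i j v c where "p = (i, j)" "e = (v, c)" by (metis surj_pair)
  then show ?thesis using assms by (cases c; cases t) (auto simp: written_def diagonal_iff split: if_splits)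
qed

lemma written_iff:
  assumes "i + off t \<le> j"
  shows "written t d k (i, j) e \<longleftrightarrow>
    e = entry_of t d k (i, j) \<and> i \<le> k \<and> (d = Rightward \<or> diagonal t (i, j) \<or> j \<le> k)"
proof
  assume w: "written t d k (i, j) e"
  obtain v c where "e = (v, c)" by force
  then have "i \<le> k \<and> (d = Rightward \<or> diagonal t (i, j) \<or> j \<le> k)"
    using w assms by (cases c; cases t) (auto simp: written_def diagonal_iff split: if_splits)
  then show "e = entry_of t d k (i, j) \<and> i \<le> k \<and> (d = Rightward \<or> diagonal t (i, j) \<or> j \<le> k)"
    using written_imp_entry_of[OF w] by auto
next
  assume *: "e = entry_of t d k (i, j) \<and> i \<le> k \<and> (d = Rightward \<or> diagonal t (i, j) \<or> j \<le> k)"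
  show "written t d k (i, j) e"
  proof (cases "t = TypeD \<and> diagonal t (i, j) \<and> odd (k - i)")
    case True
    moreover from this have "1 \<le> k - i" by (cases "k - i") auto
    ultimately show ?thesis using * by (auto simp: written_def diagonal_iff)
  next
    case False
    then show ?thesis using * by (cases t) (auto simp: written_def diagonal_iff)
  qed
qed

section \<open>A single bump\<close>

text \<open>The maximality in the definition of a bump singles out the first place of the column or row
  whose variable index, read in the direction of the bump, is at least \<open>k\<close>.\<close>
fun lands :: "ttype \<Rightarrow> tableau \<Rightarrow> nat \<Rightarrow> cell \<Rightarrow> direction \<Rightarrow> cell \<Rightarrow> bool" where
  "lands t S k (i, j) Rightward (i', j') \<longleftrightarrow> j' = j + 1 \<and> 1 \<le> i' \<and> i' + off t \<le> j' \<and>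
     (1 < i' \<longrightarrow> (i' - 1, j') \<in> dom S \<and> val S (i' - 1, j') + (i' - 1) < k) \<and>
     ((i', j') \<in> dom S \<longrightarrow> k \<le> val S (i', j') + i')"
| "lands t S k (i, j) Downward (i', j') \<longleftrightarrow> i' = i + 1 \<and> i' + off t \<le> j' \<and>
     (i' + off t < j' \<longrightarrow> (i', j' - 1) \<in> dom S \<and> val S (i', j' - 1) + (j' - 1) < k) \<and>
     ((i', j') \<in> dom S \<longrightarrow> k \<le> val S (i', j') + j')"
| "lands t S k p Stop q \<longleftrightarrow> False"

text \<open>Admissibility in local form: the candidate entry is compared only with its own cell and
  the neighbours below and to the right.\<close>

fun source :: "ttype \<Rightarrow> nat list \<Rightarrow> tableau \<Rightarrow> nat \<Rightarrow> cell \<Rightarrow> direction \<Rightarrow> bool" where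
  "source t m S k (i, j) d \<longleftrightarrow> (i, j) = (0, 0) \<and> d = Downward \<or>
     (i, j) \<in> diagram t m \<and> (d = Rightward \<or> d = Downward \<and> \<not> diagonal t (i, j)) \<and>
     written t d k (i, j) (entry_of t d k (i, j)) \<and>
     val S (i, j) \<le> fst (entry_of t d k (i, j)) \<and>
     ((i + 1, j) \<in> diagram t m \<longrightarrow> fst (entry_of t d k (i, j)) \<le> val S (i + 1, j)) \<and>
     ((i, j + 1) \<in> diagram t m \<longrightarrow> fst (entry_of t d k (i, j)) \<le> val S (i, j + 1))"

text \<open>The possible outputs of a bump, described without reference to the cell from which
  \<open>x_k\<close> came. This is what makes a bump reversible.\<close>

fun target :: "ttype \<Rightarrow> nat list \<Rightarrow> tableau \<Rightarrow> nat \<Rightarrow> cell \<Rightarrow> entry \<Rightarrow> bool" where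
  "target t m S k (i, j) e \<longleftrightarrow> 1 \<le> i \<and> i + off t \<le> j \<and> var_index (i, j) e = k \<and>
     left_up_le t m S (i, j) (fst e) \<and> (diagonal t (i, j) \<longrightarrow> diagonal_entry t e) \<and>
     ((i, j) \<in> diagram t m \<longrightarrow> fst e \<le> val S (i, j))"

declare entry_of.simps [simp del] value_at.simps [simp del]

lemma admissible_iff_source:
  assumes m: "strict_partition m" and S: "S \<in> tableaux t m" and k: "1 \<le> k"
  shows "admissible t m S p d k \<longleftrightarrow> source t m S k p d"
proof -
  obtain i j where p: "p = (i, j)" by force
  show ?thesis
  proof (cases "(i, j) \<in> diagram t m")
    case False
    then show ?thesis using S k by (auto simp: admissible_def p)
  next
    case True
    let ?e = "entry_of t d k (i, j)"
    have nz: "(i, j) \<noteq> (0, 0)" and ij: "1 \<le> i" "i + off t \<le> j" using True by (auto simp: in_diagram_iff)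
    have upd: "S((i, j) \<mapsto> e) \<in> tableaux t m \<longleftrightarrow> (diagonal t (i, j) \<longrightarrow> diagonal_entry t e) \<and>
       ((i + 1, j) \<in> diagram t m \<longrightarrow> fst e \<le> val S (i + 1, j)) \<and>
       ((i, j + 1) \<in> diagram t m \<longrightarrow> fst e \<le> val S (i, j + 1))" (is "?T e \<longleftrightarrow> ?U e")
      if "val S (i, j) \<le> fst e" for e
    proof
      assume T: "?T e"
      have "fst e \<le> val S (i + 1, j)" if "(i + 1, j) \<in> diagram t m"
        using tableaux_mono[OF m T that, of i j] ij by (simp add: val_def)
      moreover have "fst e \<le> val S (i, j + 1)" if "(i, j + 1) \<in> diagram t m"
        using tableaux_mono[OF m T that, of i j] ij by (simp add: val_def)
      moreover have "diagonal_entry t e" if "diagonal t (i, j)"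
        using tableaux_diag[OF T True that] by simp
      ultimately show "?U e" by blast
    next
      assume "?U e"
      then show "?T e" using that by (intro tableaux_raise[OF m S True]) auto
    qed
    have dir: "(\<exists>v c. var_index (i, j) (v, c) = k \<and> (diagonal t (i, j) \<longrightarrow> diagonal_entry t (v, c)) \<and> Q (v, c) \<and>
        (d = Rightward \<and> (c = Black \<or> t = TypeD \<and> diagonal t (i, j)) \<or>
         d = Downward \<and> c = Red \<and> \<not> (t = TypeD \<and> diagonal t (i, j)))) \<longleftrightarrow>
      (d = Rightward \<or> d = Downward \<and> \<not> diagonal t (i, j)) \<and> written t d k (i, j) ?e \<and> Q ?e"
      (is "(\<exists>v c. ?X Q v c) \<longleftrightarrow> ?D \<and> _ \<and> _") for Q
    proof
      assume "\<exists>v c. ?X Q v c"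
      then obtain v c where X: "?X Q v c" by blast
      then have w: "?D \<and> written t d k (i, j) (v, c)" by (cases t) (auto simp: written_def)
      then show "?D \<and> written t d k (i, j) ?e \<and> Q ?e" using X written_imp_entry_of[of t d k "(i, j)" "(v, c)"] by auto
    next
      assume *: "?D \<and> written t d k (i, j) ?e \<and> Q ?e"
      obtain v c where e: "?e = (v, c)" by force
      have "?X Q v c" using * unfolding e by (cases t) (auto simp: written_def split: if_splits)
      then show "\<exists>v c. ?X Q v c" by blast
    qed
    let ?R = "\<lambda>e. val S (i, j) \<le> fst e \<and> ((i + 1, j) \<in> diagram t m \<longrightarrow> fst e \<le> val S (i + 1, j)) \<and>
       ((i, j + 1) \<in> diagram t m \<longrightarrow> fst e \<le> val S (i, j + 1))"
    have "admissible t m S p d k \<longleftrightarrow> (\<exists>v c. var_index (i, j) (v, c) = k \<and> val S (i, j) \<le> v \<and>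
        S((i, j) \<mapsto> (v, c)) \<in> tableaux t m \<and>
        (d = Rightward \<and> (c = Black \<or> t = TypeD \<and> diagonal t (i, j)) \<or>
         d = Downward \<and> c = Red \<and> \<not> (t = TypeD \<and> diagonal t (i, j))))"
      unfolding admissible_def p val_def using S k nz True
      by (cases t) (simp_all only: simp_thms ttype.distinct)
    also have "\<dots> \<longleftrightarrow> (\<exists>v c. var_index (i, j) (v, c) = k \<and> (diagonal t (i, j) \<longrightarrow> diagonal_entry t (v, c)) \<and> ?R (v, c) \<and>
        (d = Rightward \<and> (c = Black \<or> t = TypeD \<and> diagonal t (i, j)) \<or>
         d = Downward \<and> c = Red \<and> \<not> (t = TypeD \<and> diagonal t (i, j))))"
    proof (intro ex_cong1)
      fix v c
      have "val S (i, j) \<le> v \<and> S((i, j) \<mapsto> (v, c)) \<in> tableaux t m \<longleftrightarrow>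
          (diagonal t (i, j) \<longrightarrow> diagonal_entry t (v, c)) \<and> ?R (v, c)"
        using upd[of "(v, c)"] by auto
      then show "(var_index (i, j) (v, c) = k \<and> val S (i, j) \<le> v \<and>
        S((i, j) \<mapsto> (v, c)) \<in> tableaux t m \<and>
        (d = Rightward \<and> (c = Black \<or> t = TypeD \<and> diagonal t (i, j)) \<or>
         d = Downward \<and> c = Red \<and> \<not> (t = TypeD \<and> diagonal t (i, j)))) \<longleftrightarrow>
        (var_index (i, j) (v, c) = k \<and> (diagonal t (i, j) \<longrightarrow> diagonal_entry t (v, c)) \<and> ?R (v, c) \<and>
        (d = Rightward \<and> (c = Black \<or> t = TypeD \<and> diagonal t (i, j)) \<or>
         d = Downward \<and> c = Red \<and> \<not> (t = TypeD \<and> diagonal t (i, j))))"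
        by argo
    qed
    also have "\<dots> \<longleftrightarrow> (d = Rightward \<or> d = Downward \<and> \<not> diagonal t (i, j)) \<and> written t d k (i, j) ?e \<and> ?R ?e"
      by (rule dir)
    finally show ?thesis using nz True unfolding p source.simps by argo
  qed
qed

text \<open>An entry travelling to the right is read as black, so its value plus its row is
  \<open>k\<close>. The one exception is a red entry on the type D diagonal, where one is
  missing.\<close>

lemma entry_of_Rightward:
  assumes "written t Rightward k (i, j) (entry_of t Rightward k (i, j))"
  shows "fst (entry_of t Rightward k (i, j)) + i = k \<and> entry_of t Rightward k (i, j) = (k - i, Black) \<or>
    t = TypeD \<and> j = i + 1 \<and> entry_of t Rightward k (i, j) = (k - i - 1, Red) \<and> i < k \<and> odd (k - i)"
  using assms by (cases t) (auto simp: written_def diagonal_iff entry_of.simps split: if_splits elim: oddE)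

text \<open>The first place with index at least \<open>k\<close> exists by the least number
  principle. In a column it must also not lie below the diagonal: the entry right of the source is
  at least the carried one, so the search ends by row \<open>i + 1\<close>.\<close>

lemma lands_exists:
  assumes m: "strict_partition m" and S: "S \<in> tableaux t m" and k: "1 \<le> k" and s: "source t m S k p d"
  shows "\<exists>q. lands t S k p d q"
proof -
  obtain i j where p: "p = (i, j)" by force
  have dom: "dom S = diagram t m" by (rule tableaux_dom[OF S])
  show ?thesis
  proof (cases d)
    case Rightward
    then have ij: "1 \<le> i" "i + off t \<le> j" using s p by (auto simp: in_diagram_iff)
    let ?P = "\<lambda>r. 1 \<le> r \<and> ((r, j + 1) \<in> dom S \<longrightarrow> k \<le> val S (r, j + 1) + r)"
    define r where "r = (LEAST r. ?P r)"
    \<comment> \<open>In both types row \<open>j + 2\<close> of column \<open>j + 1\<close> is below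
      the diagonal, hence outside the diagram.\<close>
    have "?P (j + 2)" by (simp add: dom in_diagram_iff)
    then have P: "?P r" unfolding r_def by (rule LeastI)
    have prev: "(r - 1, j + 1) \<in> dom S \<and> val S (r - 1, j + 1) + (r - 1) < k" if "1 < r"
      using that not_less_Least[of "r - 1" ?P] unfolding r_def[symmetric] by auto
    have "r \<le> i + 1"
    proof (rule ccontr)
      assume r: "\<not> ?thesis"
      then have r1: "(r - 1, j + 1) \<in> diagram t m" "val S (r - 1, j + 1) + (r - 1) < k"
        using prev dom by auto
      have "(i, j + 1) \<in> diagram t m" using r ij by (intro diagram_down[OF m r1(1)]) auto
      then have "fst (entry_of t d k (i, j)) \<le> val S (i, j + 1)" using s p Rightward ij by auto
      also have "\<dots> \<le> val S (r - 1, j + 1)" using r ij by (intro tableaux_mono[OF m S r1(1)]) auto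
      finally show False
        using r1(2) r s ij entry_of_Rightward[of t k i j] unfolding p Rightward by (auto)
    qed
    then have "r + off t \<le> j + 1" using ij by simp
    then show ?thesis using P prev Rightward p
      by (intro exI[of _ "(r, j + 1)"]) auto
  next
    case Downward
    have ij: "i + 1 + off t \<le> j \<or> i = 0"
      using s p Downward by (auto simp: in_diagram_iff diagonal_iff)
    let ?P = "\<lambda>r. i + 1 + off t \<le> r \<and> ((i + 1, r) \<in> dom S \<longrightarrow> k \<le> val S (i + 1, r) + r)"
    define r where "r = (LEAST r. ?P r)"
    \<comment> \<open>This is the first column after the end of row \<open>i + 1\<close>.\<close>
    have "?P (i + 1 + off t + part m (i + 1))" by (simp add: dom in_diagram_iff)
    then have P: "?P r" unfolding r_def by (rule LeastI)
    have prev: "(i + 1, r - 1) \<in> dom S \<and> val S (i + 1, r - 1) + (r - 1) < k" if "i + 1 + off t < r"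
      using that not_less_Least[of "r - 1" ?P] unfolding r_def[symmetric] by auto
    then show ?thesis using P Downward p
      by (intro exI[of _ "(i + 1, r)"]) auto
  next
    case Stop
    then show ?thesis using s p by auto
  qed
qed

lemma value_at_le_iff: "value_at S (i, j) \<le> enat v \<longleftrightarrow> i = 0 \<or> (i, j) \<in> dom S \<and> val S (i, j) \<le> v"
  by (auto simp: val_def value_at.simps zero_enat_def split: option.splits)

lemma le_value_at_iff: "enat v \<le> value_at S (Suc i, j) \<longleftrightarrow> ((Suc i, j) \<in> dom S \<longrightarrow> v \<le> val S (Suc i, j))"
  by (auto simp: val_def value_at.simps split: option.splits)

lemma written_index: "written t d k p e \<Longrightarrow> var_index p e = k"
  by (simp add: written_def)

lemma written_bounds:
  assumes "written t d k (i, j) e" "i + off t \<le> j"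
  shows "fst e + i \<le> k" "k \<le> fst e + j"
proof -
  obtain v c where "e = (v, c)" by force
  then show "fst e + i \<le> k" "k \<le> fst e + j" using assms by (cases c; auto simp: written_def)+
qed

lemma written_Red:
  assumes "written t Downward k (i, j) e" "\<not> diagonal t (i, j)"
  shows "fst e + j = k" "snd e = Red"
proof -
  obtain v c where "e = (v, c)" by force
  then show "fst e + j = k" "snd e = Red" using assms by (cases c; auto simp: written_def)+
qed

lemma written_Black:
  assumes "written t Rightward k (i, j) e" "\<not> diagonal t (i, j)"
  shows "fst e + i = k" "snd e = Black"
proof -
  obtain v c where "e = (v, c)" by force
  then show "fst e + i = k" "snd e = Black" using assms by (cases c; auto simp: written_def)+
qed

text \<open>The right neighbour of the source, if present, has value at least the carried one, so
  its index is already at least \<open>k\<close>. Only a red entry on the type D diagonal is one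
  short of this, and it can then land one row lower, which is the next diagonal cell.\<close>

lemma lands_Rightward_row:
  assumes m: "strict_partition m" and S: "S \<in> tableaux t m"
    and s: "source t m S k (i, j) Rightward" and l: "lands t S k (i, j) Rightward (a, b)"
  defines "e \<equiv> entry_of t Rightward k (i, j)"
  shows "a \<le> i \<or> a = i + 1 \<and> t = TypeD \<and> j = i + 1 \<and> e = (k - i - 1, Red) \<and> i < k \<and> odd (k - i)"
proof (cases "a \<le> i")
  case False
  have ij: "1 \<le> i" "i + off t \<le> j" and w: "written t Rightward k (i, j) e"
    using s by (auto simp: in_diagram_iff e_def)
  have ab: "(a - 1, b) \<in> diagram t m" "val S (a - 1, b) + (a - 1) < k" "b = j + 1"
    using l False ij tableaux_dom[OF S] by auto
  have "(i, b) \<in> diagram t m" using False ij ab by (intro diagram_down[OF m ab(1)]) auto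
  then have "fst e \<le> val S (i, b)" using s ij ab(3) by (auto simp: e_def)
  also have "\<dots> \<le> val S (a - 1, b)" using False ij ab by (intro tableaux_mono[OF m S ab(1)]) auto
  finally have "fst e + (a - 1) < k" using ab(2) by simp
  then show ?thesis
    using entry_of_Rightward[of t k i j] w False unfolding e_def[symmetric] by auto
qed simp

text \<open>The entry below the source is at least the carried red one, so at column
  \<open>j\<close> its index has reached \<open>k\<close>.\<close>

lemma lands_Downward_col:
  assumes m: "strict_partition m" and S: "S \<in> tableaux t m"
    and s: "source t m S k (i, j) Downward" and l: "lands t S k (i, j) Downward (a, b)" and i: "1 \<le> i"
  shows "b \<le> j"
proof (rule ccontr)
  assume b: "\<not> b \<le> j"
  let ?e = "entry_of t Downward k (i, j)"
  have ij: "i + 1 + off t \<le> j" and w: "written t Downward k (i, j) ?e" "\<not> diagonal t (i, j)"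
    using s i by (auto simp: in_diagram_iff diagonal_iff)
  have ab: "(a, b - 1) \<in> diagram t m" "val S (a, b - 1) + (b - 1) < k" "a = i + 1"
    using l b ij tableaux_dom[OF S] by auto
  have "(a, j) \<in> diagram t m" using b ij ab by (intro diagram_down[OF m ab(1)]) auto
  then have "fst ?e \<le> val S (a, j)" using s i ab(3) by (auto)
  also have "\<dots> \<le> val S (a, b - 1)" using b ij ab by (intro tableaux_mono[OF m S ab(1)]) auto
  finally show False using ab(2) written_Red(1)[OF w] b by simp
qed

lemma source_target:
  assumes m: "strict_partition m" and S: "S \<in> tableaux t m" and k: "1 \<le> k"
    and s: "source t m S k p d" and l: "lands t S k p d q"
  shows "target t m S k q (entry_of t d k q) \<and> written t d k q (entry_of t d k q)"
proof -
  obtain i j a b where p: "p = (i, j)" and q: "q = (a, b)" by (metis surj_pair)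
  let ?e = "entry_of t d k (i, j)" and ?f = "entry_of t d k (a, b)"
  have dom: "dom S = diagram t m" by (rule tableaux_dom[OF S])
  show ?thesis
  proof (cases d)
    case Rightward
    have ij: "1 \<le> i" "i + off t \<le> j" "(i, j) \<in> diagram t m" and w: "written t d k (i, j) ?e" "val S (i, j) \<le> fst ?e"
      using s unfolding p Rightward by (auto simp: in_diagram_iff)
    have ab: "b = j + 1" "1 \<le> a" "a + off t \<le> b" using l by (auto simp: p q Rightward)
    note row = lands_Rightward_row[OF m S s[unfolded p Rightward] l[unfolded p q Rightward]]
    have ak: "a \<le> k" using row w written_bounds[OF w(1) ij(2)] by auto
    \<comment> \<open>In type B a rightward bump never reaches the diagonal. In type D it does so
      only from the previous diagonal cell with \<open>k - i\<close> odd, and then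
      \<open>k - a\<close> is even.\<close>
    have f: "?f = (k - a, Black)"
      using row ab ij by (cases t) (auto simp: Rightward diagonal_iff entry_of.simps)
    have wf: "written t d k (a, b) ?f" using ak Rightward ab by (simp add: written_iff)
    have "(a, b - 1) \<in> diagram t m \<and> val S (a, b - 1) \<le> k - a" if "a + off t < b"
    proof -
      have ai: "a \<le> i" using row that ab by auto
      have "val S (a, j) \<le> val S (i, j)"
        using ai ab that by (intro tableaux_mono[OF m S ij(3)]) auto
      also have "\<dots> \<le> k - a" using w(2) written_bounds(1)[OF w(1) ij(2)] ai by linarith
      finally show ?thesis using diagram_down[OF m ij(3), of a j] ai ab that by auto
    qed
    moreover have "(a - 1, b) \<in> diagram t m \<and> val S (a - 1, b) \<le> k - a" if "1 < a"
      using l that by (auto simp: p q Rightward dom)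
    moreover have "k - a \<le> val S (a, b)" if "(a, b) \<in> diagram t m"
      using l that by (auto simp: p q Rightward dom)
    moreover have "diagonal_entry t ?f" if "diagonal t (a, b)" using wf that by (simp add: written_def)
    ultimately have "target t m S k (a, b) ?f" using ab(2,3) written_index[OF wf] by (simp add: f)
    then show ?thesis using wf q by simp
  next
    case Downward
    have ab: "a = i + 1" "a + off t \<le> b" using l by (auto simp: p q Downward)
    have w: "written t d k (i, j) ?e" "\<not> diagonal t (i, j)" "val S (i, j) \<le> fst ?e" "(i, j) \<in> diagram t m" if "1 \<le> i"
      using s that unfolding p Downward by (auto)
    have col: "b \<le> j \<and> fst ?e + j = k" if "1 \<le> i"
      using lands_Downward_col[OF m S s[unfolded p Downward] l[unfolded p q Downward] that]
        written_Red(1)[OF w(1,2)[unfolded Downward]] that Downward by simp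
    have bk: "a \<le> k" "diagonal t (a, b) \<or> b \<le> k"
      using col l k ab by (cases "1 \<le> i"; auto simp: p q Downward diagonal_iff)+
    have wf: "written t d k (a, b) ?f" using bk Downward ab by (simp add: written_iff)
    have diag: "diagonal_entry t ?f" if "diagonal t (a, b)" using wf that by (simp add: written_def)
    note bounds = written_bounds[OF wf ab(2)]
    have "(a, b - 1) \<in> diagram t m \<and> val S (a, b - 1) \<le> fst ?f" if "a + off t < b"
      using l that bounds by (auto simp: p q Downward dom)
    moreover have "(a - 1, b) \<in> diagram t m \<and> val S (a - 1, b) \<le> fst ?f" if "1 < a"
    proof -
      have i: "1 \<le> i" using that ab by simp
      have "val S (i, b) \<le> val S (i, j)"
        using col i ab by (intro tableaux_mono[OF m S w(4)]) auto
      also have "\<dots> \<le> fst ?f" using col[OF i] w(3)[OF i] bounds by linarith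
      finally show ?thesis using diagram_down[OF m w(4), of i b] i ab col by auto
    qed
    moreover have "fst ?f \<le> val S (a, b)" if ab_in: "(a, b) \<in> diagram t m"
    proof -
      have old: "k \<le> val S (a, b) + b" using l that by (auto simp: p q Downward dom)
      show ?thesis
      proof (cases "diagonal t (a, b) \<and> t = TypeD")
        case True
        \<comment> \<open>Comparing indices only shows that the new value exceeds the old one by at
          most one, because the new entry may be black. Both values being even removes the
          excess.\<close>
        have "even (val S (a, b))" "even (fst ?f)"
          using tableaux_diag[OF S ab_in] True diag
          by (cases "the (S (a, b))"; cases ?f; simp add: val_def)+
        moreover have "fst ?f \<le> val S (a, b) + 1" using old bounds True by (simp add: diagonal_iff)
        ultimately show ?thesis by (metis Suc_eq_plus1 even_Suc le_SucE)
      next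
        case False
        then have "fst ?f + b = k"
          using wf written_Red(1)[of t k a b ?f] Downward bounds by (cases t; cases "b = a") (auto simp: diagonal_iff)
        then show ?thesis using old by simp
      qed
    qed
    ultimately have "target t m S k (a, b) ?f" using ab diag written_index[OF wf] by simp
    then show ?thesis using wf q by simp
  next
    case Stop
    then show ?thesis using l p q by simp
  qed
qed

lemma bump_iff:
  assumes m: "strict_partition m" and S: "S \<in> tableaux t m" and k: "1 \<le> k"
    and s: "source t m S k p d" and l: "lands t S k p d q"
  shows "bump t (S, p, d, enat k) out \<longleftrightarrow> out = outcome t S q (entry_of t d k q)"
proof -
  obtain i j a b where p: "p = (i, j)" and q: "q = (a, b)" by (metis surj_pair)
  let ?f = "entry_of t d k (a, b)"
  have dom: "dom S = diagram t m" by (rule tableaux_dom[OF S])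
  have T: "target t m S k (a, b) ?f" and wf: "written t d k (a, b) ?f"
    using source_target[OF assms] q by auto
  have ab: "1 \<le> a" "a + off t \<le> b" using T by auto
  show ?thesis
  proof (cases d)
    case Rightward
    have b: "b = j + 1" using l by (simp add: p q Rightward)
    have "fst ?f \<le> val S (a + 1, b)" if "(a + 1, b) \<in> diagram t m"
    proof -
      have "val S (a, b) \<le> val S (a + 1, b)"
        by (rule tableaux_mono[OF m S that]) (use ab in auto)
      moreover have "(a, b) \<in> diagram t m"
        by (rule diagram_down[OF m that]) (use ab in auto)
      ultimately show ?thesis using T by auto
    qed
    then have "enat (fst ?f) \<le> value_at S (a + 1, b)" by (simp add: le_value_at_iff dom)
    moreover have "value_at S (a - 1, b) \<le> enat (fst ?f)"
      using T ab by (cases "a = 1") (auto simp: value_at_le_iff dom)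
    ultimately have fits: "fits_right t S k a (j + 1) ?f"
      using wf ab by (simp add: fits_right_def right_of_or_on_diagonal_iff b Rightward)
    \<comment> \<open>Below the first place with index at least \<open>k\<close>, the upper
      neighbour of any row \<open>r\<close> is at least the entry in row \<open>a\<close>, hence at
      least \<open>k - a\<close>. This exceeds any value that represents \<open>x_k\<close> in row
      \<open>r\<close>.\<close>
    have max: "r \<le> a" if "fits_right t S k r (j + 1) f" for r f
    proof (rule ccontr)
      assume r: "\<not> r \<le> a"
      have wr: "written t Rightward k (r, b) f" "r + off t \<le> b" and r1: "(r - 1, b) \<in> diagram t m" "val S (r - 1, b) \<le> fst f"
        using that r ab by (auto simp: fits_right_def right_of_or_on_diagonal_iff b value_at_le_iff dom)
      have "(a, b) \<in> diagram t m" using r ab by (intro diagram_down[OF m r1(1)]) auto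
      then have "k \<le> val S (a, b) + a" using l by (auto simp: p q Rightward dom)
      also have "\<dots> \<le> val S (r - 1, b) + a" using r ab tableaux_mono[OF m S r1(1), of a b] by auto
      finally show False using r1(2) written_bounds(1)[OF wr] r by simp
    qed
    have largest: "is_largest (\<lambda>r. \<exists>e. fits_right t S k r (j + 1) e) r \<longleftrightarrow> r = a" for r
      using fits max unfolding is_largest_def by (metis le_antisym)
    have unique: "fits_right t S k a (j + 1) e \<longleftrightarrow> e = ?f" for e
      using fits written_imp_entry_of[of t Rightward k "(a, b)" e] by (auto simp: fits_right_def b Rightward)
    show ?thesis
    proof
      assume "bump t (S, p, d, enat k) out"
      then obtain r e where "is_largest (\<lambda>r. \<exists>e. fits_right t S k r (j + 1) e) r"
        "fits_right t S k r (j + 1) e" "out = outcome t S (r, j + 1) e"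
        unfolding p Rightward by (cases rule: bump.cases) simp
      then show "out = outcome t S q (entry_of t d k q)"
        unfolding largest q b using unique b by simp
    next
      assume "out = outcome t S q (entry_of t d k q)"
      then show "bump t (S, p, d, enat k) out"
        using bump_rightward[of t S k j a ?f i] fits largest[of a] unfolding p q Rightward b by simp
    qed
  next
    case Downward
    have a: "a = i + 1" using l by (simp add: p q Downward)
    have "fst ?f \<le> val S (a, b + 1)" if "(a, b + 1) \<in> diagram t m"
    proof -
      have "val S (a, b) \<le> val S (a, b + 1)"
        by (rule tableaux_mono[OF m S that]) (use ab in auto)
      moreover have "(a, b) \<in> diagram t m"
        by (rule diagram_down[OF m that]) (use ab in auto)
      ultimately show ?thesis using T by auto
    qed
    then have "enat (fst ?f) \<le> value_at S (a, b + 1)" by (simp add: le_value_at_iff dom a)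
    moreover have "value_left t S (a, b) \<le> enat (fst ?f)"
      using T ab by (cases "diagonal t (a, b)") (auto simp: value_at_le_iff dom diagonal_iff zero_enat_def)
    ultimately have fits: "fits_down t S k (i + 1) b ?f"
      using wf ab by (simp add: fits_down_def right_of_or_on_diagonal_iff a Downward)
    have max: "c \<le> b" if "fits_down t S k (i + 1) c f" for c f
    proof (rule ccontr)
      assume c: "\<not> c \<le> b"
      then have nd: "\<not> diagonal t (a, c)" using ab by (simp add: diagonal_iff)
      have wr: "written t Downward k (a, c) f" and c1: "(a, c - 1) \<in> diagram t m" "val S (a, c - 1) \<le> fst f"
        using that nd c ab by (auto simp: fits_down_def a value_at_le_iff dom)
      have "(a, b) \<in> diagram t m" using c ab by (intro diagram_down[OF m c1(1)]) auto
      then have "k \<le> val S (a, b) + b" using l by (auto simp: p q Downward dom)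
      also have "\<dots> \<le> val S (a, c - 1) + b" using c ab tableaux_mono[OF m S c1(1), of a b] by auto
      finally show False using c1(2) written_Red(1)[OF wr nd] c by simp
    qed
    have largest: "is_largest (\<lambda>c. \<exists>e. fits_down t S k (i + 1) c e) c \<longleftrightarrow> c = b" for c
      using fits max unfolding is_largest_def by (metis le_antisym)
    have unique: "fits_down t S k (i + 1) b e \<longleftrightarrow> e = ?f" for e
      using fits written_imp_entry_of[of t Downward k "(a, b)" e] by (auto simp: fits_down_def a Downward)
    show ?thesis
    proof
      assume "bump t (S, p, d, enat k) out"
      then obtain c e where "is_largest (\<lambda>c. \<exists>e. fits_down t S k (i + 1) c e) c"
        "fits_down t S k (i + 1) c e" "out = outcome t S (i + 1, c) e"
        unfolding p Downward by (cases rule: bump.cases) simp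
      then show "out = outcome t S q (entry_of t d k q)"
        unfolding largest q a using unique a by simp
    next
      assume "out = outcome t S q (entry_of t d k q)"
      then show "bump t (S, p, d, enat k) out"
        using bump_downward[of t S k i b ?f j] fits largest[of b] unfolding p q Downward a by simp
    qed
  next
    case Stop
    then show ?thesis using l p q by simp
  qed
qed

section \<open>Reversing a bump\<close>

lemma target_source_left:
  assumes m: "strict_partition m" and S: "S \<in> tableaux t m"
    and T: "target t m S k (a, b) e" and nd: "\<not> diagonal t (a, b)" and black: "snd e = Black"
  shows "\<exists>p. source t m S k p Rightward \<and> lands t S k p Rightward (a, b) \<and> entry_of t Rightward k (a, b) = e"
proof -
  have dom: "dom S = diagram t m" by (rule tableaux_dom[OF S])
  have ab: "1 \<le> a" "a + off t < b" using T nd by (auto simp: diagonal_iff)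
  have e: "fst e + a = k" using T black by (cases e) auto
  define j where "j = b - 1"
  have aj: "(a, j) \<in> diagram t m" "val S (a, j) \<le> fst e" using T ab by (auto simp: j_def)
  \<comment> \<open>The source is the last row of the previous column whose entry, read as black,
    has index at most \<open>k\<close>. The cell left of the target qualifies, so the maximum exists
    and lies in row \<open>a\<close> or lower.\<close>
  let ?P = "\<lambda>r. (r, j) \<in> diagram t m \<and> val S (r, j) + r \<le> k"
  define i where "i = (GREATEST r. ?P r)"
  have bound: "\<forall>r. ?P r \<longrightarrow> r \<le> j" by (auto simp: in_diagram_iff)
  have Pa: "?P a" using aj e by simp
  have P: "?P i" unfolding i_def using GreatestI_nat[of ?P a j] Pa bound by blast
  have ai: "a \<le> i" unfolding i_def using Greatest_le_nat[of ?P a j] Pa bound by blast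
  have next_i: "k < val S (i + 1, j) + (i + 1)" if "(i + 1, j) \<in> diagram t m"
  proof (rule ccontr)
    assume "\<not> ?thesis"
    then have "?P (i + 1)" using that by simp
    then have "i + 1 \<le> i" unfolding i_def using Greatest_le_nat[of ?P _ j] bound by blast
    then show False by simp
  qed
  have ij: "i + off t \<le> j" using P by (auto simp: in_diagram_iff)
  let ?f = "entry_of t Rightward k (i, j)"
  have w: "written t Rightward k (i, j) ?f" using P ij by (simp add: written_iff)
  have fk: "fst ?f + i \<le> k" by (rule written_bounds(1)[OF w ij])
  have "val S (i, j) \<le> fst ?f"
  proof (cases "fst ?f + i = k")
    case True
    then show ?thesis using P by simp
  next
    case False
    then have D: "t = TypeD" "j = i + 1" "?f = (k - i - 1, Red)" "odd (k - i)"
      using entry_of_Rightward[OF w] by auto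
    \<comment> \<open>The old value is at most \<open>k - i\<close>; being even while
      \<open>k - i\<close> is odd, it is at most \<open>k - i - 1\<close>.\<close>
    then have "even (val S (i, j))"
      using tableaux_diag[OF S, of "(i, j)"] P by (cases "the (S (i, j))") (auto simp: val_def)
    then have "val S (i, j) \<noteq> k - i" using D by metis
    then show ?thesis using P D by auto
  qed
  moreover have "fst ?f \<le> val S (i + 1, j)" if "(i + 1, j) \<in> diagram t m"
    using next_i[OF that] fk by linarith
  moreover have "fst ?f \<le> val S (i, j + 1)" if "(i, j + 1) \<in> diagram t m"
  proof -
    have "(a, b) \<in> diagram t m" by (rule diagram_down[OF m that]) (use ai ab j_def in auto)
    then have "fst e \<le> val S (a, b)" using T by simp
    also have "\<dots> \<le> val S (i, j + 1)" by (rule tableaux_mono[OF m S that]) (use ai ab j_def in auto)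
    finally show ?thesis using fk e ai by linarith
  qed
  ultimately have "source t m S k (i, j) Rightward" using P w by auto
  moreover have "lands t S k (i, j) Rightward (a, b)"
    using T e ab by (auto simp: j_def dom)
  moreover have "entry_of t Rightward k (a, b) = e"
    using nd e black by (cases e) (auto simp: entry_of.simps)
  ultimately show ?thesis by blast
qed

text \<open>The transposed search: the source is the last column of the row above whose entry, read
  as red, has index at most \<open>k\<close>, or \<open>(0, 0)\<close> if the target is in the first
  row. The condition on the upper neighbour follows from \<open>target\<close> for a red entry, but
  a black diagonal entry in type D can violate it.\<close>

lemma target_source_above:
  assumes m: "strict_partition m" and S: "S \<in> tableaux t m"
    and T: "target t m S k (a, b) e" and w: "written t Downward k (a, b) e"
    and up: "1 < a \<Longrightarrow> val S (a - 1, b) + b \<le> k"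
  shows "\<exists>p. source t m S k p Downward \<and> lands t S k p Downward (a, b) \<and> entry_of t Downward k (a, b) = e"
proof -
  have dom: "dom S = diagram t m" by (rule tableaux_dom[OF S])
  have ab: "1 \<le> a" "a + off t \<le> b" using T by auto
  have e: "entry_of t Downward k (a, b) = e" using written_imp_entry_of[OF w] by simp
  have ek: "k \<le> fst e + b" by (rule written_bounds(2)[OF w ab(2)])
  have "val S (a, b - 1) + (b - 1) < k" if "a + off t < b"
  proof -
    have "\<not> diagonal t (a, b)" using that by (simp add: diagonal_iff)
    then have "fst e + b = k" by (rule written_Red(1)[OF w])
    then show ?thesis using T that by auto
  qed
  then have lands: "lands t S k (a - 1, j) Downward (a, b)" for j
    using T ek ab by (auto simp: dom)
  show ?thesis
  proof (cases "a = 1")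
    case True
    then show ?thesis using lands[of 0] e by (intro exI[of _ "(0, 0)"]) simp
  next
    case False
    define i where "i = a - 1"
    have i: "a = i + 1" "1 \<le> i" using False ab by (auto simp: i_def)
    let ?P = "\<lambda>c. (i, c) \<in> diagram t m \<and> val S (i, c) + c \<le> k"
    define j where "j = (GREATEST c. ?P c)"
    have bound: "\<forall>c. ?P c \<longrightarrow> c \<le> k" by auto
    have Pb: "?P b" using T up i by simp
    have P: "?P j" unfolding j_def using GreatestI_nat[of ?P b k] Pb bound by blast
    have bj: "b \<le> j" unfolding j_def using Greatest_le_nat[of ?P b k] Pb bound by blast
    have next_j: "k < val S (i, j + 1) + (j + 1)" if "(i, j + 1) \<in> diagram t m"
    proof (rule ccontr)
      assume "\<not> ?thesis"
      then have "?P (j + 1)" using that by simp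
      then have "j + 1 \<le> j" unfolding j_def using Greatest_le_nat[of ?P _ k] bound by blast
      then show False by simp
    qed
    have nd: "\<not> diagonal t (i, j)" and ij: "i + off t \<le> j" using bj ab i by (auto simp: diagonal_iff)
    let ?f = "entry_of t Downward k (i, j)"
    have f: "?f = (k - j, Red)" using nd by (simp add: entry_of.simps)
    have jk: "j \<le> k" using P by simp
    have wf: "written t Downward k (i, j) ?f" using jk ij by (simp add: written_iff)
    have "fst ?f \<le> val S (i + 1, j)" if "(i + 1, j) \<in> diagram t m"
    proof -
      have "(a, b) \<in> diagram t m" by (rule diagram_down[OF m that]) (use bj ab i in auto)
      then have "fst e \<le> val S (a, b)" using T by simp
      also have "\<dots> \<le> val S (i + 1, j)" by (rule tableaux_mono[OF m S that]) (use bj ab i in auto)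
      finally show ?thesis using f ek bj by simp
    qed
    moreover have "fst ?f \<le> val S (i, j + 1)" if "(i, j + 1) \<in> diagram t m"
      using next_j[OF that] f by simp
    ultimately have "source t m S k (i, j) Downward" using P wf nd f by auto
    then show ?thesis using lands[of j] e i by auto
  qed
qed

lemma target_source:
  assumes m: "strict_partition m" and S: "S \<in> tableaux t m" and T: "target t m S k q e"
  shows "\<exists>p d. source t m S k p d \<and> lands t S k p d q \<and> entry_of t d k q = e"
proof -
  obtain a b where q: "q = (a, b)" by force
  obtain v c where e: "e = (v, c)" by force
  have ab: "1 \<le> a" "a + off t \<le> b" and idx: "var_index (a, b) e = k"
    and up: "1 < a \<Longrightarrow> (a - 1, b) \<in> diagram t m \<and> val S (a - 1, b) \<le> v"
    using T by (auto simp: q e)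
  show ?thesis
  proof (cases "diagonal t (a, b)")
    case False
    show ?thesis
    proof (cases c)
      case Black
      then have "snd e = Black" by (simp add: e)
      then show ?thesis using target_source_left[OF m S T[unfolded q] False] unfolding q by blast
    next
      case Red
      have "written t Downward k (a, b) e" using idx False Red e by (simp add: written_def)
      moreover have "val S (a - 1, b) + b \<le> k" if "1 < a" using up[OF that] idx e Red by simp
      ultimately show ?thesis
        using target_source_above[OF m S T[unfolded q]] unfolding q by blast
    qed
  next
    case True
    then have w: "written t Downward k (a, b) e" using T by (simp add: written_def q)
    show ?thesis
    proof (cases "1 < a \<longrightarrow> val S (a - 1, b) + b \<le> k")
      case True
      then show ?thesis using target_source_above[OF m S T[unfolded q] w] unfolding q by blast
    next
      \<comment> \<open>Here the type D diagonal entry is black and equal to the entry above it. It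
        did not come from the row above but from the previous diagonal cell, where
        \<open>x_k\<close> is the red entry with the same value.\<close>
      case above: False
      have t: "t = TypeD"
        using above True up idx e T q by (cases t; cases c) (auto simp: diagonal_iff)
      then have b: "b = a + 1" using True by (simp add: diagonal_iff)
      have v: "k = v + a" "c = Black" "val S (a - 1, b) = v" "even v"
        using above up idx e b T t q by (cases c; auto)+
      define i where "i = a - 1"
      have i: "a = i + 1" "1 \<le> i" using above by (auto simp: i_def)
      have mem: "(i, a + 1) \<in> diagram t m" using up above b i by simp
      have mem': "(i, a) \<in> diagram t m" by (rule diagram_down[OF m mem]) (use i t in auto)
      have f: "entry_of t Rightward k (i, a) = (v, Red)"
        using v i t by (simp add: entry_of.simps)
      have "val S (i, a) \<le> v"
        using tableaux_mono[OF m S mem, of i a] i t v b by simp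
      then have "source t m S k (i, a) Rightward"
        using mem mem' f v i b t by (auto simp: written_def in_diagram_iff)
      moreover have "lands t S k (i, a) Rightward (a, b)"
        using v i b t T mem by (auto simp: tableaux_dom[OF S] e q)
      moreover have "entry_of t Rightward k (a, b) = e"
        using v e b t by (simp add: entry_of.simps)
      ultimately show ?thesis unfolding q by blast
    qed
  qed
qed

text \<open>Of two sources in one column the lower one has the smaller carried value, but
  monotonicity between them forces the opposite; likewise for two sources in one row.\<close>

lemma source_unique:
  assumes m: "strict_partition m" and S: "S \<in> tableaux t m" and k: "1 \<le> k"
    and 1: "source t m S k p d" "lands t S k p d q" "entry_of t d k q = e"
    and 2: "source t m S k p' d'" "lands t S k p' d' q" "entry_of t d' k q = e"
  shows "p = p' \<and> d = d'"
proof -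
  have dom: "dom S = diagram t m" by (rule tableaux_dom[OF S])
  have right: False
    if s: "source t m S k (i, j) Rightward" "source t m S k (i', j) Rightward" "i < i'" for i i' j
  proof -
    let ?e = "entry_of t Rightward k (i, j)" and ?e' = "entry_of t Rightward k (i', j)"
    have ij: "(i', j) \<in> diagram t m" "1 \<le> i" "i' + off t \<le> j" using s by (auto simp: in_diagram_iff)
    have mem: "(i + 1, j) \<in> diagram t m" by (rule diagram_down[OF m ij(1)]) (use ij s in auto)
    have "fst ?e + i = k"
      using s entry_of_Rightward[of t k i j] mem ij by (auto simp: in_diagram_iff)
    moreover have "fst ?e \<le> val S (i + 1, j)" using s mem by auto
    moreover have "val S (i + 1, j) \<le> val S (i', j)" by (rule tableaux_mono[OF m S ij(1)]) (use ij s in auto)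
    moreover have "val S (i', j) \<le> fst ?e'" using s ij by auto
    moreover have "fst ?e' + i' \<le> k" using s ij by (intro written_bounds(1)) auto
    ultimately show False using s by linarith
  qed
  have down: False
    if s: "source t m S k (i, j) Downward" "source t m S k (i, j') Downward" "j < j'" "1 \<le> i" for i j j'
  proof -
    have ij: "(i, j') \<in> diagram t m" "(i, j) \<in> diagram t m" "i + off t \<le> j" using s by (auto simp: in_diagram_iff)
    have mem: "(i, j + 1) \<in> diagram t m" by (rule diagram_down[OF m ij(1)]) (use ij s in auto)
    have "fst (entry_of t Downward k (i, j)) + j = k" "fst (entry_of t Downward k (i, j')) + j' = k"
      using s by (auto intro!: written_Red(1))
    moreover have "fst (entry_of t Downward k (i, j)) \<le> val S (i, j + 1)" using s mem by auto
    moreover have "val S (i, j + 1) \<le> val S (i, j')" by (rule tableaux_mono[OF m S ij(1)]) (use ij s in auto)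
    moreover have "val S (i, j') \<le> fst (entry_of t Downward k (i, j'))" using s by auto
    ultimately show False using s by linarith
  qed
  \<comment> \<open>Both directions write the same entry only on the diagonal. The rightward source
    is then the previous type D diagonal cell carrying \<open>k - i - 1\<close>, whereas the
    downward source lies in the same row at column \<open>b\<close> or later and has value at most
    \<open>k - b\<close>, which is smaller.\<close>
  have mixed: False
    if s: "source t m S k (i, j) Rightward" "lands t S k (i, j) Rightward (a, b)"
      "source t m S k (i', j') Downward" "lands t S k (i', j') Downward (a, b)"
      "entry_of t Rightward k (a, b) = entry_of t Downward k (a, b)" for i j i' j' a b
  proof -
    have ij: "1 \<le> i" "i + off t \<le> j" and ab: "b = j + 1" "a = i' + 1" using s by (auto simp: in_diagram_iff)
    have diag: "diagonal t (a, b)" using s(5) by (auto simp: entry_of.simps split: if_splits)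
    then have D: "a = i + 1" "t = TypeD" "j = i + 1" "entry_of t Rightward k (i, j) = (k - i - 1, Red)" "odd (k - i)"
      using lands_Rightward_row[OF m S s(1,2)] ij ab by (auto simp: diagonal_iff)
    have i': "i' = i" "1 \<le> i'" using ab D ij by auto
    have c: "b \<le> j'" by (rule lands_Downward_col[OF m S s(3,4) i'(2)])
    have mem: "(i, j') \<in> diagram t m" "fst (entry_of t Downward k (i, j')) + j' = k"
       "val S (i, j') \<le> fst (entry_of t Downward k (i, j'))"
      using s(3) i' by (auto intro!: written_Red(1))
    have "(i, b) \<in> diagram t m" using s(2) D ij dom ab by auto
    then have "k - i - 1 \<le> val S (i, b)" using s(1) D ab by auto
    also have "\<dots> \<le> val S (i, j')" by (rule tableaux_mono[OF m S mem(1)]) (use ab c ij D in auto)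
    finally show False using mem c ab D by linarith
  qed
  obtain i j i' j' a b where e: "p = (i, j)" "p' = (i', j')" "q = (a, b)" by (metis surj_pair)
  have dirs: "d = Rightward \<or> d = Downward" "d' = Rightward \<or> d' = Downward"
    using 1 2 e by auto
  have "d = d'"
  proof (rule ccontr)
    assume "d \<noteq> d'"
    with dirs consider (rd) "d = Rightward" "d' = Downward" | (dr) "d = Downward" "d' = Rightward"
      by blast
    then show False
    proof cases
      case rd
      show False
        by (rule mixed[OF 1(1,2)[unfolded e rd] 2(1,2)[unfolded e rd]]) (use 1(3) 2(3) in \<open>simp add: e rd\<close>)
    next
      case dr
      show False
        by (rule mixed[OF 2(1,2)[unfolded e dr] 1(1,2)[unfolded e dr]]) (use 1(3) 2(3) in \<open>simp add: e dr\<close>)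
    qed
  qed
  moreover have "p = p'"
  proof (cases "d = Rightward")
    case True
    then have d': "d' = Rightward" using calculation by simp
    have j: "j = j'" using 1(2) 2(2) e True d' by simp
    have "\<not> i < i'" "\<not> i' < i"
      using right[OF 1(1)[unfolded e True] 2(1)[unfolded e d' j[symmetric]]]
        right[OF 2(1)[unfolded e d' j[symmetric]] 1(1)[unfolded e True]] by blast+
    then show ?thesis using e j by simp
  next
    case False
    then have d: "d = Downward" using dirs by simp
    have d': "d' = Downward" using calculation d by simp
    have i: "i' = i" using 1(2) 2(2) e d d' by simp
    note s = 1(1)[unfolded e d] 2(1)[unfolded e d' i]
    have "j = j'" if "1 \<le> i"
      using down[OF s _ that] down[OF s(2,1) _ that] by (metis linorder_neqE_nat)
    moreover have "j = j'" if "i = 0"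
      using s that by (simp add: in_diagram_iff)
    ultimately show ?thesis using e i by (cases "i = 0") auto
  qed
  ultimately show ?thesis by simp
qed

declare lands.simps [simp del] source.simps [simp del] target.simps [simp del]

section \<open>Iterating an injective partial map\<close>

text \<open>If \<open>R\<close> is a bijection from \<open>P\<close> to \<open>Q\<close> that preserves an invariant with finite fibres, then no
  orbit that starts outside \<open>Q\<close> can run into a cycle, so iterating \<open>R\<close> is a bijection from
  \<open>P - Q\<close> to \<open>Q - P\<close>.\<close>
locale partial_bijection =
  fixes R :: "'a \<Rightarrow> 'a \<Rightarrow> bool" and P Q :: "'a set" and invar :: "'a \<Rightarrow> 'b"
  assumes total: "x \<in> P \<Longrightarrow> \<exists>y. R x y"
    and deterministic: "x \<in> P \<Longrightarrow> R x y \<Longrightarrow> R x y' \<Longrightarrow> y = y'"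
    and into: "x \<in> P \<Longrightarrow> R x y \<Longrightarrow> y \<in> Q \<and> invar y = invar x"
    and surjective: "y \<in> Q \<Longrightarrow> \<exists>x\<in>P. R x y"
    and injective: "x \<in> P \<Longrightarrow> x' \<in> P \<Longrightarrow> R x y \<Longrightarrow> R x' y \<Longrightarrow> x = x'"
    and final: "x \<in> Q \<Longrightarrow> x \<notin> P \<Longrightarrow> \<not> R x y"
    and finite_fibre: "finite {x \<in> P. invar x = w}"
begin

lemma step_source: "x \<in> P \<union> Q \<Longrightarrow> R x y \<Longrightarrow> x \<in> P"
  using final by blast

lemma reachable: "R\<^sup>*\<^sup>* x y \<Longrightarrow> x \<in> P \<union> Q \<Longrightarrow> y \<in> P \<union> Q \<and> invar y = invar x"
proof (induction rule: rtranclp_induct)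
  case (step y z)
  then show ?case using step_source[of y z] into[of y z] by auto
qed simp

text \<open>An infinite orbit stays in one finite fibre and so repeats a state. Injectivity moves
  the repetition back to the start, which would then have a predecessor and lie in
  \<open>Q\<close>.\<close>

lemma terminates:
  assumes "a \<in> P - Q"
  shows "terminates R a"
  unfolding terminates_def
proof
  assume "\<exists>f. f 0 = a \<and> (\<forall>n. R (f n) (f (Suc n)))"
  then obtain f where f: "f 0 = a" "\<And>n. R (f n) (f (Suc n))" by blast
  have "R\<^sup>*\<^sup>* a (f n)" for n by (induction n) (auto simp: f intro: rtranclp.rtrancl_into_rtrancl)
  then have in_P: "f n \<in> P" "invar (f n) = invar a" for n
    using reachable[of a "f n"] assms step_source[OF _ f(2)] by auto
  have "finite (range f)"
    by (rule finite_subset[OF _ finite_fibre[of "invar a"]]) (use in_P in auto)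
  then have "\<not> inj f" using finite_imageD infinite_UNIV_nat by blast
  then obtain i j where "f i = f j" "i < j"
    unfolding inj_def by (metis linorder_neqE_nat)
  then have "f 0 = f (j - i)"
  proof (induction i arbitrary: j)
    case (Suc i)
    then obtain j' where j: "j = Suc j'" by (cases j) auto
    have "f i = f j'" using Suc.prems f(2)[of i] f(2)[of j'] j by (auto intro: injective[OF in_P(1) in_P(1)])
    then show ?case using Suc.IH[of j'] Suc.prems j by simp
  qed simp
  moreover obtain n where "j - i = Suc n" using \<open>i < j\<close> by (metis Suc_diff_Suc)
  ultimately have "a \<in> Q" using into[OF in_P(1) f(2)[of n]] f(1) by metis
  then show False using assms by simp
qed

lemma reaches_end:
  assumes "a \<in> P - Q"
  shows "\<exists>c\<in>Q - P. R\<^sup>*\<^sup>* a c"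
proof (rule ccontr)
  assume no: "\<not> ?thesis"
  have next_P: "x \<in> P" if "R\<^sup>*\<^sup>* a x" for x
    using reachable[OF that] assms no that by blast
  define g where "g x = (SOME y. R x y)" for x
  have g: "R x (g x)" if "x \<in> P" for x
    using someI_ex[OF total[OF that]] by (simp add: g_def)
  have "R\<^sup>*\<^sup>* a ((g ^^ n) a)" for n
    by (induction n) (auto intro: rtranclp.rtrancl_into_rtrancl g next_P)
  then have "R ((g ^^ n) a) ((g ^^ Suc n) a)" for n using g next_P by simp
  then have "\<exists>f. f 0 = a \<and> (\<forall>n. R (f n) (f (Suc n)))"
    by (intro exI[of _ "\<lambda>n. (g ^^ n) a"]) simp
  then show False using terminates[OF assms] unfolding terminates_def by blast
qed

lemma end_unique:
  assumes "x \<in> P \<union> Q" "R\<^sup>*\<^sup>* x c" "R\<^sup>*\<^sup>* x c'" "c \<in> Q - P" "c' \<in> Q - P"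
  shows "c = c'"
  using assms(2,1,3)
proof (induction rule: converse_rtranclp_induct)
  case base
  then show ?case using assms final by (metis DiffE converse_rtranclpE)
next
  case (step x y)
  have x: "x \<in> P" using step_source step by blast
  then have "x \<noteq> c'" using assms by auto
  then obtain z where "R x z" "R\<^sup>*\<^sup>* z c'" using step.prems by (metis converse_rtranclpE)
  then show ?case using step deterministic[OF x] into[OF x] by (metis UnI2)
qed

lemma start_unique:
  assumes "a \<in> P - Q" "a' \<in> P - Q" "R\<^sup>*\<^sup>* a c" "R\<^sup>*\<^sup>* a' c"
  shows "a = a'"
  using assms(3,4)
proof (induction rule: rtranclp_induct)
  case base
  show ?case
  proof (rule ccontr)
    assume "a \<noteq> a'"
    then obtain z where z: "R\<^sup>*\<^sup>* a' z" "R z a" using base by (metis rtranclp.cases)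
    then have "z \<in> P" using reachable[OF z(1)] assms step_source by blast
    then show False using into[OF _ z(2)] assms by blast
  qed
next
  case (step x y)
  have x: "x \<in> P" using reachable[OF step(1)] assms step_source[OF _ step(2)] by blast
  then have "y \<in> Q" using into step by blast
  then have "a' \<noteq> y" using assms by blast
  then obtain z where z: "R\<^sup>*\<^sup>* a' z" "R z y" using step.prems by (metis rtranclp.cases)
  then have "z \<in> P" using reachable[OF z(1)] assms step_source by blast
  then show ?case using injective[OF x _ step(2) z(2)] z step.IH by blast
qed

text \<open>Choosing predecessors from \<open>c\<close> backwards without end also repeats a state.
  Here determinism moves the repetition forward to \<open>c\<close>, which would then lie in
  \<open>P\<close>.\<close>

lemma reached_from_start:
  assumes "c \<in> Q - P"
  shows "\<exists>a\<in>P - Q. R\<^sup>*\<^sup>* a c"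
proof (rule ccontr)
  assume no: "\<not> ?thesis"
  define g where "g y = (SOME x. x \<in> P \<and> R x y)" for y
  have g: "g y \<in> P \<and> R (g y) y" if "y \<in> Q" for y
    using someI_ex[of "\<lambda>x. x \<in> P \<and> R x y"] surjective[OF that] unfolding g_def by blast
  define f where "f n = (g ^^ n) c" for n
  have f: "f n \<in> Q \<and> R\<^sup>*\<^sup>* (f n) c" for n
  proof (induction n)
    case (Suc n)
    then have "f (Suc n) \<in> P \<and> R (f (Suc n)) (f n)" using g by (simp add: f_def)
    then show ?case using no Suc by (meson DiffI converse_rtranclp_into_rtranclp)
  qed (use assms in \<open>simp add: f_def\<close>)
  have fS: "f (Suc n) \<in> P" "R (f (Suc n)) (f n)" for n
    using g f by (simp_all add: f_def)
  have in_fibre: "f (Suc n) \<in> {x \<in> P. invar x = invar c}" for n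
    using reachable[of "f (Suc n)" c] f[of "Suc n"] fS(1) by auto
  have "finite (range (\<lambda>n. f (Suc n)))"
    by (rule finite_subset[OF _ finite_fibre[of "invar c"]]) (use in_fibre in blast)
  then have "\<not> inj (\<lambda>n. f (Suc n))" using finite_imageD infinite_UNIV_nat by blast
  then obtain i j where "f (Suc i) = f (Suc j)" "i < j"
    unfolding inj_def by (metis linorder_neqE_nat)
  have "\<exists>j>0. f 0 = f j" if "f i = f j" "i < j" for i j
    using that
  proof (induction i arbitrary: j)
    case (Suc i)
    then obtain j' where j: "j = Suc j'" by (cases j) auto
    have "f i = f j'" using deterministic[OF fS(1) fS(2)] fS(2)[of j'] Suc.prems j by metis
    then show ?case using Suc.IH[of j'] Suc.prems j by simp
  qed auto
  then obtain j where "0 < j" "f 0 = f j" using \<open>f (Suc i) = f (Suc j)\<close> \<open>i < j\<close> by blast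
  then have "c \<in> P" using fS(1) unfolding f_def by (metis Suc_pred' funpow_0)
  then show False using assms by simp
qed

end

section \<open>The insertion process\<close>

lemma var_index_pos: "1 \<le> i \<Longrightarrow> 1 \<le> j \<Longrightarrow> 1 \<le> var_index (i, j) e"
  by (cases e; cases "snd e") auto

text \<open>The index fixes an entry up to color. On the diagonal the color is fixed too: in type D
  the red and the black value for one index differ by one, so only one is even.\<close>

lemma entry_eqI:
  assumes "var_index q e = var_index q e'"
    and "diagonal t q \<Longrightarrow> diagonal_entry t e \<and> diagonal_entry t e'"
    and "\<not> diagonal t q \<Longrightarrow> snd e = snd e'"
  shows "e = e'"
proof -
  obtain i j v c v' c' where "q = (i, j)" "e = (v, c)" "e' = (v', c')" by (metis surj_pair)
  then show ?thesis
    using assms by (cases t; cases c; cases c'; cases "diagonal t q") (auto simp: diagonal_iff; presburger)+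
qed

lemma target_lower:
  assumes m: "strict_partition m" and n: "strict_partition n" and S: "S \<in> tableaux t m"
    and T: "target t m S k q e" and dn: "diagram t n = insert q (diagram t m)"
  shows "S(q \<mapsto> e) \<in> tableaux t n"
proof (cases q)
  case (Pair i j)
  show ?thesis
    by (rule tableaux_lower[OF m n S dn])
      (use T Pair in \<open>auto simp: target.simps simp del: left_up_le.simps\<close>)
qed

lemma target_index: "target t m S k q e \<Longrightarrow> var_index q e = k"
  by (cases q) (auto simp: target.simps)

lemma target_corner: "target t m S k q e \<Longrightarrow> q \<notin> diagram t m \<Longrightarrow> corner t m q"
  by (cases q) (auto simp: target.simps)

text \<open>Putting the expelled entry back restores \<open>S\<close>, so this entry itself
  witnesses that the next input is admissible.\<close>

lemma target_inside:
  assumes m: "strict_partition m" and S: "S \<in> tableaux t m"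
    and T: "target t m S k q e" and q: "q \<in> diagram t m" and old: "S q = Some old"
  shows "admissible t m (S(q \<mapsto> e)) q (if snd old = Black \<or> t = TypeD \<and> diagonal TypeD q then Rightward else Downward)
    (var_index q old)"
proof -
  obtain i j where ij: "q = (i, j)" by force
  obtain v c where vc: "old = (v, c)" by force
  have "S(q \<mapsto> e) \<in> tableaux t m"
    by (rule target_lower[OF m m S T]) (use q in auto)
  moreover have "1 \<le> var_index q old" using q unfolding ij by (intro var_index_pos) (auto simp: in_diagram_iff)
  moreover have "fst (the ((S(q \<mapsto> e)) q)) \<le> v"
    using T q old vc by (simp add: ij target.simps val_def)
  moreover have "(S(q \<mapsto> e))(q \<mapsto> (v, c)) \<in> tableaux t m"
    using S old vc by (metis fun_upd_triv fun_upd_upd)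
  ultimately show ?thesis
    unfolding admissible_def using q vc by (cases c) auto
qed

lemma bump_step:
  assumes m: "strict_partition m" and A: "admissible t m S p d k"
  shows "\<exists>q e. target t m S k q e \<and> (\<forall>y. bump t (S, p, d, enat k) y \<longleftrightarrow> y = outcome t S q e) \<and>
    source t m S k p d \<and> lands t S k p d q \<and> entry_of t d k q = e"
proof -
  have S: "S \<in> tableaux t m" and k: "1 \<le> k" using A by (auto simp: admissible_def)
  then have s: "source t m S k p d" using A admissible_iff_source[OF m] by blast
  obtain q where l: "lands t S k p d q" using lands_exists[OF m S k s] by blast
  then show ?thesis using source_target[OF m S k s l] bump_iff[OF m S k s l] s by blast
qed

lemma target_bump:
  assumes m: "strict_partition m" and S: "S \<in> tableaux t m" and k: "1 \<le> k" and T: "target t m S k q e"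
  shows "\<exists>p d. admissible t m S p d k \<and> bump t (S, p, d, enat k) (outcome t S q e)"
proof -
  obtain p d where "source t m S k p d" "lands t S k p d q" "entry_of t d k q = e"
    using target_source[OF m S T] by blast
  then show ?thesis using bump_iff[OF m S k] admissible_iff_source[OF m S k] by metis
qed

section \<open>The bump as a partial bijection on states\<close>

definition admissible_states :: "ttype \<Rightarrow> nat list \<Rightarrow> state set" where
  "admissible_states t m = {(S, p, d, enat k) | S p d k. admissible t m S p d k}"

lemma admissible_statesI: "admissible t m S p d k \<Longrightarrow> (S, p, d, enat k) \<in> admissible_states t m"
  unfolding admissible_states_def by blast

definition stopped_states :: "ttype \<Rightarrow> nat list \<Rightarrow> state set" where
  "stopped_states t m = {(S, p, Stop, \<infinity>) | S p n. strict_partition n \<and> covers n m \<and>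
     S \<in> tableaux t n \<and> corner t m p \<and> diagram t n = insert p (diagram t m)}"

text \<open>The possible outputs of a bump. Requiring \<open>p\<close> in the diagram removes
  exactly the starts at \<open>(0, 0)\<close> from the admissible states.\<close>

definition later_states :: "ttype \<Rightarrow> nat list \<Rightarrow> state set" where
  "later_states t m = {(S, p, d, enat k) | S p d k. admissible t m S p d k \<and> p \<in> diagram t m} \<union> stopped_states t m"

definition start_states :: "ttype \<Rightarrow> nat list \<Rightarrow> state set" where
  "start_states t m = {start S k | S k. S \<in> tableaux t m \<and> 1 \<le> k}"

lemma admissible_outside:
  "p \<notin> diagram t m \<Longrightarrow> admissible t m S p d k \<longleftrightarrow> S \<in> tableaux t m \<and> 1 \<le> k \<and> p = (0, 0) \<and> d = Downward"
  unfolding admissible_def by blast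

lemma admissible_direction: "admissible t m S p d k \<Longrightarrow> d \<noteq> Stop"
  by (auto simp: admissible_def)

lemma admissible_minus_later: "admissible_states t m - later_states t m = start_states t m"
proof -
  have 0: "(0, 0) \<notin> diagram t m" by (simp add: in_diagram_iff)
  show ?thesis
    by (auto simp: admissible_states_def later_states_def start_states_def start_def stopped_states_def
        admissible_outside 0)
qed

lemma later_minus_admissible: "later_states t m - admissible_states t m = stopped_states t m"
  by (auto simp: admissible_states_def later_states_def stopped_states_def)

definition indices :: "tableau \<Rightarrow> nat set" where
  "indices S = (\<lambda>q. var_index q (the (S q))) ` dom S"

lemma indices_update: "indices (S(q \<mapsto> e)) = insert (var_index q e) (indices (S(q := None)))"
proof -
  have dom: "dom (S(q \<mapsto> e)) = insert q (dom S - {q})" by auto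
  have "indices (S(q \<mapsto> e)) = (\<lambda>p. var_index p (the ((S(q \<mapsto> e)) p))) ` insert q (dom S - {q})"
    by (simp only: indices_def dom)
  also have "\<dots> = insert (var_index q e) ((\<lambda>p. var_index p (the ((S(q \<mapsto> e)) p))) ` (dom S - {q}))"
    by (simp only: image_insert fun_upd_same option.sel)
  also have "(\<lambda>p. var_index p (the ((S(q \<mapsto> e)) p))) ` (dom S - {q}) = indices (S(q := None))"
    unfolding indices_def by (rule image_cong) auto
  finally show ?thesis .
qed

lemma indices_split: "S q = Some e \<Longrightarrow> indices S = insert (var_index q e) (indices (S(q := None)))"
  using indices_update[of S q e] by (simp add: fun_upd_idem)

lemma weight_update: "finite (dom S) \<Longrightarrow> weight (S(q \<mapsto> e)) = X (var_index q e) * weight (S(q := None))"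
  unfolding weight_def
  by (simp add: prod.insert_remove)

lemma weight_split: "finite (dom S) \<Longrightarrow> S q = Some e \<Longrightarrow> weight S = X (var_index q e) * weight (S(q := None))"
  using weight_update[of S q e] by (simp add: fun_upd_idem)

lemma finite_tableaux_indices: "finite {S \<in> tableaux t m. indices S \<subseteq> W}" if "finite W"
proof (rule finite_subset)
  let ?B = "{..Max (insert 0 W)} \<times> {Black, Red}"
  show "{S \<in> tableaux t m. indices S \<subseteq> W} \<subseteq> {S. dom S = diagram t m \<and> ran S \<subseteq> ?B}"
  proof (intro subsetI CollectI conjI)
    fix S e assume "S \<in> {S \<in> tableaux t m. indices S \<subseteq> W}" "e \<in> ran S"
    then have S: "indices S \<subseteq> W" "e \<in> ran S" by auto
    obtain v c where e: "e = (v, c)" by force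
    from S(2) obtain q where "S q = Some e" by (auto simp: ran_def)
    then have "var_index q e \<in> W" using S by (force simp: indices_def)
    then have "var_index q e \<le> Max (insert 0 W)" using that by simp
    moreover have "v \<le> var_index q e" by (cases q; cases c) (auto simp: e)
    ultimately show "e \<in> ?B" by (cases c) (auto simp: e)
  qed (auto dest: tableaux_dom)
  show "finite {S. dom S = diagram t m \<and> ran S \<subseteq> ?B}"
    by (rule finite_set_of_finite_maps) (auto simp: finite_diagram)
qed

text \<open>The weight is what the theorem speaks of. The set of indices is carried along for
  finiteness of the fibres: a value never exceeds the index of its entry. The index in transit
  counts in both components, and a stopped state has none.\<close>

fun state_inv :: "state \<Rightarrow> nat set \<times> mpoly" where
  "state_inv (S, p, d, k) =
     (indices S \<union> {j. enat j = k}, weight S * (case k of enat j \<Rightarrow> X j | \<infinity> \<Rightarrow> 1))"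

lemma finite_indices: "finite (dom S) \<Longrightarrow> finite (indices S)"
  by (simp add: indices_def)

lemma state_inv_outcome:
  assumes S: "finite (dom S)" and k: "var_index q e = k"
  shows "state_inv (outcome t S q e) = state_inv (S, p, d, enat k)"
proof (cases "S q")
  case None
  then have "S(q := None) = S" by auto
  then show ?thesis using None k S
    by (auto simp: outcome_def indices_update weight_update mult.commute)
next
  case (Some old)
  then show ?thesis using k S
    by (auto simp: outcome_def indices_update weight_update indices_split[of S q old, OF Some] weight_split[OF S, of q old, OF Some] ac_simps)
qed

lemma tableaux_remove:
  assumes m: "strict_partition m" and n: "strict_partition n" and S: "S \<in> tableaux t n"
    and dn: "diagram t n = insert p (diagram t m)" and p: "p \<notin> diagram t m"
  shows "S(p := None) \<in> tableaux t m"
proof (rule tableauxI[OF m])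
  show "dom (S(p := None)) = diagram t m" using tableaux_dom[OF S] dn p by auto
  have val: "val (S(p := None)) q = val S q" if "q \<in> diagram t m" for q
    using that p by (auto simp: val_def)
  show "val (S(p := None)) (a, b) \<le> val (S(p := None)) (i, j)"
    if "(a, b) \<in> diagram t m" "(i, j) \<in> diagram t m" "a \<le> i" "b \<le> j" for a b i j
  proof -
    have "val S (a, b) \<le> val S (i, j)"
      by (rule tableaux_mono[OF n S]) (use that dn in \<open>auto simp: in_diagram_iff[of a b]\<close>)
    then show ?thesis using that by (simp add: val)
  qed
  show "diagonal_entry t (the ((S(p := None)) q))" if "q \<in> diagram t m" "diagonal t q" for q
    using tableaux_diag[OF S, of q] that p dn by auto
qed

text \<open>The converse of \<open>target_lower\<close>: an entry of a tableau can be the result of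
  a bump on any tableau that differs only in that cell and has a larger or equal entry, or none,
  there.\<close>

lemma tableau_target:
  assumes n: "strict_partition n" and S: "S' \<in> tableaux t n"
    and dn: "diagram t n = insert q (diagram t m)" and e: "S' q = Some e" and k: "var_index q e = k"
    and off: "\<And>p. p \<noteq> q \<Longrightarrow> S p = S' p" and old: "q \<in> diagram t m \<Longrightarrow> fst e \<le> val S q"
  shows "target t m S k q e"
proof -
  obtain i j where q: "q = (i, j)" by force
  have mem: "(i, j) \<in> diagram t n" using dn q by auto
  then have ij: "1 \<le> i" "i + off t \<le> j" by (auto simp: in_diagram_iff)
  have ve: "val S' (i, j) = fst e" using e q by (simp add: val_def)
  have "(a, b) \<in> diagram t m \<and> val S (a, b) \<le> fst e"
    if "1 \<le> a" "a \<le> i" "a + off t \<le> b" "b \<le> j" "(a, b) \<noteq> (i, j)" for a b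
  proof -
    have "(a, b) \<in> diagram t n" by (rule diagram_down[OF n mem]) (use that in auto)
    moreover have "val S' (a, b) \<le> fst e"
      unfolding ve[symmetric] by (rule tableaux_mono[OF n S mem]) (use that in auto)
    ultimately show ?thesis using that dn q off[of "(a, b)"] by (auto simp: val_def)
  qed
  then have "left_up_le t m S (i, j) (fst e)" using ij by auto
  moreover have "diagonal_entry t e" if "diagonal t (i, j)"
    using tableaux_diag[OF S mem that] e q by simp
  ultimately show ?thesis using ij k old q by (auto simp: target.simps)
qed

lemma TypeD_diagonal_cong: "(t = TypeD \<and> diagonal TypeD q) = (t = TypeD \<and> diagonal t q)"
  by auto

lemma bump_partial_bijection:
  assumes m: "strict_partition m"
  shows "partial_bijection (bump t) (admissible_states t m) (later_states t m) state_inv"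
proof
  fix x y assume "x \<in> admissible_states t m"
  then obtain S p d k where x: "x = (S, p, d, enat k)" and A: "admissible t m S p d k"
    by (auto simp: admissible_states_def)
  have S: "S \<in> tableaux t m" and k: "1 \<le> k" using A by (auto simp: admissible_def)
  obtain q e where T: "target t m S k q e" and b: "\<And>y. bump t x y \<longleftrightarrow> y = outcome t S q e"
    using bump_step[OF m A] x by blast
  show "\<exists>y. bump t x y" using b by blast
  show "bump t x y \<Longrightarrow> bump t x y' \<Longrightarrow> y = y'" for y' by (simp add: b)
  have fin: "finite (dom S)" using tableaux_dom[OF S] finite_diagram by simp
  have "outcome t S q e \<in> later_states t m"
  proof (cases "q \<in> diagram t m")
    case True
    then obtain old where old: "S q = Some old" using tableaux_dom[OF S] by blast
    show ?thesis using target_inside[OF m S T True old] True old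
      by (cases q) (auto simp: outcome_def later_states_def)
  next
    case False
    then have "S q = None" using tableaux_dom[OF S] by blast
    moreover obtain n where n: "strict_partition n" "covers n m" "diagram t n = insert q (diagram t m)"
      using add_corner[OF m target_corner[OF T False]] by blast
    ultimately show ?thesis
      using target_lower[OF m n(1) S T n(3)] target_corner[OF T False]
      by (cases q) (auto simp: outcome_def later_states_def stopped_states_def)
  qed
  moreover have "state_inv (outcome t S q e) = state_inv x"
    unfolding x by (rule state_inv_outcome[OF fin target_index[OF T]])
  ultimately show "bump t x y \<Longrightarrow> y \<in> later_states t m \<and> state_inv y = state_inv x"
    by (simp add: b)
next
  fix y assume "y \<in> later_states t m"
  then consider S' q d' k' where "y = (S', q, d', enat k')" "admissible t m S' q d' k'" "q \<in> diagram t m"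
    | "y \<in> stopped_states t m"
    by (auto simp: later_states_def)
  then show "\<exists>x\<in>admissible_states t m. bump t x y"
  proof cases
    case 1
    have S': "S' \<in> tableaux t m" using 1 by (simp add: admissible_def)
    have "q \<noteq> (0, 0)" using 1(3) by (auto simp: in_diagram_iff)
    then obtain v c where vc: "var_index q (v, c) = k'" "fst (the (S' q)) \<le> v" "S'(q \<mapsto> (v, c)) \<in> tableaux t m"
      and d': "d' = Rightward \<and> (c = Black \<or> t = TypeD \<and> diagonal TypeD q) \<or>
              d' = Downward \<and> c = Red \<and> \<not> (t = TypeD \<and> diagonal TypeD q)"
      using 1(2) unfolding admissible_def by blast
    obtain e where e: "S' q = Some e" using 1(3) tableaux_dom[OF S'] by blast
    \<comment> \<open>The predecessor has the expelled entry \<open>(v, c)\<close> back in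
      \<open>q\<close>; the entry \<open>e\<close> found in \<open>q\<close> is then the one that
      the bump wrote.\<close>
    let ?S = "S'(q \<mapsto> (v, c))"
    have T: "target t m ?S (var_index q e) q e"
      by (rule tableau_target[OF m S']) (use 1(3) e vc in \<open>auto simp: val_def\<close>)
    have "1 \<le> var_index q e"
      using 1(3) by (cases q) (auto simp: in_diagram_iff simp del: One_nat_def intro!: var_index_pos)
    then obtain p d where "admissible t m ?S p d (var_index q e)"
        "bump t (?S, p, d, enat (var_index q e)) (outcome t ?S q e)"
      using target_bump[OF m vc(3) _ T] by blast
    moreover have "outcome t ?S q e = y"
      using d' e vc(1) unfolding 1(1) by (auto simp: outcome_def fun_upd_idem)
    ultimately show ?thesis
      by (intro bexI[of _ "(?S, p, d, enat (var_index q e))"]) (auto intro: admissible_statesI)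
  next
    case 2
    then obtain S' q n where y: "y = (S', q, Stop, \<infinity>)" and n: "strict_partition n" "covers n m"
      and S': "S' \<in> tableaux t n" and c: "corner t m q" and dn: "diagram t n = insert q (diagram t m)"
      by (auto simp: stopped_states_def)
    have q: "q \<notin> diagram t m" using c by (cases q) auto
    let ?S = "S'(q := None)"
    have S: "?S \<in> tableaux t m" by (rule tableaux_remove[OF m n(1) S' dn q])
    obtain e where e: "S' q = Some e" using dn tableaux_dom[OF S'] by blast
    have T: "target t m ?S (var_index q e) q e"
      by (rule tableau_target[OF n(1) S' dn]) (use e q in auto)
    have "1 \<le> var_index q e" using c by (cases q) (auto simp del: One_nat_def intro!: var_index_pos)
    then obtain p d where "admissible t m ?S p d (var_index q e)"
        "bump t (?S, p, d, enat (var_index q e)) (outcome t ?S q e)"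
      using target_bump[OF m S _ T] by blast
    moreover have "outcome t ?S q e = y"
      using e unfolding y by (auto simp: outcome_def fun_upd_idem)
    ultimately show ?thesis
      by (intro bexI[of _ "(?S, p, d, enat (var_index q e))"]) (auto intro: admissible_statesI)
  qed
next
  fix x x' y assume x: "x \<in> admissible_states t m" and x': "x' \<in> admissible_states t m" and y: "bump t x y" "bump t x' y"
  obtain S p d k where xe: "x = (S, p, d, enat k)" and A: "admissible t m S p d k"
    using x by (auto simp: admissible_states_def)
  obtain S0 p0 d0 k0 where xe': "x' = (S0, p0, d0, enat k0)" and A0: "admissible t m S0 p0 d0 k0"
    using x' by (auto simp: admissible_states_def)
  have S: "S \<in> tableaux t m" and k: "1 \<le> k" using A by (auto simp: admissible_def)
  have S0: "S0 \<in> tableaux t m" using A0 by (auto simp: admissible_def)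
  obtain q e where T: "target t m S k q e" and y1: "y = outcome t S q e"
    and s: "source t m S k p d" "lands t S k p d q" "entry_of t d k q = e"
    using bump_step[OF m A] y xe by blast
  obtain q0 e0 where T0: "target t m S0 k0 q0 e0" and y2: "y = outcome t S0 q0 e0"
    and s0: "source t m S0 k0 p0 d0" "lands t S0 k0 p0 d0 q0" "entry_of t d0 k0 q0 = e0"
    using bump_step[OF m A0] y xe' by blast
  have q: "q0 = q" using y1 y2 by (simp add: outcome_def)
  have upd: "S(q \<mapsto> e) = S0(q \<mapsto> e0)" using y1 y2 q by (simp add: outcome_def)
  then have e: "e0 = e" by (metis fun_upd_same option.sel)
  have kk: "k0 = k" using T T0 e q by (cases q) (auto simp: target.simps)
  \<comment> \<open>The output keeps the index of the expelled entry, and off the diagonal its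
    direction keeps the color. On the diagonal in type D the direction is always rightward, but
    there the index alone suffices.\<close>
  have "S q = S0 q"
  proof (cases "q \<in> diagram t m")
    case False
    then show ?thesis using tableaux_dom[OF S] tableaux_dom[OF S0] by (metis domIff)
  next
    case True
    then obtain u u0 where u: "S q = Some u" "S0 q = Some u0" using tableaux_dom[OF S] tableaux_dom[OF S0] by blast
    have "u = u0"
    proof (rule entry_eqI[where t = t])
      show "var_index q u = var_index q u0" using y1 y2 u q by (simp add: outcome_def)
      show "diagonal_entry t u \<and> diagonal_entry t u0" if "diagonal t q"
        using tableaux_diag[OF S True that] tableaux_diag[OF S0 True that] u by simp
      show "snd u = snd u0" if "\<not> diagonal t q"
        using y1 y2 u q that unfolding outcome_def TypeD_diagonal_cong
        by (cases "snd u"; cases "snd u0") (simp_all)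
    qed
    then show ?thesis using u by simp
  qed
  then have "S = S0" using upd by (metis fun_upd_triv fun_upd_upd)
  then show "x = x'" using source_unique[OF m S k s] s0 unfolding xe xe' q e kk by blast
next
  fix x y assume "x \<in> later_states t m" "x \<notin> admissible_states t m"
  then have "x \<in> stopped_states t m" using later_minus_admissible by blast
  then obtain S p where "x = (S, p, Stop, \<infinity>)" unfolding stopped_states_def by blast
  then show "\<not> bump t x y" by (auto elim: bump.cases)
next
  fix w :: "nat set \<times> mpoly"
  show "finite {x \<in> admissible_states t m. state_inv x = w}"
  proof (cases "finite (fst w)")
    case True
    let ?Z = "{S \<in> tableaux t m. indices S \<subseteq> fst w} \<times> insert (0, 0) (diagram t m) \<times> {Downward, Rightward, Stop} \<times> enat ` fst w"
    have "{x \<in> admissible_states t m. state_inv x = w} \<subseteq> ?Z"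
    proof
      fix x assume "x \<in> {x \<in> admissible_states t m. state_inv x = w}"
      then obtain S p d k where x: "x = (S, p, d, enat k)" "admissible t m S p d k" "state_inv x = w"
        by (auto simp: admissible_states_def)
      then show "x \<in> ?Z" by (cases d) (auto simp: admissible_def)
    qed
    moreover have "finite ?Z" using finite_tableaux_indices[OF True] finite_diagram True by simp
    ultimately show ?thesis by (rule finite_subset)
  next
    case False
    have "finite (fst (state_inv x))" if x: "x \<in> admissible_states t m" for x
    proof -
      obtain S p d k where "x = (S, p, d, enat k)" "S \<in> tableaux t m"
        using x by (auto simp: admissible_states_def admissible_def)
      then show ?thesis using finite_indices[of S] by (simp add: tableaux_dom finite_diagram)
    qed
    then have "{x \<in> admissible_states t m. state_inv x = w} = {}" using False by auto
    then show ?thesis by (simp only: finite.emptyI)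
  qed
qed

section \<open>From bumps to the insertion process\<close>

lemma insertion_iff:
  "insertion t S k S' \<longleftrightarrow> (\<exists>p. (bump t)\<^sup>*\<^sup>* (start S k) (S', p, Stop, \<infinity>))"
  unfolding insertion_def start_def
  by (metis Pair_inject direction.distinct(4) rtranclpD tranclp_into_rtranclp)

lemma start_in: "S \<in> tableaux t m \<Longrightarrow> 1 \<le> k \<Longrightarrow> start S k \<in> admissible_states t m - later_states t m"
  unfolding admissible_minus_later start_states_def by blast

lemma stopped_eq:
  assumes "(S, p, Stop, \<infinity>) \<in> stopped_states t m" "(S, p', Stop, \<infinity>) \<in> stopped_states t m"
  shows "p = p'"
proof -
  have "dom S - diagram t m = {q}" if "(S, q, Stop, \<infinity>) \<in> stopped_states t m" for q
  proof -
    from that obtain n where "S \<in> tableaux t n" "corner t m q" "diagram t n = insert q (diagram t m)"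
      unfolding stopped_states_def by blast
    moreover from this have "q \<notin> diagram t m" by (cases q) simp
    ultimately show ?thesis using tableaux_dom by blast
  qed
  from this[OF assms(1)] this[OF assms(2)] show ?thesis by simp
qed

lemma insertion_reaches:
  assumes m: "strict_partition m" and S: "S \<in> tableaux t m" and k: "1 \<le> k"
  shows "insertion t S k S' \<longleftrightarrow>
    (\<exists>p. (S', p, Stop, \<infinity>) \<in> stopped_states t m \<and> (bump t)\<^sup>*\<^sup>* (start S k) (S', p, Stop, \<infinity>))"
proof -
  interpret partial_bijection "bump t" "admissible_states t m" "later_states t m" state_inv
    by (rule bump_partial_bijection[OF m])
  have "(S', p, Stop, \<infinity>) \<in> stopped_states t m" if "(bump t)\<^sup>*\<^sup>* (start S k) (S', p, Stop, \<infinity>)" for p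
    using reachable[OF that] start_in[OF S k] admissible_direction
    by (auto simp: admissible_states_def later_states_def)
  then show ?thesis unfolding insertion_iff by blast
qed

lemma insertion_terminates:
  assumes m: "strict_partition m" and S: "S \<in> tableaux t m" and k: "1 \<le> k"
  shows "terminates (bump t) (start S k)"
  by (rule partial_bijection.terminates[OF bump_partial_bijection[OF m] start_in[OF S k]])

lemma insertion_exists:
  assumes m: "strict_partition m" and S: "S \<in> tableaux t m" and k: "1 \<le> k"
  shows "\<exists>S'. insertion t S k S'"
proof -
  interpret partial_bijection "bump t" "admissible_states t m" "later_states t m" state_inv
    by (rule bump_partial_bijection[OF m])
  obtain c where "c \<in> stopped_states t m" "(bump t)\<^sup>*\<^sup>* (start S k) c"
    using reaches_end[OF start_in[OF S k]] unfolding later_minus_admissible by blast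
  then show ?thesis unfolding insertion_iff stopped_states_def by blast
qed

lemma insertion_unique:
  assumes m: "strict_partition m" and S: "S \<in> tableaux t m" and k: "1 \<le> k"
    and "insertion t S k S1" "insertion t S k S2"
  shows "S1 = S2"
proof -
  interpret partial_bijection "bump t" "admissible_states t m" "later_states t m" state_inv
    by (rule bump_partial_bijection[OF m])
  obtain p1 p2 where
    "(S1, p1, Stop, \<infinity>) \<in> later_states t m - admissible_states t m" "(bump t)\<^sup>*\<^sup>* (start S k) (S1, p1, Stop, \<infinity>)"
    "(S2, p2, Stop, \<infinity>) \<in> later_states t m - admissible_states t m" "(bump t)\<^sup>*\<^sup>* (start S k) (S2, p2, Stop, \<infinity>)"
    using assms unfolding insertion_reaches[OF m S k] later_minus_admissible by blast
  then show ?thesis using end_unique[of "start S k"] start_in[OF S k] by blast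
qed

lemma insertion_result:
  assumes m: "strict_partition m" and S: "S \<in> tableaux t m" and k: "1 \<le> k" and i: "insertion t S k S'"
  shows "\<exists>p n. strict_partition n \<and> covers n m \<and> S' \<in> tableaux t n \<and> corner t m p \<and>
    diagram t n = insert p (diagram t m) \<and> weight S' = weight S * X k \<and> indices S' = insert k (indices S)"
proof -
  interpret partial_bijection "bump t" "admissible_states t m" "later_states t m" state_inv
    by (rule bump_partial_bijection[OF m])
  obtain p where p: "(S', p, Stop, \<infinity>) \<in> stopped_states t m" "(bump t)\<^sup>*\<^sup>* (start S k) (S', p, Stop, \<infinity>)"
    using i unfolding insertion_reaches[OF m S k] by blast
  have "state_inv (S', p, Stop, \<infinity>) = state_inv (start S k)"
    using reachable[OF p(2)] start_in[OF S k] by blast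
  then have "weight S' = weight S * X k" "indices S' = insert k (indices S)" by (auto simp: start_def)
  then show ?thesis using p(1) unfolding stopped_states_def by blast
qed

lemma insertion_injective:
  assumes m: "strict_partition m"
    and S: "S1 \<in> tableaux t m" "1 \<le> k1" "insertion t S1 k1 S'" "S2 \<in> tableaux t m" "1 \<le> k2" "insertion t S2 k2 S'"
  shows "S1 = S2 \<and> k1 = k2"
proof -
  interpret partial_bijection "bump t" "admissible_states t m" "later_states t m" state_inv
    by (rule bump_partial_bijection[OF m])
  obtain p1 where p1: "(S', p1, Stop, \<infinity>) \<in> stopped_states t m" "(bump t)\<^sup>*\<^sup>* (start S1 k1) (S', p1, Stop, \<infinity>)"
    using S(3) unfolding insertion_reaches[OF m S(1,2)] by blast
  obtain p2 where p2: "(S', p2, Stop, \<infinity>) \<in> stopped_states t m" "(bump t)\<^sup>*\<^sup>* (start S2 k2) (S', p2, Stop, \<infinity>)"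
    using S(6) unfolding insertion_reaches[OF m S(4,5)] by blast
  have "start S1 k1 = start S2 k2"
    using start_unique[OF start_in[OF S(1,2)] start_in[OF S(4,5)] p1(2)] p2(2) stopped_eq[OF p1(1) p2(1)] by blast
  then show ?thesis by (simp add: start_def)
qed

lemma insertion_surjective:
  assumes m: "strict_partition m" and n: "strict_partition n" "covers n m" and S': "S' \<in> tableaux t n"
  shows "\<exists>S k. S \<in> tableaux t m \<and> 1 \<le> k \<and> insertion t S k S'"
proof -
  interpret partial_bijection "bump t" "admissible_states t m" "later_states t m" state_inv
    by (rule bump_partial_bijection[OF m])
  obtain p where "corner t m p" "diagram t n = insert p (diagram t m)"
    using covers_corner[OF m n] by blast
  then have "(S', p, Stop, \<infinity>) \<in> stopped_states t m"
    using n S' unfolding stopped_states_def by blast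
  then obtain x where "x \<in> start_states t m" "(bump t)\<^sup>*\<^sup>* x (S', p, Stop, \<infinity>)"
    using reached_from_start unfolding admissible_minus_later later_minus_admissible by blast
  then show ?thesis unfolding start_states_def insertion_iff by blast
qed

lemma psi_eq:
  assumes "strict_partition m" "S \<in> tableaux t m" "1 \<le> k" "insertion t S k S'"
  shows "psi t (S, k) = S'"
  unfolding psi_def using assms insertion_unique by (auto intro!: the_equality)

lemma psi_bij:
  assumes m: "strict_partition m"
  shows "bij_betw (psi t) (tableaux t m \<times> {k. 1 \<le> k}) (\<Union>n\<in>{n. strict_partition n \<and> covers n m}. tableaux t n)"
proof -
  have ins: "insertion t S k (psi t (S, k))" if "S \<in> tableaux t m" "1 \<le> k" for S k
    using insertion_exists[OF m that] psi_eq[OF m that] by metis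
  show ?thesis
  proof (rule bij_betw_imageI)
    show "inj_on (psi t) (tableaux t m \<times> {k. 1 \<le> k})"
    proof (rule inj_onI)
      fix x y assume "x \<in> tableaux t m \<times> {k. 1 \<le> k}" "y \<in> tableaux t m \<times> {k. 1 \<le> k}" "psi t x = psi t y"
      moreover obtain S1 k1 S2 k2 where "x = (S1, k1)" "y = (S2, k2)" by (metis surj_pair)
      ultimately show "x = y"
        using ins[of S1 k1] ins[of S2 k2] insertion_injective[OF m, of S1 t k1 "psi t x" S2 k2] by simp
    qed
    show "psi t ` (tableaux t m \<times> {k. 1 \<le> k}) = (\<Union>n\<in>{n. strict_partition n \<and> covers n m}. tableaux t n)"
    proof (intro equalityI subsetI)
      fix S' assume "S' \<in> psi t ` (tableaux t m \<times> {k. 1 \<le> k})"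
      then obtain S k where "S \<in> tableaux t m" "1 \<le> k" "S' = psi t (S, k)" by auto
      then show "S' \<in> (\<Union>n\<in>{n. strict_partition n \<and> covers n m}. tableaux t n)"
        using insertion_result[OF m _ _ ins] by blast
    next
      fix S' assume "S' \<in> (\<Union>n\<in>{n. strict_partition n \<and> covers n m}. tableaux t n)"
      then obtain S k where "S \<in> tableaux t m" "1 \<le> k" "insertion t S k S'"
        using insertion_surjective[OF m] by blast
      moreover from this have "S' = psi t (S, k)" using psi_eq[OF m] by metis
      ultimately show "S' \<in> psi t ` (tableaux t m \<times> {k. 1 \<le> k})" by auto
    qed
  qed
qed

lemma bump_well_defined:
  assumes m: "strict_partition m" and A: "admissible t m S p d k"
  shows "(\<exists>!out. bump t (S, p, d, enat k) out) \<and>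
    (\<forall>S' p' d' k'. bump t (S, p, d, enat k) (S', p', d', k') \<longrightarrow> (\<exists>n. strict_partition n \<and> S' \<in> tableaux t n))"
proof -
  interpret partial_bijection "bump t" "admissible_states t m" "later_states t m" state_inv
    by (rule bump_partial_bijection[OF m])
  have P: "(S, p, d, enat k) \<in> admissible_states t m" by (rule admissible_statesI[OF A])
  have "\<exists>n. strict_partition n \<and> S' \<in> tableaux t n" if "bump t (S, p, d, enat k) (S', p', d', k')" for S' p' d' k'
    using into[OF P that] m by (auto simp: later_states_def stopped_states_def admissible_def)
  then show ?thesis using total[OF P] deterministic[OF P] by blast
qed

section \<open>Bounded tableaux\<close>

text \<open>An entry \<open>v\<close> in a cell obeys the bound given by \<open>l\<close> iff the cell stays in the diagram of \<open>l\<close>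
  when it is moved down the diagonal by \<open>v\<close> steps.\<close>
fun fits :: "ttype \<Rightarrow> nat list \<Rightarrow> cell \<Rightarrow> nat \<Rightarrow> bool" where
  "fits t l (i, j) v \<longleftrightarrow> (i + v, j + v) \<in> diagram t l"

lemma bounded_iff:
  "S \<in> bounded_tableaux t m l \<longleftrightarrow> S \<in> tableaux t m \<and> (\<forall>p\<in>diagram t m. fits t l p (val S p))"
proof (cases "S \<in> tableaux t m")
  case True
  have B: "fits t l (i, j) v \<longleftrightarrow> (case t of TypeB \<Rightarrow> j \<le> part l (i + v) + i - 1 | TypeD \<Rightarrow> j \<le> part l (i + v) + i)"
    if "(i, j) \<in> diagram t m" for i j v
    using that by (cases t) (auto simp: in_diagram_iff)
  have "S \<in> bounded_tableaux t m l \<longleftrightarrow> (\<forall>i j v c. S (i, j) = Some (v, c) \<longrightarrow> fits t l (i, j) v)"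
  proof -
    have "S \<in> bounded_tableaux t m l \<longleftrightarrow> (\<forall>i j v c. S (i, j) = Some (v, c) \<longrightarrow>
        (case t of TypeB \<Rightarrow> j \<le> part l (i + v) + i - 1 | TypeD \<Rightarrow> j \<le> part l (i + v) + i))"
      using True by (cases t) simp_all
    also have "\<dots> \<longleftrightarrow> (\<forall>i j v c. S (i, j) = Some (v, c) \<longrightarrow> fits t l (i, j) v)"
      using tableaux_dom[OF True] B by (intro iff_allI imp_cong refl) (metis domI)
    finally show ?thesis .
  qed
  also have "\<dots> \<longleftrightarrow> (\<forall>p\<in>dom S. fits t l p (val S p))"
    by (force simp: val_def dom_def)
  finally show ?thesis using True tableaux_dom[OF True] by simp
next
  case False
  then show ?thesis by (cases t) auto
qed

text \<open>After both cells are moved down the diagonal by their values, this is only the downward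
  closure of the diagram of \<open>l\<close>.\<close>

lemma fits_down:
  assumes l: "strict_partition l" and f: "fits t l (i, j) v"
    and le: "1 \<le> a + u" "a + off t \<le> b" "a + u \<le> i + v" "b + u \<le> j + v"
  shows "fits t l (a, b) u"
  using diagram_down[OF l f[unfolded fits.simps], of "a + u" "b + u"] le by simp

text \<open>The cell in which \<open>x\<^sub>k\<close> is written, moved down the diagonal, lies weakly below and to the right of the
  cell from which \<open>x\<^sub>k\<close> came, moved down the diagonal.\<close>
lemma carried_fits:
  assumes m: "strict_partition m" and l: "strict_partition l" and S: "S \<in> tableaux t m" and k: "1 \<le> k"
    and s: "source t m S k p d" and ld: "lands t S k p d q" and p: "p \<noteq> (0, 0)"
    and f: "fits t l q (fst (entry_of t d k q))"
  shows "fits t l p (fst (entry_of t d k p))"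
proof -
  obtain i j a b where e: "p = (i, j)" "q = (a, b)" by (metis surj_pair)
  have mem: "(i, j) \<in> diagram t m" "d = Rightward \<or> d = Downward \<and> \<not> diagonal t (i, j)"
    and w: "written t d k (i, j) (entry_of t d k (i, j))"
    using s p by (auto simp: e source.simps)
  have ij: "1 \<le> i" "i + off t \<le> j" using mem by (auto simp: in_diagram_iff)
  have wq: "written t d k (a, b) (entry_of t d k (a, b))" and ab: "1 \<le> a" "a + off t \<le> b"
    using source_target[OF m S k s ld] by (auto simp: e target.simps)
  note bp = written_bounds[OF w ij(2)] and bq = written_bounds[OF wq ab(2)]
  show ?thesis
  proof (cases "d = Rightward")
    case True
    have b: "b = j + 1" using ld by (simp add: e True lands.simps)
    note row = lands_Rightward_row[OF m S s[unfolded e True] ld[unfolded e True]]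
    have "fst (entry_of t d k (a, b)) + a = k"
    proof (cases "diagonal t (a, b)")
      case False
      then show ?thesis using written_Black(1) wq True by blast
    next
      \<comment> \<open>Only the move between consecutive type D diagonal cells is possible here,
        and it writes a black entry.\<close>
      case diag: True
      then have "\<not> a \<le> i" using ij b by (auto simp: diagonal_iff)
      then show ?thesis using row by (auto simp: entry_of.simps True)
    qed
    moreover have "a \<le> i \<or> a = i + 1 \<and> fst (entry_of t d k (i, j)) + i + 1 = k"
      using row True by auto
    ultimately show ?thesis
      using ij bp b unfolding e by (intro fits_down[OF l f[unfolded e]]) linarith+
  next
    case False
    then have d: "d = Downward" "\<not> diagonal t (i, j)" using mem by auto
    have a: "a = i + 1" using ld by (simp add: e d lands.simps)
    have "b \<le> j" by (rule lands_Downward_col[OF m S s[unfolded e d] ld[unfolded e d] ij(1)])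
    moreover have "fst (entry_of t d k (i, j)) + j = k" using written_Red(1) w d by blast
    ultimately show ?thesis
      using ij ab bq a unfolding e by (intro fits_down[OF l f[unfolded e]]) linarith+
  qed
qed

text \<open>The entry in transit is tested in the cell that expelled it, as if it were still there.
  At the start there is no such cell and nothing to test.\<close>

definition carries_bounded :: "ttype \<Rightarrow> nat list \<Rightarrow> nat list \<Rightarrow> tableau \<Rightarrow> cell \<Rightarrow> direction \<Rightarrow> nat \<Rightarrow> bool" where
  "carries_bounded t m l S p d k \<longleftrightarrow>
     S \<in> bounded_tableaux t m l \<and> (p = (0, 0) \<or> fits t l p (fst (entry_of t d k p)))"

text \<open>Both sides are equivalent to \<open>S\<close> being bounded. After the bump the entry in
  transit is the old entry of \<open>q\<close>, and whatever fits in \<open>q\<close> also fits if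
  made smaller. Before the bump, the old entry makes the new one fit in \<open>q\<close>, and
  \<open>carried_fits\<close> takes this back to the source.\<close>

lemma carries_bounded_step:
  assumes m: "strict_partition m" and l: "strict_partition l" and A: "admissible t m S p d k"
    and b: "bump t (S, p, d, enat k) (S1, p1, d1, enat k1)"
  shows "carries_bounded t m l S1 p1 d1 k1 \<longleftrightarrow> carries_bounded t m l S p d k"
proof -
  have S: "S \<in> tableaux t m" and k: "1 \<le> k" using A by (auto simp: admissible_def)
  obtain q e where T: "target t m S k q e" and o: "(S1, p1, d1, enat k1) = outcome t S q e"
    and s: "source t m S k p d" "lands t S k p d q" "entry_of t d k q = e"
    using bump_step[OF m A] b by blast
  obtain old where old: "S q = Some old" using o by (cases "S q") (auto simp: outcome_def)
  then have q: "q \<in> diagram t m" using tableaux_dom[OF S] by blast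
  then have q0: "q \<noteq> (0, 0)" by (auto simp: in_diagram_iff)
  have S1: "S1 = S(q \<mapsto> e)" "p1 = q" "k1 = var_index q old"
    and d1: "d1 = (if snd old = Black \<or> t = TypeD \<and> diagonal TypeD q then Rightward else Downward)"
    using o old by (auto simp: outcome_def)
  have "written t d1 k1 q old"
    using d1 tableaux_diag[OF S q] old S1 unfolding TypeD_diagonal_cong
    by (cases "snd old") (auto simp: written_def)
  then have carried: "fst (entry_of t d1 k1 p1) = val S q"
    using written_imp_entry_of S1 old by (metis val_def option.sel)
  have S1_tab: "S1 \<in> tableaux t m" unfolding S1 by (rule target_lower[OF m m S T]) (use q in auto)
  have le: "fst e \<le> val S q" using T q by (cases q) (auto simp: target.simps)
  have e_fits: "fits t l q (fst e)" if "fits t l q (val S q)"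
    using that le q by (cases q) (auto simp: in_diagram_iff[of _ _ t m] simp del: fits.simps intro: fits_down[OF l])
  have vals: "val S1 q = fst e" "\<And>r. r \<noteq> q \<Longrightarrow> val S1 r = val S r" by (simp_all add: S1)
  have "carries_bounded t m l S1 p1 d1 k1 \<longleftrightarrow> S \<in> bounded_tableaux t m l"
    unfolding carries_bounded_def carried bounded_iff using S S1_tab S1(2) q0 q e_fits vals by metis
  moreover have "carries_bounded t m l S p d k \<longleftrightarrow> S \<in> bounded_tableaux t m l"
    unfolding carries_bounded_def
    using carried_fits[OF m l S k s(1,2)] e_fits q unfolding s(3) bounded_iff by blast
  ultimately show ?thesis by simp
qed

text \<open>Since boundedness is transported along all earlier bumps, only the bump that fills the
  new cell remains to be studied.\<close>

lemma insertion_last_bump: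
  assumes m: "strict_partition m" and l: "strict_partition l" and S: "S \<in> tableaux t m" and k: "1 \<le> k"
    and i: "insertion t S k S'"
  shows "\<exists>S1 p d k1 q e. S1 \<in> tableaux t m \<and> 1 \<le> k1 \<and> target t m S1 k1 q e \<and> q \<notin> diagram t m \<and> S' = S1(q \<mapsto> e) \<and>
    source t m S1 k1 p d \<and> lands t S1 k1 p d q \<and> entry_of t d k1 q = e \<and>
    (S \<in> bounded_tableaux t m l \<longleftrightarrow> carries_bounded t m l S1 p d k1)"
proof -
  interpret partial_bijection "bump t" "admissible_states t m" "later_states t m" state_inv
    by (rule bump_partial_bijection[OF m])
  have start: "start S k \<in> admissible_states t m \<union> later_states t m" using start_in[OF S k] by blast
  obtain r where r: "(bump t)\<^sup>+\<^sup>+ (start S k) (S', r, Stop, \<infinity>)" using i by (auto simp: insertion_def)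
  obtain x where x: "(bump t)\<^sup>*\<^sup>* (start S k) x" "bump t x (S', r, Stop, \<infinity>)"
    using tranclpD[OF r] by (metis r rtranclp.rtrancl_refl tranclp.cases tranclp_into_rtranclp)
  have inv: "\<forall>S1 p d k1. x = (S1, p, d, enat k1) \<longrightarrow> x \<in> admissible_states t m \<longrightarrow>
      (carries_bounded t m l S1 p d k1 \<longleftrightarrow> S \<in> bounded_tableaux t m l)"
    using x(1)
  proof (induction rule: rtranclp_induct)
    case base
    then show ?case by (simp add: start_def carries_bounded_def)
  next
    case (step y z)
    have y: "y \<in> admissible_states t m"
      using step_source[OF _ step(2)] reachable[OF step(1) start] by blast
    then obtain S0 p0 d0 k0 where ye: "y = (S0, p0, d0, enat k0)" and A: "admissible t m S0 p0 d0 k0"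
      by (auto simp: admissible_states_def)
    then show ?case using step.IH y carries_bounded_step[OF m l A] step(2) by metis
  qed
  have xP: "x \<in> admissible_states t m"
    using step_source[OF _ x(2)] reachable[OF x(1) start] by blast
  then obtain S1 p d k1 where xe: "x = (S1, p, d, enat k1)" and A: "admissible t m S1 p d k1"
    by (auto simp: admissible_states_def)
  have S1: "S1 \<in> tableaux t m" and k1: "1 \<le> k1" using A by (auto simp: admissible_def)
  obtain q e where T: "target t m S1 k1 q e" and o: "(S', r, Stop, \<infinity>) = outcome t S1 q e"
    and s: "source t m S1 k1 p d" "lands t S1 k1 p d q" "entry_of t d k1 q = e"
    using bump_step[OF m A] x(2) xe by blast
  have "S1 q = None" using o by (cases "S1 q") (auto simp: outcome_def)
  then have "q \<notin> diagram t m" using tableaux_dom[OF S1] by (metis domIff)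
  moreover have "S' = S1(q \<mapsto> e)" using o by (simp add: outcome_def)
  ultimately show ?thesis using S1 k1 T s inv xe xP by blast
qed

text \<open>In type D the index \<open>length l + 1\<close> is matched with the empty row \<open>length m + 1\<close>.\<close>
definition row_match :: "ttype \<Rightarrow> nat list \<Rightarrow> nat list \<Rightarrow> nat \<Rightarrow> nat \<Rightarrow> bool" where
  "row_match t m l k r \<longleftrightarrow> 1 \<le> r \<and> part l k = part m r \<and>
     (k \<le> length l \<or> t = TypeD \<and> k = length l + 1 \<and> r = length m + 1 \<and> even (k + r))"

text \<open>The equation of column differences, written without subtraction. In type D both
  \<open>k\<close> and \<open>s\<close> number columns of type D diagrams, one to the right of the
  type B columns whose lengths occur.\<close>

definition col_match :: "ttype \<Rightarrow> nat list \<Rightarrow> nat list \<Rightarrow> nat \<Rightarrow> nat \<Rightarrow> bool" where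
  "col_match t m l k s \<longleftrightarrow> length l + 1 + off t \<le> k \<and> 1 + off t \<le> s \<and>
     col_length l (k - off t) + s = col_length m (s - off t) + k"

lemma notin_index_set_iff:
  assumes "1 \<le> k"
  shows "k \<notin> index_set t m l \<longleftrightarrow> (\<exists>r. row_match t m l k r) \<or> (\<exists>s. col_match t m l k s)"
proof (cases t)
  case TypeB
  have "int (col_length l k) - int k = int (col_length m i) - int i \<longleftrightarrow>
      col_length l k + i = col_length m i + k" for i by linarith
  then show ?thesis using assms
    by (cases "k \<le> length l") (auto simp: TypeB row_match_def col_match_def)
next
  case TypeD
  consider "k \<le> length l" | "k = length l + 1" | "length l + 2 \<le> k" by linarith
  then show ?thesis
  proof cases
    case 1
    then show ?thesis using assms by (auto simp: TypeD row_match_def col_match_def)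
  next
    case 2
    have "odd (int (length l) - int (length m)) \<longleftrightarrow> odd (length l + length m)" by simp
    moreover have "part l (length l + 1) = part m (length m + 1)" by (simp add: part_def)
    ultimately show ?thesis using 2 by (auto simp: TypeD row_match_def col_match_def)
  next
    case 3
    have eq: "int (col_length l (k - 1)) - (int k - 1) = int (col_length m i) - int i \<longleftrightarrow>
        col_length l (k - 1) + (i + 1) = col_length m (i + 1 - 1) + k" for i using 3 by auto
    have "k \<notin> index_set t m l \<longleftrightarrow> (\<exists>i\<ge>1. col_length l (k - 1) + (i + 1) = col_length m (i + 1 - 1) + k)"
      using 3 by (auto simp: TypeD eq[symmetric])
    also have "\<dots> \<longleftrightarrow> (\<exists>s\<ge>2. col_length l (k - 1) + s = col_length m (s - 1) + k)"
    proof
      assume "\<exists>s\<ge>2. col_length l (k - 1) + s = col_length m (s - 1) + k"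
      then obtain s where "s \<ge> 2" "col_length l (k - 1) + s = col_length m (s - 1) + k" by blast
      then show "\<exists>i\<ge>1. col_length l (k - 1) + (i + 1) = col_length m (i + 1 - 1) + k"
        by (intro exI[of _ "s - 1"]) auto
    next
      assume "\<exists>i\<ge>1. col_length l (k - 1) + (i + 1) = col_length m (i + 1 - 1) + k"
      then obtain i where "1 \<le> i" "col_length l (k - 1) + (i + 1) = col_length m (i + 1 - 1) + k" by blast
      then show "\<exists>s\<ge>2. col_length l (k - 1) + s = col_length m (s - 1) + k"
        by (intro exI[of _ "i + 1"]) auto
    qed
    finally show ?thesis using 3 by (auto simp: TypeD row_match_def col_match_def numeral_2_eq_2)
  qed
qed

text \<open>The only corner in which a rejected round can leave \<open>x\<^sub>k\<close>. The matched row \<open>r\<close> need not end in a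
  corner; the corner is then the one at the top of the block of rows that end in the same column, and
  likewise for columns.\<close>
fun home :: "ttype \<Rightarrow> nat list \<Rightarrow> nat list \<Rightarrow> nat \<Rightarrow> cell \<Rightarrow> entry \<Rightarrow> bool" where
  "home t m l k (i, j) e \<longleftrightarrow>
     (\<exists>r\<ge>i. row_match t m l k r \<and> j = part m r + r + off t \<and> (diagonal t (i, j) \<or> snd e = Black)) \<or>
     (\<exists>s\<ge>j. col_match t m l k s \<and> i = col_length m (s - off t) + 1 \<and> (diagonal t (i, j) \<or> snd e = Red))"

section \<open>The last bump and the home cell of its index\<close>

lemma col_length_le: "col_length l c \<le> length l" "col_length l c \<le> c"
proof -
  have "{r. (r, c) \<in> diagram TypeB l} \<subseteq> {1..length l}" "{r. (r, c) \<in> diagram TypeB l} \<subseteq> {1..c}"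
    by (auto simp: diagram.simps)
  from card_mono[OF _ this(1)] card_mono[OF _ this(2)]
  show "col_length l c \<le> length l" "col_length l c \<le> c" by (simp_all add: col_length_def)
qed

lemma in_diagram_length: "(i, j) \<in> diagram t m \<Longrightarrow> i \<le> length m"
  by (cases t) (auto simp: diagram.simps)

lemma diagonal_in_diagram:
  "strict_partition m \<Longrightarrow> (i, i + off t) \<in> diagram t m \<longleftrightarrow> 1 \<le> i \<and> i \<le> length m"
  by (auto simp: in_diagram_iff part_pos_iff)

text \<open>For a black carried entry both fitting conditions concern row \<open>k\<close> of
  \<open>l\<close>: the new cell requires more than \<open>j + 1 - a - off t\<close> cells in it,
  the source at least \<open>j + 1 - i - off t\<close>. If the first fails, the second holds iff
  some row of \<open>m\<close> from \<open>a\<close> to \<open>i\<close> has exactly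
  \<open>part l k\<close> cells. In type D the empty rows and the red diagonal entry need separate
  treatment.\<close>

lemma home_if_lands_right:
  assumes m: "strict_partition m" and l: "strict_partition l" and S: "S \<in> bounded_tableaux t m l"
    and s: "source t m S k (i, j) Rightward" and ld: "lands t S k (i, j) Rightward (a, b)"
    and out: "(a, b) \<notin> diagram t m" and k: "1 \<le> k"
    and e_def: "e = entry_of t Rightward k (a, b)" and bad: "\<not> fits t l (a, b) (fst e)"
  shows "fits t l (i, j) (fst (entry_of t Rightward k (i, j))) \<longleftrightarrow> home t m l k (a, b) e"
proof -
  have St: "S \<in> tableaux t m" and Sl: "\<And>p. p \<in> diagram t m \<Longrightarrow> fits t l p (val S p)"
    using S by (auto simp: bounded_iff)
  define c where "c = fst (entry_of t Rightward k (i, j))"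
  have mem: "(i, j) \<in> diagram t m" and w: "written t Rightward k (i, j) (entry_of t Rightward k (i, j))"
    and right: "(i, j + 1) \<in> diagram t m \<Longrightarrow> c \<le> val S (i, j + 1)"
    and below: "(i + 1, j) \<in> diagram t m \<Longrightarrow> c \<le> val S (i + 1, j)"
    using s by (auto simp: source.simps c_def in_diagram_iff)
  have ij: "1 \<le> i" "i + off t \<le> j" using mem by (auto simp: in_diagram_iff)
  have T: "target t m S k (a, b) e" and wq: "written t Rightward k (a, b) e"
    using source_target[OF m St k s ld] by (auto simp: e_def)
  have ab: "1 \<le> a" "a + off t \<le> b" "b = j + 1" using T ld by (auto simp: target.simps lands.simps)
  note row = lands_Rightward_row[OF m St s ld]
  have e: "fst e + a = k" "snd e = Black"
  proof -
    have "fst e + a = k \<and> snd e = Black"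
    proof (cases "diagonal t (a, b)")
      case False
      then show ?thesis using written_Black wq by blast
    next
      case diag: True
      then have "\<not> a \<le> i" using ij ab by (auto simp: diagonal_iff)
      then show ?thesis using row by (auto simp: entry_of.simps e_def)
    qed
    then show "fst e + a = k" "snd e = Black" by auto
  qed
  have bad': "part l k + a + off t \<le> j + 1"
  proof (rule ccontr)
    assume *: "\<not> ?thesis"
    have ak: "a + fst e = k" using e by simp
    have "k + off t \<le> b + fst e" "b + fst e < part l k + k + off t" using * e ab by linarith+
    then show False using bad k by (simp add: in_diagram_iff ak)
  qed
  \<comment> \<open>These rows contain the cell above or at \<open>(i, j)\<close> in column
    \<open>j\<close>, but nothing in column \<open>j + 1\<close>, since \<open>(a, j + 1)\<close> is
    already outside.\<close>
  have row_end: "part m r + r + off t = j + 1" if "a \<le> r" "r \<le> i" for r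
  proof -
    have "(r, j) \<in> diagram t m" by (rule diagram_down[OF m mem]) (use that ab ij in auto)
    moreover have "(r, j + 1) \<notin> diagram t m"
      using diagram_down[OF m, of r "j + 1" t a b] out that ab by auto
    ultimately show ?thesis using that ab by (auto simp: in_diagram_iff)
  qed
  have home_if: "home t m l k (a, b) e" if f: "j + 1 \<le> part l k + i + off t" and "part l k > 0"
  proof -
    \<comment> \<open>The row in which a part of size \<open>part l k\<close> ends in column
      \<open>j\<close>.\<close>
    define r where "r = j + 1 - off t - part l k"
    have r: "a \<le> r" "r \<le> i" using bad' f by (auto simp: r_def)
    then have "part m r + r + off t = j + 1" by (rule row_end)
    moreover from this have "part l k = part m r" using bad' unfolding r_def by linarith
    ultimately have "row_match t m l k r \<and> b = part m r + r + off t"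
      using that(2) r ab part_pos_iff[OF l, of k] by (auto simp: row_match_def)
    then show ?thesis using r e(2) by auto
  qed
  have special: "home t m l k (a, b) e"
    if "t = TypeD" "k = length l + 1" "length m + 1 = r" "even (k + r)" "a \<le> r" "b = r + 1" for r
  proof -
    have "row_match t m l k r" using that ab by (auto simp: row_match_def part_def)
    moreover have "part m r = 0" using that by (auto simp: part_def)
    ultimately show ?thesis using that e(2) by auto
  qed
  consider (black) "c + i = k" "a \<le> i"
    | (red) "t = TypeD" "j = i + 1" "c + i + 1 = k" "even c"
    using row entry_of_Rightward[OF w] unfolding c_def by fastforce
  then show ?thesis unfolding c_def[symmetric]
  proof cases
    case black
    have fit: "fits t l (i, j) c \<longleftrightarrow> j + 1 \<le> part l k + i + off t"
    proof -
      have ic: "i + c = k" using black by simp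
      have "fits t l (i, j) c \<longleftrightarrow> k + off t \<le> j + c \<and> j + c < part l k + (k + off t)"
        using k by (simp add: in_diagram_iff ic add.assoc)
      also have "\<dots> \<longleftrightarrow> j + 1 \<le> part l k + i + off t"
        using black(1) ij by arith
      finally show ?thesis .
    qed
    have nd: "\<not> diagonal t (a, b)" using black ij ab by (auto simp: diagonal_iff)
    have "part l k > 0" if "j + 1 \<le> part l k + i + off t" using that ij by linarith
    moreover have "j + 1 \<le> part l k + i + off t" if h: "home t m l k (a, b) e"
    proof -
      obtain r where r: "a \<le> r" "row_match t m l k r" "b = part m r + r + off t"
        using h nd e(2) by auto
      show ?thesis
      proof (cases "r \<le> i")
        case True
        then show ?thesis using r ab by (auto simp: row_match_def)
      next
        case ri: False
        \<comment> \<open>A matching row below the source cannot occur: an entry of column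
          \<open>j\<close> further down is at least \<open>c\<close>, so its index exceeds
          \<open>k\<close>, but the rows of \<open>l\<close> after row \<open>k\<close> are too
          short for it.\<close>
        have later: False if r': "i < r'" "(r', j) \<in> diagram t m" and L: "\<And>x. k < x \<Longrightarrow> part l x + r' + off t \<le> j" for r'
        proof -
          have "(i + 1, j) \<in> diagram t m"
            by (rule diagram_down[OF m r'(2)]) (use r' in \<open>auto simp: in_diagram_iff\<close>)
          then have "c \<le> val S (i + 1, j)" by (rule below)
          also have "\<dots> \<le> val S (r', j)"
            by (rule tableaux_mono[OF m St r'(2)]) (use r' in \<open>auto simp: in_diagram_iff\<close>)
          finally have "k < r' + val S (r', j)" using black r' by linarith
          then show False using L[of "r' + val S (r', j)"] Sl[OF r'(2)] by (auto simp: in_diagram_iff)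
        qed
        consider "k \<le> length l" | "t = TypeD" "k = length l + 1" "r = length m + 1" "even (k + r)"
          using r by (auto simp: row_match_def)
        then show ?thesis
        proof cases
          case 1
          then have pos: "0 < part l k" using k by (simp add: part_pos_iff[OF l])
          have rj: "(r, j) \<in> diagram t m" using r pos ab by (auto simp: in_diagram_iff row_match_def)
          have "part l x + r + off t \<le> j" if "k < x" for x
            using part_strict[OF l k that pos] r ab by (auto simp: row_match_def)
          then show ?thesis using later[of r] rj ri by auto
        next
          case 2
          have j: "j = length m + 1" using 2 r ab by (auto simp: row_match_def part_def)
          show ?thesis
          proof (cases "i = length m")
            case True
            then have "diagonal t (i, j)" using j 2 by (simp add: diagonal_iff)
            \<comment> \<open>The source is on the diagonal with a black entry, so
              \<open>k - i\<close> is even, whereas a match with row \<open>length m + 1\<close>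
              requires \<open>k - i\<close> to be odd.\<close>
            then have "even c" using w 2 by (cases "entry_of t Rightward k (i, j)") (auto simp: written_def c_def)
            moreover have "k + r = c + 2 * i + 1" using 2 True black(1) by simp
            ultimately have "odd (k + r)" by simp
            then show ?thesis using 2(4) by simp
          next
            case False
            then have i: "i < length m" using in_diagram_length[OF mem] by simp
            have mj: "(length m, j) \<in> diagram t m"
              using diagonal_in_diagram[OF m, of "length m" t] 2 j i by auto
            have "part l x + length m + off t \<le> j" if "k < x" for x
              using that 2 j by (auto simp: part_def)
            then show ?thesis using later[OF i mj] by auto
          qed
        qed
      qed
    qed
    ultimately show "fits t l (i, j) c \<longleftrightarrow> home t m l k (a, b) e" using fit home_if by blast
  next
    case red
    \<comment> \<open>Moved down by \<open>c\<close>, the diagonal source becomes the diagonal cell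
      of row \<open>k - 1\<close>, which lies in the diagram of \<open>l\<close> iff that row is
      nonempty.\<close>
    have fit: "fits t l (i, j) c \<longleftrightarrow> k \<le> length l + 1"
    proof -
      have "fits t l (i, j) c \<longleftrightarrow> 0 < part l (k - 1)" using red ij by (auto simp: in_diagram_iff add.commute[of c])
      then show ?thesis using red ij part_pos_iff[OF l, of "k - 1"] by auto
    qed
    have row_case: "k \<le> length l + 1" if "row_match t m l k r" for r
      using that by (auto simp: row_match_def)
    show "fits t l (i, j) c \<longleftrightarrow> home t m l k (a, b) e"
    proof (cases "a \<le> i")
      case True
      then have nd: "\<not> diagonal t (a, b)" using ij ab by (auto simp: diagonal_iff)
      have pi: "part m i = 1" using row_end[of i] True red by auto
      have im: "i = length m"
      proof (rule antisym)
        show "i \<le> length m" using in_diagram_length[OF mem] .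
        show "length m \<le> i"
          using part_strict[OF m ij(1), of "length m"] pi part_pos_iff[OF m, of "length m"] by (cases "i < length m") auto
      qed
      have "home t m l k (a, b) e" if "k \<le> length l + 1"
      proof (cases "k \<le> length l")
        case kl: True
        then have "0 < part l k" using k by (simp add: part_pos_iff[OF l])
        then show ?thesis using home_if red by auto
      next
        case False
        then show ?thesis using special[of "i + 1"] that im red ab True by auto
      qed
      moreover have "k \<le> length l + 1" if "home t m l k (a, b) e"
        using that nd e(2) row_case by auto
      ultimately show ?thesis using fit by blast
    next
      case False
      then have a: "a = i + 1" "b = a + 1" using row red ab by auto
      have im: "i = length m"
      proof (rule antisym)
        show "i \<le> length m" using in_diagram_length[OF mem] .
        show "length m \<le> i" using out a red diagonal_in_diagram[OF m, of a t] by auto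
      qed
      have kl: "length l < k"
        using bad' red a part_pos_iff[OF l, of k] k by auto
      have "home t m l k (a, b) e" if "k \<le> length l + 1"
        using special[of "i + 1"] that im red a kl by auto
      \<comment> \<open>Here both sides of the equivalence hold: the entry above the new cell is at
        least \<open>c\<close> and fits, which bounds \<open>k\<close>.\<close>
      moreover have "k \<le> length l + 1"
      proof -
        have mem': "(i, b) \<in> diagram t m" using ld a ij tableaux_dom[OF St] by (auto simp: lands.simps)
        then have "c \<le> val S (i, b)" using right ab by auto
        moreover have "i + val S (i, b) \<le> length l" using Sl[OF mem'] in_diagram_length by auto
        ultimately show ?thesis using red by linarith
      qed
      ultimately show ?thesis using fit by blast
    qed
  qed
qed

lemma outside_down:
  assumes "strict_partition m" "(a, b) \<notin> diagram t m" "1 \<le> a" "a + off t \<le> b" "b \<le> s"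
  shows "(a, s) \<notin> diagram t m"
  using diagram_down[OF assms(1), of a s t a b] assms by auto

lemma fits_iff_col_length:
  assumes "strict_partition l" "1 \<le> a + v" "a + off t \<le> b" "b + v = k"
  shows "fits t l (a, b) v \<longleftrightarrow> a + v \<le> col_length l (k - off t)"
  using assms by (auto simp: diagram_iff_col_length[OF assms(1)])

text \<open>A nonempty row contains its diagonal cell, so a column that meets the diagonal in a
  nonempty row is complete up to the diagonal.\<close>

lemma full_column:
  assumes "strict_partition l" "k \<le> length l + off t"
  shows "k - off t \<le> col_length l (k - off t)"
proof (cases "k \<le> off t")
  case False
  then have "(k - off t, k) \<in> diagram t l"
    using diagonal_in_diagram[OF assms(1), of "k - off t" t] assms(2) by auto
  then show ?thesis by (simp add: diagram_iff_col_length[OF assms(1)])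
qed simp

text \<open>The crossing argument for columns: off the type D diagonal, both fitting conditions
  compare with the length of column \<open>k\<close> of \<open>l\<close>, while the columns of
  \<open>m\<close> from \<open>b\<close> to \<open>j\<close> all have length
  \<open>i\<close>.\<close>

lemma home_if_lands_down:
  assumes m: "strict_partition m" and l: "strict_partition l" and S: "S \<in> bounded_tableaux t m l"
    and s: "source t m S k (i, j) Downward" and ld: "lands t S k (i, j) Downward (a, b)"
    and out: "(a, b) \<notin> diagram t m" and k: "1 \<le> k"
    and e_def: "e = entry_of t Downward k (a, b)" and bad: "\<not> fits t l (a, b) (fst e)"
  shows "(i, j) = (0, 0) \<or> fits t l (i, j) (fst (entry_of t Downward k (i, j))) \<longleftrightarrow> home t m l k (a, b) e"
proof -
  have St: "S \<in> tableaux t m" and Sl: "\<And>p. p \<in> diagram t m \<Longrightarrow> fits t l p (val S p)"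
    using S by (auto simp: bounded_iff)
  define c where "c = fst (entry_of t Downward k (i, j))"
  define C where "C = col_length l (k - off t)"
  have T: "target t m S k (a, b) e" and wq: "written t Downward k (a, b) e"
    using source_target[OF m St k s ld] by (auto simp: e_def)
  have ab: "1 \<le> a" "a + off t \<le> b" "a = i + 1" using T ld by (auto simp: target.simps lands.simps)
  note bq = written_bounds[OF wq ab(2)]
  have start: "(i, j) = (0, 0)" if "i = 0" using s that by (auto simp: source.simps in_diagram_iff)
  have mem: "(i, j) \<in> diagram t m" "c + j = k" "b \<le> j" "i + off t < j"
    and right: "(i, j + 1) \<in> diagram t m \<Longrightarrow> c \<le> val S (i, j + 1)" if i: "1 \<le> i"
  proof -
    have st: "(i, j) \<in> diagram t m" "written t Downward k (i, j) (entry_of t Downward k (i, j))" "\<not> diagonal t (i, j)"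
      "(i, j + 1) \<in> diagram t m \<Longrightarrow> c \<le> val S (i, j + 1)"
      using s i unfolding c_def by (auto simp: source.simps)
    then show "(i, j) \<in> diagram t m" "c + j = k" "(i, j + 1) \<in> diagram t m \<Longrightarrow> c \<le> val S (i, j + 1)"
      using written_Red(1) unfolding c_def by blast+
    show "i + off t < j" using st by (auto simp: in_diagram_iff diagonal_iff)
    show "b \<le> j" by (rule lands_Downward_col[OF m St s ld i])
  qed
  have col_i: "col_length m (x - off t) = i" if "b \<le> x" "1 \<le> i \<Longrightarrow> x \<le> j" for x
  proof -
    have "(i + 1, x) \<notin> diagram t m" using outside_down[OF m out ab(1,2) that(1)] ab by simp
    then have "col_length m (x - off t) \<le> i"
      using ab that by (auto simp: diagram_iff_col_length[OF m])
    moreover have "i \<le> col_length m (x - off t)" if i: "1 \<le> i"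
    proof -
      have "(i, x) \<in> diagram t m"
        by (rule diagram_down[OF m mem(1)[OF i]]) (use i ab \<open>b \<le> x\<close> \<open>1 \<le> i \<Longrightarrow> x \<le> j\<close> in auto)
      then show ?thesis by (simp add: diagram_iff_col_length[OF m])
    qed
    ultimately show ?thesis by (cases "i = 0") auto
  qed
  have fit: "fits t l (i, j) c \<longleftrightarrow> i + c \<le> C" if "1 \<le> i"
    unfolding C_def by (rule fits_iff_col_length[OF l]) (use mem[OF that] that in auto)
  \<comment> \<open>The solution of the matching equation for a column of length \<open>i\<close>.
    The new cell failing to fit places \<open>x\<close> at \<open>b\<close> or later, and the source
    fitting places it at \<open>j\<close> or earlier.\<close>
  define x where "x = i + k - C"
  have colhome: "home t m l k (a, b) e"
    if f: "i = 0 \<or> i + c \<le> C" and x: "b \<le> x" and kl: "length l + 1 + off t \<le> k"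
      and col: "diagonal t (a, b) \<or> snd e = Red"
  proof -
    have "C \<le> k" using kl col_length_le(1)[of l "k - off t"] by (simp add: C_def)
    then have "C + x = i + k" by (simp add: x_def)
    moreover have "col_length m (x - off t) = i"
      by (rule col_i[OF x]) (use f mem \<open>C + x = i + k\<close> in auto)
    ultimately have "col_match t m l k x \<and> a = col_length m (x - off t) + 1"
      using kl x ab by (auto simp: col_match_def C_def)
    then show ?thesis using x col by auto
  qed
  \<comment> \<open>A matching column beyond \<open>j\<close> leads to the same conclusion in
    another way: row \<open>i\<close> then extends to column \<open>y\<close>, where an entry at
    least \<open>c\<close> fits, and this gives the bound at the source.\<close>
  have colfit: "fits t l (i, j) c"
    if i: "1 \<le> i" and y: "b \<le> y" "col_match t m l k y" "a = col_length m (y - off t) + 1" for y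
  proof (cases "y \<le> j")
    case True
    then show ?thesis using fit[OF i] y ab mem(2)[OF i] by (auto simp: col_match_def C_def)
  next
    case False
    have iy: "(i, y) \<in> diagram t m" using y ab i by (auto simp: diagram_iff_col_length[OF m])
    have "(i, j + 1) \<in> diagram t m" by (rule diagram_down[OF m iy]) (use False mem(4)[OF i] i in auto)
    then have "c \<le> val S (i, j + 1)" by (rule right[OF i])
    also have "\<dots> \<le> val S (i, y)" by (rule tableaux_mono[OF m St iy]) (use False mem(4)[OF i] i in auto)
    finally have "c \<le> val S (i, y)" .
    then show ?thesis
      using False mem(4)[OF i] i by (intro fits_down[OF l Sl[OF iy]]) auto
  qed
  have i_cases: "(i, j) = (0, 0) \<or> fits t l (i, j) c \<Longrightarrow> i = 0 \<or> i + c \<le> C"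
    using fit by (cases "i = 0") auto
  show ?thesis unfolding c_def[symmetric]
  proof (cases "t = TypeD \<and> diagonal t (a, b)")
    case False
    have vb: "fst e + b = k"
      using False written_Red(1)[OF wq] bq ab by (cases t; cases "diagonal t (a, b)") (auto simp: diagonal_iff)
    have red: "diagonal t (a, b) \<or> snd e = Red" using written_Red(2)[OF wq] by blast
    have C: "C < a + fst e"
      using bad fits_iff_col_length[OF l, of a "fst e" t b k] ab vb by (simp add: C_def)
    \<comment> \<open>For smaller \<open>k\<close>, column \<open>k\<close> of \<open>l\<close>
      reaches the diagonal, and the new entry would fit.\<close>
    have kl: "length l + 1 + off t \<le> k"
    proof (rule ccontr)
      assume "\<not> ?thesis"
      then have "k - off t \<le> C" unfolding C_def by (intro full_column[OF l]) simp
      then show False using C vb ab by linarith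
    qed
    have x: "b \<le> x" using C vb ab unfolding x_def by linarith
    show "(i, j) = (0, 0) \<or> fits t l (i, j) c \<longleftrightarrow> home t m l k (a, b) e"
    proof
      assume "(i, j) = (0, 0) \<or> fits t l (i, j) c"
      then show "home t m l k (a, b) e" using colhome[OF i_cases x kl red] by blast
    next
      assume h: "home t m l k (a, b) e"
      have "\<not> (\<exists>r. row_match t m l k r \<and> (diagonal t (a, b) \<or> snd e = Black))"
        using kl False written_Red(2)[OF wq] by (cases t) (auto simp: row_match_def)
      then obtain y where "b \<le> y" "col_match t m l k y" "a = col_length m (y - off t) + 1"
        using h by auto
      then show "(i, j) = (0, 0) \<or> fits t l (i, j) c"
        using colfit[of y] start by (cases "i = 0") auto
    qed
  next
    case True
    then have b: "b = a + 1" "t = TypeD" "diagonal t (a, b)" by (auto simp: diagonal_iff)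
    have ev: "even (fst e)" using wq True by (cases e) (auto simp: written_def)
    have big: "length l < a + fst e"
      using bad ab b part_pos_iff[OF l, of "a + fst e"] by (auto simp: in_diagram_iff)
    have im: "i = length m"
    proof (rule antisym)
      show "i \<le> length m" using in_diagram_length mem(1) by (cases "i = 0") auto
      show "length m \<le> i" using out ab b diagonal_in_diagram[OF m, of a t] by auto
    qed
    show "(i, j) = (0, 0) \<or> fits t l (i, j) c \<longleftrightarrow> home t m l k (a, b) e"
    proof (cases "k = length l + 1")
      \<comment> \<open>The only case in which a downward bump ends in a row match: the diagonal
        entry turns out black, and its even value is the parity condition.\<close>
      case kl: True
      then have "a + fst e = k" using big bq by linarith
      then have "even (k + a)" using ev by (auto simp flip: \<open>a + fst e = k\<close>)
      then have "row_match t m l k a" "part m a = 0"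
        using kl b im ab by (auto simp: row_match_def part_def)
      then have "home t m l k (a, b) e" using b by auto
      moreover have "fits t l (i, j) c" if i: "1 \<le> i"
      proof -
        have "k - 1 \<le> C" using full_column[OF l, of k t] kl b by (simp add: C_def)
        then show ?thesis using fit[OF i] mem[OF i] b by simp
      qed
      ultimately show ?thesis using start by (cases "i = 0") auto
    next
      case False
      then have kl: "length l + 2 \<le> k" using big bq by linarith
      have "C \<le> length l" by (simp add: C_def col_length_le)
      then have x: "b \<le> x" using kl b ab by (simp add: x_def)
      show ?thesis
      proof
        assume "(i, j) = (0, 0) \<or> fits t l (i, j) c"
        then show "home t m l k (a, b) e" using colhome[OF i_cases x] kl b by auto
      next
        assume h: "home t m l k (a, b) e"
        have "\<not> row_match t m l k r" for r using kl by (auto simp: row_match_def)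
        then obtain y where "b \<le> y" "col_match t m l k y" "a = col_length m (y - off t) + 1"
          using h by auto
        then show "(i, j) = (0, 0) \<or> fits t l (i, j) c"
          using colfit[of y] start by (cases "i = 0") auto
      qed
    qed
  qed
qed

lemma carried_fits_iff_home:
  assumes m: "strict_partition m" and l: "strict_partition l" and S: "S \<in> bounded_tableaux t m l" and k: "1 \<le> k"
    and s: "source t m S k p d" and ld: "lands t S k p d q" and out: "q \<notin> diagram t m"
    and e: "e = entry_of t d k q" and bad: "\<not> fits t l q (fst e)"
  shows "p = (0, 0) \<or> fits t l p (fst (entry_of t d k p)) \<longleftrightarrow> home t m l k q e"
proof -
  obtain i j a b where pq: "p = (i, j)" "q = (a, b)" by (metis surj_pair)
  show ?thesis
  proof (cases d)
    case Rightward
    then have "p \<noteq> (0, 0)" using s pq by (auto simp: source.simps in_diagram_iff)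
    then show ?thesis using home_if_lands_right[OF m l S] assms unfolding pq Rightward by blast
  next
    case Downward
    then show ?thesis using home_if_lands_down[OF m l S] assms unfolding pq Downward by blast
  next
    case Stop
    then show ?thesis using ld pq by (simp add: lands.simps)
  qed
qed

section \<open>Uniqueness and existence of the home cell\<close>

lemma row_match_unique:
  assumes m: "strict_partition m" and l: "strict_partition l" and k: "1 \<le> k"
    and r: "row_match t m l k r" "row_match t m l k r'"
  shows "r = r'"
proof (cases "k \<le> length l")
  case True
  then have "0 < part l k" using k by (simp add: part_pos_iff[OF l])
  then show ?thesis
    using r part_strict[OF m, of r r'] part_strict[OF m, of r' r] unfolding row_match_def
    by (cases r r' rule: linorder_cases) auto
next
  case False
  then show ?thesis using r by (simp add: row_match_def)
qed

text \<open>A match further right would have a column longer by as much as its number is larger. By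
  downward closure column \<open>s\<close> would then contain a cell below its own end.\<close>

lemma col_match_unique:
  assumes m: "strict_partition m" and s: "col_match t m l k s" "col_match t m l k s'"
  shows "s = s'"
proof -
  have less: False if s: "col_match t m l k s" "col_match t m l k s'" "s < s'" for s s'
  proof -
    define a where "a = col_length m (s - off t)"
    define a' where "a' = col_length m (s' - off t)"
    define C where "C = col_length l (k - off t)"
    have C: "C + 1 + off t \<le> k" "C + s = a + k" "C + s' = a' + k"
      using s col_length_le(1)[of l "k - off t"] by (auto simp: col_match_def C_def a_def a'_def)
    have a: "a + 1 + off t \<le> s" "a + 1 \<le> a'" using C s(3) by linarith+
    have "a' \<le> s' - off t" unfolding a'_def by (rule col_length_le)
    then have "(a', s') \<in> diagram t m"
      using a C s by (auto simp: diagram_iff_col_length[OF m] a'_def[symmetric])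
    then have "(a + 1, s) \<in> diagram t m" by (rule diagram_down[OF m]) (use a s in auto)
    then show False by (simp add: diagram_iff_col_length[OF m] a_def)
  qed
  then show ?thesis using s by (meson linorder_neqE_nat)
qed

lemma corner_column_unique:
  assumes m: "strict_partition m" and "corner t m (i, j)" "corner t m (i', j)"
  shows "i = i'"
proof -
  have False if c: "corner t m (i, j)" "corner t m (i', j)" "i < i'" for i i'
  proof -
    have "(i' - 1, j) \<in> diagram t m" "i \<le> i' - 1" using c by auto
    then show False using diagram_down[OF m, of "i' - 1" j t i j] c by auto
  qed
  then show ?thesis using assms by (meson linorder_neqE_nat)
qed

lemma corner_row_unique:
  assumes m: "strict_partition m" and "corner t m (i, j)" "corner t m (i, j')"
  shows "j = j'"
proof -
  have False if c: "corner t m (i, j)" "corner t m (i, j')" "j < j'" for j j'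
  proof -
    have "(i, j' - 1) \<in> diagram t m" "j \<le> j' - 1" using c by auto
    then show False using diagram_down[OF m, of i "j' - 1" t i j] c by auto
  qed
  then show ?thesis using assms by (meson linorder_neqE_nat)
qed

text \<open>A row match fixes the column and a column match fixes the row; a row or column contains
  at most one corner. The kind of match fixes the color off the diagonal, and parity fixes it on the
  diagonal.\<close>

lemma home_unique:
  assumes m: "strict_partition m" and l: "strict_partition l" and k: "1 \<le> k"
    and c: "corner t m q" "corner t m q'"
    and h: "home t m l k q e" "home t m l k q' e'"
    and ix: "var_index q e = k" "var_index q' e' = k"
    and dg: "diagonal t q \<Longrightarrow> diagonal_entry t e" "diagonal t q' \<Longrightarrow> diagonal_entry t e'"
  shows "q = q' \<and> e = e'"
proof -
  obtain i j i' j' where q: "q = (i, j)" "q' = (i', j')" by (metis surj_pair)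
  have excl: "\<not> (row_match t m l k r \<and> col_match t m l k s)" for r s
    by (cases t) (auto simp: row_match_def col_match_def)
  have "q = q' \<and> (diagonal t q \<or> snd e = snd e')"
  proof (cases "\<exists>r. row_match t m l k r")
    case True
    then obtain r r' where r: "row_match t m l k r" "row_match t m l k r'"
       "j = part m r + r + off t" "diagonal t q \<or> snd e = Black"
       "j' = part m r' + r' + off t" "diagonal t q' \<or> snd e' = Black"
      using h excl unfolding q by auto
    then have "j = j'" using row_match_unique[OF m l k r(1,2)] by simp
    then show ?thesis using corner_column_unique[OF m, of t i j i'] c r unfolding q by auto
  next
    case False
    then obtain s s' where s: "col_match t m l k s" "col_match t m l k s'"
       "i = col_length m (s - off t) + 1" "diagonal t q \<or> snd e = Red"
       "i' = col_length m (s' - off t) + 1" "diagonal t q' \<or> snd e' = Red"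
      using h unfolding q by auto
    then have "i = i'" using col_match_unique[OF m s(1,2)] by simp
    then show ?thesis using corner_row_unique[OF m, of t i j j'] c s unfolding q by auto
  qed
  then show ?thesis using entry_eqI[of q e e' t] ix dg by metis
qed

text \<open>The black \<open>x_k\<close> goes to the top of the block of rows ending with row
  \<open>r\<close>. Boundedness of \<open>S\<close> makes it at least its left and upper neighbours,
  and the match makes it exceed the bound.\<close>

lemma home_exists_row:
  assumes m: "strict_partition m" and l: "strict_partition l" and S: "S \<in> bounded_tableaux t m l" and k: "1 \<le> k"
    and r: "row_match t m l k r"
  shows "\<exists>q e. target t m S k q e \<and> q \<notin> diagram t m \<and> \<not> fits t l q (fst e) \<and> home t m l k q e"
proof -
  have Sl: "\<And>p. p \<in> diagram t m \<Longrightarrow> fits t l p (val S p)"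
    using S by (auto simp: bounded_iff)
  define b where "b = part m r + r + off t"
  define a where "a = (LEAST a. 1 \<le> a \<and> (a, b) \<notin> diagram t m)"
  have r1: "1 \<le> r" and lk: "part l k = part m r" using r by (auto simp: row_match_def)
  have Pr: "1 \<le> r \<and> (r, b) \<notin> diagram t m" using r1 by (auto simp: b_def in_diagram_iff)
  have ar: "a \<le> r" unfolding a_def using Least_le[of "\<lambda>a. 1 \<le> a \<and> (a, b) \<notin> diagram t m" r] Pr by blast
  have a: "1 \<le> a" "(a, b) \<notin> diagram t m" unfolding a_def using LeastI[of "\<lambda>a. 1 \<le> a \<and> (a, b) \<notin> diagram t m" r] Pr by blast+
  have up: "(a - 1, b) \<in> diagram t m" if "1 < a"
    using not_less_Least[of "a - 1" "\<lambda>a. 1 \<le> a \<and> (a, b) \<notin> diagram t m"] that unfolding a_def[symmetric] by auto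
  \<comment> \<open>Part \<open>k\<close> of \<open>l\<close> is then zero too, which leaves only
    the extra index of type D.\<close>
  have special: "t = TypeD \<and> r = length m + 1 \<and> part m r = 0 \<and> even (k + r)" if "part m r = 0"
    using that lk k r part_pos_iff[OF l, of k] by (auto simp: row_match_def)
  have left: "(a, b - 1) \<in> diagram t m" if "a + off t < b"
  proof (cases "part m r = 0")
    case True
    note sp = special[OF True]
    have "1 \<le> length m" using sp that ar a True by (auto simp: b_def)
    then have "(length m, length m + off t) \<in> diagram t m"
      by (simp add: diagonal_in_diagram[OF m])
    then show ?thesis by (rule diagram_down[OF m]) (use sp that ar a True in \<open>auto simp: b_def\<close>)
  next
    case False
    then have "(r, b - 1) \<in> diagram t m" using r1 by (auto simp: in_diagram_iff b_def)
    then show ?thesis by (rule diagram_down[OF m]) (use that ar a in auto)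
  qed
  \<comment> \<open>Otherwise the upper neighbour moves down to row \<open>k\<close> of
    \<open>l\<close> or later, and such a row has at most \<open>part m r\<close> cells, too few to
    contain it.\<close>
  have up_val: "val S (a - 1, b) + a \<le> k" if "1 < a"
  proof (rule ccontr)
    assume "\<not> ?thesis"
    then have "part l (a - 1 + val S (a - 1, b)) \<le> part l k"
      using k by (intro part_antimono[OF l]) auto
    then show False using Sl[OF up[OF that]] ar that lk by (auto simp: in_diagram_iff b_def)
  qed
  have left_val: "val S (a, b - 1) + a \<le> k" if "a + off t < b"
  proof (rule ccontr)
    assume "\<not> ?thesis"
    then have gt: "k < a + val S (a, b - 1)" by simp
    have f: "b - 1 < part l (a + val S (a, b - 1)) + a + off t"
      using Sl[OF left[OF that]] by (auto simp: in_diagram_iff)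
    show False
    proof (cases "part l k = 0")
      case True
      then have "part l (a + val S (a, b - 1)) = 0"
        using part_antimono[OF l k, of "a + val S (a, b - 1)"] gt by simp
      then show False using f that by linarith
    next
      case False
      then have "part l (a + val S (a, b - 1)) < part l k" using gt k by (intro part_strict[OF l]) auto
      then show False using f ar lk False unfolding b_def by linarith
    qed
  qed
  have ak: "a \<le> k" using up_val a k by (cases "a = 1") force+
  have ab: "a + off t \<le> b" using ar by (simp add: b_def)
  have "diagonal_entry t (k - a, Black)" if "diagonal t (a, b)"
  proof (cases t)
    case TypeD
    \<comment> \<open>On the diagonal the black entry has to be even, and the parity condition in
      the match guarantees this.\<close>
    have "part m r = 0" "a = r" using that ar by (auto simp: diagonal_iff b_def)
    then have "even (k + a)" using special by simp
    then show ?thesis using ak TypeD by auto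
  qed simp
  then have "target t m S k (a, b) (k - a, Black)"
    using a ab ak up up_val left left_val by (fastforce simp: target.simps)
  moreover have "\<not> fits t l (a, b) (k - a)"
    using ak ar lk by (auto simp: in_diagram_iff b_def)
  moreover have "home t m l k (a, b) (k - a, Black)" using r ar by (auto simp: b_def)
  ultimately show ?thesis using a by (intro exI[of _ "(a, b)"] exI[of _ "(k - a, Black)"]) auto
qed

text \<open>The transposed construction: \<open>x_k\<close> goes to the leftmost outside cell of the
  row right below column \<open>s\<close>.\<close>

lemma home_exists_col:
  assumes m: "strict_partition m" and l: "strict_partition l" and S: "S \<in> bounded_tableaux t m l" and k: "1 \<le> k"
    and s: "col_match t m l k s"
  shows "\<exists>q e. target t m S k q e \<and> q \<notin> diagram t m \<and> \<not> fits t l q (fst e) \<and> home t m l k q e"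
proof -
  have Sl: "\<And>p. p \<in> diagram t m \<Longrightarrow> fits t l p (val S p)"
    using S by (auto simp: bounded_iff)
  define C where "C = col_length l (k - off t)"
  define a where "a = col_length m (s - off t) + 1"
  define b where "b = (LEAST b. a + off t \<le> b \<and> (a, b) \<notin> diagram t m)"
  have kl: "length l + 1 + off t \<le> k" and s1: "1 + off t \<le> s" and Cs: "C + s + 1 = a + k"
    using s by (auto simp: col_match_def C_def a_def)
  have Cl: "C \<le> length l" unfolding C_def by (rule col_length_le)
  have a: "1 \<le> a" "a + off t \<le> s" using Cs Cl kl by (simp_all add: a_def)
  have Ps: "a + off t \<le> s \<and> (a, s) \<notin> diagram t m"
    using a by (simp add: diagram_iff_col_length[OF m]) (simp add: a_def)
  have bs: "b \<le> s" unfolding b_def using Least_le[of "\<lambda>b. a + off t \<le> b \<and> (a, b) \<notin> diagram t m" s] Ps by blast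
  have b: "a + off t \<le> b" "(a, b) \<notin> diagram t m" unfolding b_def using LeastI[of "\<lambda>b. a + off t \<le> b \<and> (a, b) \<notin> diagram t m" s] Ps by blast+
  have left: "(a, b - 1) \<in> diagram t m" if "a + off t < b"
    using not_less_Least[of "b - 1" "\<lambda>b. a + off t \<le> b \<and> (a, b) \<notin> diagram t m"] that unfolding b_def[symmetric] by auto
  have up: "(a - 1, b) \<in> diagram t m" if "1 < a"
  proof -
    have "(a - 1, s) \<in> diagram t m" using a that by (auto simp: diagram_iff_col_length[OF m] a_def)
    then show ?thesis by (rule diagram_down[OF m]) (use that b bs in auto)
  qed
  have col: "x \<le> C" if "(x, k) \<in> diagram t l" for x
    using that by (simp add: diagram_iff_col_length[OF l] C_def)
  \<comment> \<open>A larger neighbour, moved down the diagonal, would put a cell of column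
    \<open>k\<close> of \<open>l\<close> into row \<open>a + k - b\<close>. By the matching equation
    that column ends before this row.\<close>
  have up_val: "val S (a - 1, b) + b \<le> k" if "1 < a"
  proof (rule ccontr)
    assume not: "\<not> ?thesis"
    have "(a + k - b, k) \<in> diagram t l"
      using Sl[OF up[OF that], unfolded fits.simps]
      by (rule diagram_down[OF l]) (use not that Cs bs b kl in auto)
    then show False using col[of "a + k - b"] Cs bs by linarith
  qed
  have left_val: "val S (a, b - 1) + b \<le> k" if "a + off t < b"
  proof (rule ccontr)
    assume not: "\<not> ?thesis"
    have "(a + k + 1 - b, k) \<in> diagram t l"
      using Sl[OF left[OF that], unfolded fits.simps]
      by (rule diagram_down[OF l]) (use not that Cs bs b kl in auto)
    then show False using col[of "a + k + 1 - b"] Cs bs by linarith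
  qed
  have bk: "b \<le> k"
  proof (cases "1 < a")
    case True
    then show ?thesis using up_val by force
  next
    case False
    then show ?thesis using Cs bs a by linarith
  qed
  define e where "e = entry_of t Downward k (a, b)"
  have w: "written t Downward k (a, b) e" using bk b by (simp add: e_def written_iff)
  note be = written_bounds[OF w b(1)]
  have "target t m S k (a, b) e"
  proof -
    have "val S (a, b - 1) \<le> fst e" if "a + off t < b" using left_val[OF that] be by linarith
    moreover have "val S (a - 1, b) \<le> fst e" if "1 < a" using up_val[OF that] be by linarith
    moreover have "diagonal_entry t e" if "diagonal t (a, b)" using w that by (simp add: written_def)
    ultimately show ?thesis using a b up left written_index[OF w] by (auto simp: target.simps)
  qed
  moreover have "\<not> fits t l (a, b) (fst e)"
  proof
    assume f: "fits t l (a, b) (fst e)"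
    show False
    proof (cases "t = TypeD \<and> diagonal t (a, b)")
      case True
      have "a + fst e \<le> length l" using f in_diagram_length by auto
      then show False using True be kl by (auto simp: diagonal_iff)
    next
      case False
      have eb: "fst e + b = k"
        using False written_Red(1)[OF w] be b by (cases t; cases "diagonal t (a, b)") (auto simp: diagonal_iff)
      then have "a + fst e \<le> C" using f col[of "a + fst e"] by (simp add: add.commute[of b])
      then show False using eb Cs bs by linarith
    qed
  qed
  moreover have "home t m l k (a, b) e"
    using s bs written_Red(2)[OF w] by (auto simp: a_def)
  ultimately show ?thesis using b by blast
qed

lemma home_exists:
  assumes "strict_partition m" "strict_partition l" "S \<in> bounded_tableaux t m l" "1 \<le> k" "k \<notin> index_set t m l"
  shows "\<exists>q e. target t m S k q e \<and> q \<notin> diagram t m \<and> \<not> fits t l q (fst e) \<and> home t m l k q e"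
  using assms home_exists_row home_exists_col unfolding notin_index_set_iff[OF assms(4)] by metis

lemma home_notin_index_set: "1 \<le> k \<Longrightarrow> home t m l k q e \<Longrightarrow> k \<notin> index_set t m l"
  unfolding notin_index_set_iff by (cases q) auto

section \<open>The repeated insertion process\<close>

text \<open>The equivalence works in both directions: it classifies the results obtained from a
  bounded \<open>S\<close>, and it shows that the preimage of such a result is bounded.\<close>

lemma insertion_bounded_iff:
  assumes m: "strict_partition m" and l: "strict_partition l" and S: "S \<in> tableaux t m" and k: "1 \<le> k"
    and ins: "insertion t S k S'"
  shows "\<exists>q e n. strict_partition n \<and> covers n m \<and> S' \<in> tableaux t n \<and> diagram t n = insert q (diagram t m) \<and>
    q \<notin> diagram t m \<and> S' q = Some e \<and> target t m (S'(q := None)) (var_index q e) q e \<and> 1 \<le> var_index q e \<and>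
    (S \<in> bounded_tableaux t m l \<longleftrightarrow> S'(q := None) \<in> bounded_tableaux t m l \<and>
      (fits t l q (fst e) \<or> home t m l (var_index q e) q e))"
proof -
  obtain S1 p d k1 q e where S1: "S1 \<in> tableaux t m" "1 \<le> k1" and T: "target t m S1 k1 q e"
    and q: "q \<notin> diagram t m" and S': "S' = S1(q \<mapsto> e)"
    and s: "source t m S1 k1 p d" "lands t S1 k1 p d q" "entry_of t d k1 q = e"
    and iff: "S \<in> bounded_tableaux t m l \<longleftrightarrow> carries_bounded t m l S1 p d k1"
    using insertion_last_bump[OF m l S k ins] by blast
  obtain n where n: "strict_partition n" "covers n m" "diagram t n = insert q (diagram t m)"
    using add_corner[OF m target_corner[OF T q]] by blast
  have "S' \<in> tableaux t n" unfolding S' by (rule target_lower[OF m n(1) S1(1) T n(3)])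
  moreover have "S1 q = None" using q tableaux_dom[OF S1(1)] by (metis domIff)
  then have rem: "S'(q := None) = S1" by (auto simp: S')
  moreover have "var_index q e = k1" by (rule target_index[OF T])
  moreover have "carries_bounded t m l S1 p d k1 \<longleftrightarrow>
      S1 \<in> bounded_tableaux t m l \<and> (fits t l q (fst e) \<or> home t m l k1 q e)"
  proof (cases "S1 \<in> bounded_tableaux t m l")
    case True
    show ?thesis
    proof (cases "fits t l q (fst e)")
      case fq: True
      then show ?thesis
        using carried_fits[OF m l S1 s(1,2)] True s(3) by (auto simp: carries_bounded_def)
    next
      case False
      then show ?thesis
        using carried_fits_iff_home[OF m l True S1(2) s(1,2) q s(3)[symmetric]] True by (auto simp: carries_bounded_def)
    qed
  qed (simp add: carries_bounded_def)
  ultimately show ?thesis using n q T S1(2) iff S' by (intro exI[of _ q] exI[of _ e] exI[of _ n]) simp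
qed

lemma bounded_extend:
  assumes S: "S' \<in> tableaux t n" and dn: "diagram t n = insert q (diagram t m)" and q: "q \<notin> diagram t m"
    and e: "S' q = Some e" and rem: "S'(q := None) \<in> tableaux t m"
  shows "S' \<in> bounded_tableaux t n l \<longleftrightarrow> S'(q := None) \<in> bounded_tableaux t m l \<and> fits t l q (fst e)"
proof -
  have "val (S'(q := None)) p = val S' p" if "p \<in> diagram t m" for p
    using that q by (auto simp: val_def)
  moreover have "val S' q = fst e" using e by (simp add: val_def)
  ultimately show ?thesis using S rem by (simp add: bounded_iff dn conj_commute)
qed

text \<open>Moving a cell down the diagonal and back stays inside \<open>l\<close>, because values
  are nonnegative. Hence a rejected round always fails through its entries.\<close>

lemma bounded_contained:
  assumes l: "strict_partition l" and S: "S \<in> bounded_tableaux t n l"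
  shows "contained n l"
  unfolding contained_iff[of n l t]
proof
  fix p assume p: "p \<in> diagram t n"
  obtain i j where ij: "p = (i, j)" by force
  have "fits t l (i, j) (val S p)" using S p unfolding bounded_iff ij by blast
  moreover have "1 \<le> i" "i + off t \<le> j" using p by (simp_all add: ij in_diagram_iff)
  ultimately show "p \<in> diagram t l"
    using diagram_down[OF l, of "i + val S p" "j + val S p" t i j] by (simp add: ij)
qed

text \<open>Rejected rounds lead back to inputs and accepted ones to results. The sum type makes
  both a single relation, to which the iteration lemmas apply.\<close>

definition round_step ::
  "ttype \<Rightarrow> nat list \<Rightarrow> nat list \<Rightarrow> (tableau \<times> nat) + tableau \<Rightarrow> (tableau \<times> nat) + tableau \<Rightarrow> bool" where
  "round_step t m l x y \<longleftrightarrow> (\<exists>s. x = Inl s \<and>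
     ((\<exists>s'. y = Inl s' \<and> rejected_round t m l s s') \<or> (\<exists>S'. y = Inr S' \<and> accepted_round t m l s S')))"

lemma round_outcome:
  assumes m: "strict_partition m" and l: "strict_partition l" and S: "S \<in> bounded_tableaux t m l" and k: "1 \<le> k"
  shows "\<exists>S' q e n. insertion t S k S' \<and> strict_partition n \<and> covers n m \<and> S' \<in> tableaux t n \<and>
    diagram t n = insert q (diagram t m) \<and> q \<notin> diagram t m \<and> S' q = Some e \<and>
    target t m (S'(q := None)) (var_index q e) q e \<and> 1 \<le> var_index q e \<and>
    S'(q := None) \<in> bounded_tableaux t m l \<and>
    (fits t l q (fst e) \<and> contained n l \<and> S' \<in> bounded_tableaux t n l \<and>
       (\<forall>y. round_step t m l (Inl (S, k)) y \<longleftrightarrow> y = Inr S') \<or>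
     \<not> fits t l q (fst e) \<and> home t m l (var_index q e) q e \<and>
       (\<forall>y. round_step t m l (Inl (S, k)) y \<longleftrightarrow> y = Inl (S'(q := None), var_index q e)))"
proof -
  have St: "S \<in> tableaux t m" using S by (simp add: bounded_iff)
  obtain S' where ins: "insertion t S k S'" using insertion_exists[OF m St k] by blast
  obtain q e n where n: "strict_partition n" "covers n m" and S': "S' \<in> tableaux t n"
    and dn: "diagram t n = insert q (diagram t m)" and q: "q \<notin> diagram t m" and e: "S' q = Some e"
    and T: "target t m (S'(q := None)) (var_index q e) q e" "1 \<le> var_index q e"
    and rem: "S'(q := None) \<in> bounded_tableaux t m l"
    and or: "fits t l q (fst e) \<or> home t m l (var_index q e) q e"
    using insertion_bounded_iff[OF m l St k ins] S by blast
  have remt: "S'(q := None) \<in> tableaux t m" using rem by (simp add: bounded_iff)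
  have ins_eq: "insertion t S k S'' \<longleftrightarrow> S'' = S'" for S''
    using ins insertion_unique[OF m St k] by blast
  have same: "diagram t n' = diagram t n" if "S' \<in> tableaux t n'" for n'
    using tableaux_dom[OF that] tableaux_dom[OF S'] by simp
  have bounded: "S' \<in> bounded_tableaux t n' l \<longleftrightarrow> fits t l q (fst e)" if "S' \<in> tableaux t n'" for n'
    using bounded_extend[OF that _ q e remt, of l] same[OF that] dn rem by simp
  have acc: "accepted_round t m l (S, k) S'' \<longleftrightarrow> S'' = S' \<and> fits t l q (fst e)" for S''
  proof
    assume "accepted_round t m l (S, k) S''"
    then obtain n' where "S'' = S'" "S' \<in> bounded_tableaux t n' l"
      by (auto simp: accepted_round_def ins_eq)
    moreover from this have "S' \<in> tableaux t n'" by (simp add: bounded_iff)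
    ultimately show "S'' = S' \<and> fits t l q (fst e)" using bounded by blast
  next
    assume *: "S'' = S' \<and> fits t l q (fst e)"
    then have "S' \<in> bounded_tableaux t n l" using bounded[OF S'] by blast
    then show "accepted_round t m l (S, k) S''"
      using * n bounded_contained[OF l] by (auto simp: accepted_round_def ins_eq)
  qed
  have rej: "rejected_round t m l (S, k) s \<longleftrightarrow> s = (S'(q := None), var_index q e) \<and> \<not> fits t l q (fst e)" for s
  proof
    assume "rejected_round t m l (S, k) s"
    moreover obtain S1 k1 where s: "s = (S1, k1)" by force
    ultimately obtain n' p where r: "S' \<in> tableaux t n'" "\<not> (contained n' l \<and> S' \<in> bounded_tableaux t n' l)"
      "diagram t n' - diagram t m = {p}" "k1 = var_index p (the (S' p))" "S1 = S'(p := None)"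
      by (auto simp: rejected_round_def ins_eq)
    then have "p = q" using same[OF r(1)] dn q by auto
    then show "s = (S'(q := None), var_index q e) \<and> \<not> fits t l q (fst e)"
      using r e s bounded[OF r(1)] bounded_contained[OF l, of S' t n'] by auto
  next
    assume *: "s = (S'(q := None), var_index q e) \<and> \<not> fits t l q (fst e)"
    have "diagram t n - diagram t m = {q}" using dn q by auto
    moreover have "S' \<notin> bounded_tableaux t n l" using * bounded[OF S'] by blast
    ultimately show "rejected_round t m l (S, k) s"
      using * n S' e by (cases q) (auto simp: rejected_round_def ins_eq intro!: exI[of _ n])
  qed
  have steps: "round_step t m l (Inl (S, k)) y \<longleftrightarrow>
      (if fits t l q (fst e) then y = Inr S' else y = Inl (S'(q := None), var_index q e))" for y
    unfolding round_step_def by (auto simp: acc rej)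
  have "contained n l \<and> S' \<in> bounded_tableaux t n l" if "fits t l q (fst e)"
    using bounded[OF S'] that bounded_contained[OF l] by blast
  then show ?thesis
    using ins n S' dn q e T rem or steps by (intro exI[of _ S'] exI[of _ q] exI[of _ e] exI[of _ n]) auto
qed

text \<open>All positive \<open>k\<close> are allowed, since every rejected round continues with an
  index outside the index set. Such inputs are the ones that can also be returned by a
  round.\<close>

definition pending_states :: "ttype \<Rightarrow> nat list \<Rightarrow> nat list \<Rightarrow> ((tableau \<times> nat) + tableau) set" where
  "pending_states t m l = {Inl (S, k) | S k. S \<in> bounded_tableaux t m l \<and> 1 \<le> k}"

definition returned_states :: "ttype \<Rightarrow> nat list \<Rightarrow> nat list \<Rightarrow> ((tableau \<times> nat) + tableau) set" where
  "returned_states t m l = {Inl (S, k) | S k. S \<in> bounded_tableaux t m l \<and> 1 \<le> k \<and> k \<notin> index_set t m l} \<union>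
     Inr ` (\<Union>n\<in>{n. strict_partition n \<and> covers n m \<and> contained n l}. bounded_tableaux t n l)"

fun round_inv :: "(tableau \<times> nat) + tableau \<Rightarrow> nat set \<times> mpoly" where
  "round_inv (Inl (S, k)) = (insert k (indices S), weight S * X k)"
| "round_inv (Inr S) = (indices S, weight S)"

lemma index_set_pos: "k \<in> index_set t m l \<Longrightarrow> 1 \<le> k"
  by (cases t) auto

lemma pending_minus_returned:
  "pending_states t m l - returned_states t m l =
     {Inl (S, k) | S k. S \<in> bounded_tableaux t m l \<and> k \<in> index_set t m l}"
  using index_set_pos by (fastforce simp: pending_states_def returned_states_def)

lemma returned_minus_pending:
  "returned_states t m l - pending_states t m l =
     Inr ` (\<Union>n\<in>{n. strict_partition n \<and> covers n m \<and> contained n l}. bounded_tableaux t n l)"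
  by (auto simp: pending_states_def returned_states_def)

lemma round_partial_bijection:
  assumes m: "strict_partition m" and l: "strict_partition l"
  shows "partial_bijection (round_step t m l) (pending_states t m l) (returned_states t m l) round_inv"
proof
  fix x y assume "x \<in> pending_states t m l"
  then obtain S k where x: "x = Inl (S, k)" and S: "S \<in> bounded_tableaux t m l" and k: "1 \<le> k"
    by (auto simp: pending_states_def)
  have St: "S \<in> tableaux t m" using S by (simp add: bounded_iff)
  obtain S' q e n where ins: "insertion t S k S'" and n: "strict_partition n" "covers n m" and S': "S' \<in> tableaux t n"
    and e: "S' q = Some e" and k1: "1 \<le> var_index q e" and rem: "S'(q := None) \<in> bounded_tableaux t m l"
    and or: "fits t l q (fst e) \<and> contained n l \<and> S' \<in> bounded_tableaux t n l \<and>
       (\<forall>y. round_step t m l (Inl (S, k)) y \<longleftrightarrow> y = Inr S') \<or>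
     \<not> fits t l q (fst e) \<and> home t m l (var_index q e) q e \<and>
       (\<forall>y. round_step t m l (Inl (S, k)) y \<longleftrightarrow> y = Inl (S'(q := None), var_index q e))"
    using round_outcome[OF m l S k] by blast
  show "\<exists>y. round_step t m l x y" using or x by blast
  show "round_step t m l x y \<Longrightarrow> round_step t m l x y' \<Longrightarrow> y = y'" for y' using or x by metis
  have fin: "finite (dom S')" using tableaux_dom[OF S'] finite_diagram by simp
  have "weight S' = weight S * X k" "indices S' = insert k (indices S)"
    using insertion_result[OF m St k ins] by blast+
  then have inv: "round_inv (Inr S') = round_inv x"
    "round_inv (Inl (S'(q := None), var_index q e)) = round_inv x"
    using weight_split[OF fin, of q e, OF e] indices_split[of S' q e, OF e] by (simp_all add: x mult.commute)
  have "Inl (S'(q := None), var_index q e) \<in> returned_states t m l" if "home t m l (var_index q e) q e"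
    using home_notin_index_set[OF k1 that] rem k1 by (auto simp: returned_states_def)
  moreover have "Inr S' \<in> returned_states t m l" if "contained n l" "S' \<in> bounded_tableaux t n l"
    using n that by (auto simp: returned_states_def)
  ultimately show "round_step t m l x y \<Longrightarrow> y \<in> returned_states t m l \<and> round_inv y = round_inv x"
    using or inv x by metis
next
  fix y assume y: "y \<in> returned_states t m l"
  \<comment> \<open>One argument for both kinds of output: the insertion is undone by its
    surjectivity, and \<open>insertion_bounded_iff\<close> shows that the preimage is
    bounded.\<close>
  have pre: "\<exists>x\<in>pending_states t m l. round_step t m l x (if fits t l q (fst e) then Inr S' else Inl (S'(q := None), var_index q e))"
    if S': "S' \<in> tableaux t n" and n: "strict_partition n" "covers n m" and dn: "diagram t n = insert q (diagram t m)"
      and q: "q \<notin> diagram t m" and e: "S' q = Some e" and rem: "S'(q := None) \<in> bounded_tableaux t m l"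
      and or: "fits t l q (fst e) \<or> home t m l (var_index q e) q e" for S' n q e
  proof -
    obtain S k where St: "S \<in> tableaux t m" and k: "1 \<le> k" and ins: "insertion t S k S'"
      using insertion_surjective[OF m n S'] by blast
    have cell: "q' = q \<and> e' = e" if "S' \<in> tableaux t n'" "diagram t n' = insert q' (diagram t m)" "q' \<notin> diagram t m" "S' q' = Some e'"
      for n' q' e'
    proof -
      have "insert q' (diagram t m) = insert q (diagram t m)"
        using tableaux_dom[OF that(1)] tableaux_dom[OF S'] that(2) dn by simp
      then have "q' = q" using q that(3) by blast
      then show ?thesis using e that(4) by simp
    qed
    have S: "S \<in> bounded_tableaux t m l"
      using insertion_bounded_iff[OF m l St k ins] cell rem or by metis
    obtain S'' q'' e'' n'' where ins'': "insertion t S k S''" and R: "S'' \<in> tableaux t n''"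
      "diagram t n'' = insert q'' (diagram t m)" "q'' \<notin> diagram t m" "S'' q'' = Some e''"
      and or'': "fits t l q'' (fst e'') \<and> contained n'' l \<and> S'' \<in> bounded_tableaux t n'' l \<and>
        (\<forall>y. round_step t m l (Inl (S, k)) y \<longleftrightarrow> y = Inr S'') \<or>
       \<not> fits t l q'' (fst e'') \<and> home t m l (var_index q'' e'') q'' e'' \<and>
       (\<forall>y. round_step t m l (Inl (S, k)) y \<longleftrightarrow> y = Inl (S''(q'' := None), var_index q'' e''))"
      using round_outcome[OF m l S k] by blast
    have S'': "S'' = S'" by (rule insertion_unique[OF m St k ins'' ins])
    have "q'' = q \<and> e'' = e" using cell[of n''] R unfolding S'' by blast
    then have "round_step t m l (Inl (S, k)) (if fits t l q (fst e) then Inr S' else Inl (S'(q := None), var_index q e))"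
      using or'' S'' by (cases "fits t l q (fst e)") simp_all
    then show ?thesis using S k by (intro bexI[of _ "Inl (S, k)"]) (auto simp: pending_states_def)
  qed
  from y consider S1 k1 where "y = Inl (S1, k1)" "S1 \<in> bounded_tableaux t m l" "1 \<le> k1" "k1 \<notin> index_set t m l"
    | S' n where "y = Inr S'" "strict_partition n" "covers n m" "S' \<in> bounded_tableaux t n l"
    unfolding returned_states_def by blast
  then show "\<exists>x\<in>pending_states t m l. round_step t m l x y"
  proof cases
    case 1
    have S1: "S1 \<in> tableaux t m" using 1 by (simp add: bounded_iff)
    obtain q e where T: "target t m S1 k1 q e" and q: "q \<notin> diagram t m"
      and h: "\<not> fits t l q (fst e)" "home t m l k1 q e"
      using home_exists[OF m l 1(2-4)] by blast
    obtain n where n: "strict_partition n" "covers n m" "diagram t n = insert q (diagram t m)"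
      using add_corner[OF m target_corner[OF T q]] by blast
    have S': "S1(q \<mapsto> e) \<in> tableaux t n" by (rule target_lower[OF m n(1) S1 T n(3)])
    have "S1 q = None" using q tableaux_dom[OF S1] by (metis domIff)
    then have rem: "(S1(q \<mapsto> e))(q := None) = S1" by auto
    show ?thesis
      using pre[OF S' n q, of e] rem 1 h target_index[OF T] by simp
  next
    case 2
    have S': "S' \<in> tableaux t n" using 2 by (simp add: bounded_iff)
    obtain q where c: "corner t m q" and dn: "diagram t n = insert q (diagram t m)"
      using covers_corner[OF m 2(2,3)] by blast
    have q: "q \<notin> diagram t m" using c by (cases q) auto
    obtain e where e: "S' q = Some e" using dn tableaux_dom[OF S'] by blast
    have "S'(q := None) \<in> bounded_tableaux t m l \<and> fits t l q (fst e)"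
      using bounded_extend[OF S' dn q e tableaux_remove[OF m 2(2) S' dn q]] 2(4) by blast
    then show ?thesis using pre[OF S' 2(2,3) dn q e] 2(1) by simp
  qed
next
  fix x x' y assume x: "x \<in> pending_states t m l" and x': "x' \<in> pending_states t m l"
    and y: "round_step t m l x y" "round_step t m l x' y"
  have outcome: "\<exists>S' q e. insertion t S k S' \<and> S' q = Some e \<and> target t m (S'(q := None)) (var_index q e) q e \<and>
      q \<notin> diagram t m \<and> 1 \<le> var_index q e \<and>
      (y = Inr S' \<or> y = Inl (S'(q := None), var_index q e) \<and> home t m l (var_index q e) q e)"
    if "round_step t m l (Inl (S, k)) y" "S \<in> bounded_tableaux t m l" "1 \<le> k" for S k
    using round_outcome[OF m l that(2,3)] that(1) by metis
  obtain S k where S: "x = Inl (S, k)" "S \<in> bounded_tableaux t m l" "1 \<le> k"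
    using x by (auto simp: pending_states_def)
  obtain S0 k0 where S0: "x' = Inl (S0, k0)" "S0 \<in> bounded_tableaux t m l" "1 \<le> k0"
    using x' by (auto simp: pending_states_def)
  obtain S' q e where o: "insertion t S k S'" "S' q = Some e" "target t m (S'(q := None)) (var_index q e) q e"
      "q \<notin> diagram t m" "1 \<le> var_index q e"
      and yo: "y = Inr S' \<or> y = Inl (S'(q := None), var_index q e) \<and> home t m l (var_index q e) q e"
    using outcome[OF y(1)[unfolded S(1)] S(2,3)] by blast
  obtain S0' q0 e0 where o0: "insertion t S0 k0 S0'" "S0' q0 = Some e0" "target t m (S0'(q0 := None)) (var_index q0 e0) q0 e0"
      "q0 \<notin> diagram t m" "1 \<le> var_index q0 e0"
      and yo0: "y = Inr S0' \<or> y = Inl (S0'(q0 := None), var_index q0 e0) \<and> home t m l (var_index q0 e0) q0 e0"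
    using outcome[OF y(2)[unfolded S0(1)] S0(2,3)] by blast
  have "S' = S0'"
  proof (cases y)
    case (Inr S'')
    then show ?thesis using yo yo0 by simp
  next
    case (Inl s)
    then have eq: "S'(q := None) = S0'(q0 := None)" "var_index q e = var_index q0 e0"
      and h: "home t m l (var_index q e) q e" "home t m l (var_index q0 e0) q0 e0"
      using yo yo0 by auto
    have "diagonal t q \<Longrightarrow> diagonal_entry t e" "diagonal t q0 \<Longrightarrow> diagonal_entry t e0"
      using o(3) o0(3) by (cases q; cases q0; simp add: target.simps)+
    \<comment> \<open>The removed cell and its entry are not part of a rejected output, but the
      index carried on determines them as its home.\<close>
    then have "q = q0 \<and> e = e0"
      using home_unique[OF m l o(5) target_corner[OF o(3,4)] target_corner[OF o0(3,4)] h(1) h(2)[folded eq(2)] refl eq(2)[symmetric]]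
      by blast
    then show ?thesis using eq(1) o(2) o0(2) by (metis fun_upd_triv fun_upd_upd)
  qed
  then show "x = x'"
    using insertion_injective[OF m, of S t k S' S0 k0] o(1) o0(1) S S0 by (simp add: bounded_iff)
next
  show "x \<in> returned_states t m l \<Longrightarrow> x \<notin> pending_states t m l \<Longrightarrow> \<not> round_step t m l x y" for x y
    by (auto simp: returned_states_def pending_states_def round_step_def)
next
  fix w :: "nat set \<times> mpoly"
  show "finite {x \<in> pending_states t m l. round_inv x = w}"
  proof (cases "finite (fst w)")
    case True
    have "{x \<in> pending_states t m l. round_inv x = w} \<subseteq> Inl ` ({S \<in> tableaux t m. indices S \<subseteq> fst w} \<times> fst w)"
      by (auto simp: pending_states_def bounded_iff)
    then show ?thesis
      by (rule finite_subset) (simp add: finite_tableaux_indices[OF True] True)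
  next
    case False
    have "finite (fst (round_inv x))" if x: "x \<in> pending_states t m l" for x
      using x finite_indices tableaux_dom finite_diagram by (fastforce simp: pending_states_def bounded_iff)
    then have "{x \<in> pending_states t m l. round_inv x = w} = {}" using False by auto
    then show ?thesis by (simp only: finite.emptyI)
  qed
qed

lemma repeated_insertion_iff:
  "repeated_insertion t m l S k S' \<longleftrightarrow> (round_step t m l)\<^sup>*\<^sup>* (Inl (S, k)) (Inr S')"
proof
  assume "repeated_insertion t m l S k S'"
  then obtain y where y: "(rejected_round t m l)\<^sup>*\<^sup>* (S, k) y" "accepted_round t m l y S'"
    unfolding repeated_insertion_def by blast
  from y(1) have "(round_step t m l)\<^sup>*\<^sup>* (Inl (S, k)) (Inl y)"
    by (induction rule: rtranclp_induct) (auto simp: round_step_def intro: rtranclp.rtrancl_into_rtrancl)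
  moreover have "round_step t m l (Inl y) (Inr S')" using y(2) by (simp add: round_step_def)
  ultimately show "(round_step t m l)\<^sup>*\<^sup>* (Inl (S, k)) (Inr S')" by (rule rtranclp.rtrancl_into_rtrancl)
next
  assume "(round_step t m l)\<^sup>*\<^sup>* (Inl (S, k)) (Inr S')"
  moreover have "case x of Inl s \<Rightarrow> \<exists>y. (rejected_round t m l)\<^sup>*\<^sup>* s y \<and> accepted_round t m l y S' | Inr S'' \<Rightarrow> S'' = S'"
    if "(round_step t m l)\<^sup>*\<^sup>* x (Inr S')" for x
    using that
  proof (induction rule: converse_rtranclp_induct)
    case (step x z)
    then show ?case
      by (auto simp: round_step_def split: sum.splits intro: converse_rtranclp_into_rtranclp)
  qed simp
  from this[of "Inl (S, k)"] calculation show "repeated_insertion t m l S k S'"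
    unfolding sum.case repeated_insertion_def by blast
qed

text \<open>An infinite chain of rejected rounds is an infinite orbit of \<open>round_step\<close>
  inside the left summand.\<close>

lemma repeated_terminates:
  assumes m: "strict_partition m" and l: "strict_partition l"
    and S: "S \<in> bounded_tableaux t m l" and k: "k \<in> index_set t m l"
  shows "terminates (rejected_round t m l) (S, k)"
proof -
  have "Inl (S, k) \<in> pending_states t m l - returned_states t m l"
    using S k unfolding pending_minus_returned by blast
  then have "terminates (round_step t m l) (Inl (S, k))"
    by (rule partial_bijection.terminates[OF round_partial_bijection[OF m l]])
  moreover have "\<exists>g. g 0 = Inl (S, k) \<and> (\<forall>n. round_step t m l (g n) (g (Suc n)))"
    if "f 0 = (S, k)" "\<forall>n. rejected_round t m l (f n) (f (Suc n))" for f
    using that by (intro exI[of _ "\<lambda>n. Inl (f n)"]) (simp add: round_step_def)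
  ultimately show ?thesis unfolding terminates_def by blast
qed

lemma Psi_bij:
  assumes m: "strict_partition m" and l: "strict_partition l"
  shows "(\<forall>S\<in>bounded_tableaux t m l. \<forall>k\<in>index_set t m l.
             (\<exists>!S'. repeated_insertion t m l S k S') \<and> weight (Psi t m l (S, k)) = weight S * X k) \<and>
    bij_betw (Psi t m l) (bounded_tableaux t m l \<times> index_set t m l)
      (\<Union>n\<in>{n. strict_partition n \<and> covers n m \<and> contained n l}. bounded_tableaux t n l)"
    (is "?uniq \<and> bij_betw _ ?A ?C")
proof -
  interpret partial_bijection "round_step t m l" "pending_states t m l" "returned_states t m l" round_inv
    by (rule round_partial_bijection[OF m l])
  have start: "Inl (S, k) \<in> pending_states t m l - returned_states t m l"
    if "(S, k) \<in> ?A" for S k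
    using that unfolding pending_minus_returned by blast
  have final: "Inr S' \<in> returned_states t m l - pending_states t m l \<longleftrightarrow> S' \<in> ?C" for S'
    unfolding returned_minus_pending by blast
  have result: "S' \<in> ?C \<and> weight S' = weight S * X k"
    if "(S, k) \<in> ?A" "repeated_insertion t m l S k S'" for S k S'
  proof -
    have "Inr S' \<in> pending_states t m l \<union> returned_states t m l \<and> round_inv (Inr S') = round_inv (Inl (S, k))"
      using reachable[OF that(2)[unfolded repeated_insertion_iff]] start[OF that(1)] by blast
    moreover have "Inr S' \<notin> pending_states t m l" by (auto simp: pending_states_def)
    ultimately show ?thesis using final by auto
  qed
  have ex1: "\<exists>!S'. repeated_insertion t m l S k S'" if Sk: "(S, k) \<in> ?A" for S k
  proof -
    obtain S' where S': "repeated_insertion t m l S k S'"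
      using reaches_end[OF start[OF Sk]] unfolding returned_minus_pending repeated_insertion_iff by blast
    moreover have "S'' = S'" if "repeated_insertion t m l S k S''" for S''
      using end_unique[of "Inl (S, k)" "Inr S''" "Inr S'"] start[OF Sk] final result[OF Sk] S' that unfolding repeated_insertion_iff by blast
    ultimately show ?thesis by blast
  qed
  have Psi: "repeated_insertion t m l S k (Psi t m l (S, k))" if "(S, k) \<in> ?A" for S k
    unfolding Psi_def using theI'[OF ex1[OF that]] by simp
  have "bij_betw (Psi t m l) ?A ?C"
  proof (rule bij_betw_imageI)
    show "inj_on (Psi t m l) ?A"
    proof (rule inj_onI)
      fix x y assume x: "x \<in> ?A" and y: "y \<in> ?A" and eq: "Psi t m l x = Psi t m l y"
      have "Inl x = (Inl y :: _ + tableau)"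
        using start_unique[of "Inl x" "Inl y" "Inr (Psi t m l x)"] start x y Psi eq
        unfolding repeated_insertion_iff by (metis surj_pair)
      then show "x = y" by simp
    qed
    show "Psi t m l ` ?A = ?C"
    proof (intro equalityI subsetI)
      fix S' assume "S' \<in> Psi t m l ` ?A"
      then obtain x where x: "x \<in> ?A" "S' = Psi t m l x" by blast
      moreover obtain S k where "x = (S, k)" by force
      ultimately show "S' \<in> ?C" using result Psi by blast
    next
      fix S' assume "S' \<in> ?C"
      then obtain S k where Sk: "(S, k) \<in> ?A" "repeated_insertion t m l S k S'"
        using reached_from_start[of "Inr S'"] final unfolding pending_minus_returned repeated_insertion_iff by blast
      then have "S' = Psi t m l (S, k)" using Psi[OF Sk(1)] ex1[OF Sk(1)] by blast
      then show "S' \<in> Psi t m l ` ?A" using Sk(1) by blast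
    qed
  qed
  moreover have ?uniq using ex1 Psi result by blast
  ultimately show ?thesis by blast
qed

theorem theorem8:
  fixes l m :: "nat list" and t :: ttype
  assumes "strict_partition l" and "strict_partition m"
  shows "(\<forall>S p d k. admissible t m S p d k \<longrightarrow>
            (\<exists>!out. bump t (S, p, d, enat k) out) \<and>
            (\<forall>S' p' d' k'. bump t (S, p, d, enat k) (S', p', d', k') \<longrightarrow>
               (\<exists>n. strict_partition n \<and> S' \<in> tableaux t n)))
       \<and> ((\<forall>S\<in>tableaux t m. \<forall>k\<ge>1.
             terminates (bump t) (start S k) \<and>
             (\<exists>!S'. insertion t S k S') \<and>
             weight (psi t (S, k)) = weight S * X k) \<and>
          bij_betw (psi t) (tableaux t m \<times> {k. 1 \<le> k})
            (\<Union>n\<in>{n. strict_partition n \<and> covers n m}. tableaux t n))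
       \<and> ((\<forall>S\<in>bounded_tableaux t m l. \<forall>k\<in>index_set t m l.
             terminates (rejected_round t m l) (S, k) \<and>
             (\<exists>!S'. repeated_insertion t m l S k S') \<and>
             weight (Psi t m l (S, k)) = weight S * X k) \<and>
          bij_betw (Psi t m l) (bounded_tableaux t m l \<times> index_set t m l)
            (\<Union>n\<in>{n. strict_partition n \<and> covers n m \<and> contained n l}. bounded_tableaux t n l))"
proof (intro conjI)
  note l = assms(1) and m = assms(2)
  show "\<forall>S p d k. admissible t m S p d k \<longrightarrow>
            (\<exists>!out. bump t (S, p, d, enat k) out) \<and>
            (\<forall>S' p' d' k'. bump t (S, p, d, enat k) (S', p', d', k') \<longrightarrow>
               (\<exists>n. strict_partition n \<and> S' \<in> tableaux t n))"
    using bump_well_defined[OF m] by blast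
  show "bij_betw (psi t) (tableaux t m \<times> {k. 1 \<le> k})
            (\<Union>n\<in>{n. strict_partition n \<and> covers n m}. tableaux t n)"
    by (rule psi_bij[OF m])
  show "\<forall>S\<in>tableaux t m. \<forall>k\<ge>1. terminates (bump t) (start S k) \<and> (\<exists>!S'. insertion t S k S') \<and>
             weight (psi t (S, k)) = weight S * X k"
  proof (intro ballI allI impI)
    fix S and k :: nat assume S: "S \<in> tableaux t m" and k: "1 \<le> k"
    obtain S' where S': "insertion t S k S'" using insertion_exists[OF m S k] by blast
    then show "terminates (bump t) (start S k) \<and> (\<exists>!S'. insertion t S k S') \<and> weight (psi t (S, k)) = weight S * X k"
      using insertion_terminates[OF m S k] insertion_unique[OF m S k] insertion_result[OF m S k S'] psi_eq[OF m S k S']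
      by blast
  qed
  show "\<forall>S\<in>bounded_tableaux t m l. \<forall>k\<in>index_set t m l. terminates (rejected_round t m l) (S, k) \<and>
             (\<exists>!S'. repeated_insertion t m l S k S') \<and> weight (Psi t m l (S, k)) = weight S * X k"
    using Psi_bij[OF m l, of t] repeated_terminates[OF m l] by blast
  show "bij_betw (Psi t m l) (bounded_tableaux t m l \<times> index_set t m l)
            (\<Union>n\<in>{n. strict_partition n \<and> covers n m \<and> contained n l}. bounded_tableaux t n l)"
    using Psi_bij[OF m l, of t] by blast
qed

end
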